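(* Let $G_0$ and $G_1$ be abelian groups, each of which is a direct sum of indecomposable pure-injective abelian groups (equivalently, each is a direct sum of groups each isomorphic to one of: a finite cyclic group of prime-power order, $\mathbb{Z}_{p^\infty}$ for some prime $p$, $\mathbb{Q}$, or the additive group $\widehat{\mathbb{Z}_{(p)}}$ of $p$-adic integers for some prime $p$). If there exist a pure embedding $G_0 \to G_1$ and a pure embedding $G_1 \to G_0$, then $G_0 \cong G_1$.
   Context: A subgroup $H$ of an abelian group $G$ is pure if for all $h \in H$ and $n \in \mathbb{N}$, whenever $nx = h$ has a solution in $G$ it has one in $H$; an injective homomorphism is a pure embedding if its image is pure. An abelian group is pure-injective (algebraically compact) if every system of equations over it that is finitely solvable in it is solvable in it; it is indecomposable if it is nonzero and not a direct sum of two nonzero subgroups. $\mathbb{Z}_{p^\infty}$ is the subgroup of $\mathbb{Q}/\mathbb{Z}$ generated by $\{p^{-i} : i \in \mathbb{N}\}$, and $\widehat{\mathbb{Z}_{(p)}}$ is the completion of the localization $\mathbb{Z}_{(p)}$ in the $p$-adic topology. *)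

theory Defs
  imports "HOL-Algebra.Algebra"
begin

text \<open>
  Abelian groups are rendered as \<^locale>\<open>comm_group\<close>, hence written multiplicatively:
  \<open>x [^] n\<close> is the multiple \<open>n x\<close> and \<open>\<one>\<close> is the zero element.
\<close>

definition pure_subgroup :: "'a set \<Rightarrow> ('a, 'm) monoid_scheme \<Rightarrow> bool" where
  "pure_subgroup H G \<longleftrightarrow> subgroup H G \<and>
     (\<forall>h\<in>H. \<forall>n::nat. (\<exists>x\<in>carrier G. x [^]\<^bsub>G\<^esub> n = h) \<longrightarrow> (\<exists>x\<in>H. x [^]\<^bsub>G\<^esub> n = h))"

definition pure_embedding ::
  "('a, 'm) monoid_scheme \<Rightarrow> ('b, 'n) monoid_scheme \<Rightarrow> ('a \<Rightarrow> 'b) \<Rightarrow> bool" where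
  "pure_embedding G H f \<longleftrightarrow>
     f \<in> hom G H \<and> inj_on f (carrier G) \<and> pure_subgroup (f ` carrier G) H"

definition indecomposable :: "('a, 'm) monoid_scheme \<Rightarrow> bool" where
  "indecomposable G \<longleftrightarrow> carrier G \<noteq> {\<one>\<^bsub>G\<^esub>} \<and>
     \<not> (\<exists>H K. subgroup H G \<and> subgroup K G \<and> H \<noteq> {\<one>\<^bsub>G\<^esub>} \<and> K \<noteq> {\<one>\<^bsub>G\<^esub>} \<and>
          H \<inter> K = {\<one>\<^bsub>G\<^esub>} \<and> H <#>\<^bsub>G\<^esub> K = carrier G)"

text \<open>
  The pair \<open>(c, a)\<close> stands for the equation \<open>\<Sum>v. c v \<cdot> x\<^sub>v = a\<close> in unknowns \<open>x\<^sub>v\<close>, where the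
  integer coefficients \<open>c\<close> have finite support.
\<close>

type_synonym ('v, 'a) equation = "('v \<Rightarrow>\<^sub>0 int) \<times> 'a"

definition system_over :: "('a, 'm) monoid_scheme \<Rightarrow> ('v, 'a) equation set \<Rightarrow> bool" where
  "system_over G S \<longleftrightarrow> (\<forall>(c, a)\<in>S. a \<in> carrier G)"

definition solves ::
  "('a, 'm) monoid_scheme \<Rightarrow> ('v \<Rightarrow> 'a) \<Rightarrow> ('v, 'a) equation set \<Rightarrow> bool" where
  "solves G s S \<longleftrightarrow> s \<in> UNIV \<rightarrow> carrier G \<and>
     (\<forall>(c, a)\<in>S. (\<Otimes>\<^bsub>G\<^esub>v\<in>Poly_Mapping.keys c. s v [^]\<^bsub>G\<^esub> Poly_Mapping.lookup c v) = a)"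

definition solvable_in :: "('a, 'm) monoid_scheme \<Rightarrow> ('v, 'a) equation set \<Rightarrow> bool" where
  "solvable_in G S \<longleftrightarrow> (\<exists>s. solves G s S)"

definition finitely_solvable_in :: "('a, 'm) monoid_scheme \<Rightarrow> ('v, 'a) equation set \<Rightarrow> bool" where
  "finitely_solvable_in G S \<longleftrightarrow> (\<forall>F\<subseteq>S. finite F \<longrightarrow> solvable_in G F)"

text \<open>
  A definition cannot quantify over the type of unknowns. Taking the unknowns from \<^typ>\<open>'a + nat\<close>
  loses nothing: \<open>pure_injective_any_unknowns\<close> below shows that the property then holds for
  systems in unknowns of an arbitrary type.
\<close>

definition pure_injective :: "('a, 'm) monoid_scheme \<Rightarrow> bool" where
  "pure_injective G \<longleftrightarrow>
     (\<forall>S :: ('a + nat, 'a) equation set.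
        system_over G S \<longrightarrow> finitely_solvable_in G S \<longrightarrow> solvable_in G S)"

lemma rename_keys_exists:
  fixes c :: "'v \<Rightarrow>\<^sub>0 int" and f :: "'v \<Rightarrow> 'w"
  assumes "inj_on f (Poly_Mapping.keys c)"
  shows "\<exists>c'. Poly_Mapping.keys c' = f ` Poly_Mapping.keys c \<and>
           (\<forall>k\<in>Poly_Mapping.keys c. Poly_Mapping.lookup c' (f k) = Poly_Mapping.lookup c k)"
proof -
  let ?K = "Poly_Mapping.keys c"
  let ?h = "\<lambda>y. if y \<in> f ` ?K then Poly_Mapping.lookup c (inv_into ?K f y) else 0"
  have fin: "finite {y. ?h y \<noteq> 0}"
    by (rule finite_subset[of _ "f ` ?K"]) auto
  have l: "Poly_Mapping.lookup (Abs_poly_mapping ?h) = ?h"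
    using fin by (simp add: Abs_poly_mapping_inverse)
  have eq: "?h (f k) = Poly_Mapping.lookup c k" if "k \<in> ?K" for k
    using that assms by (simp add: inv_into_f_f)
  show ?thesis
  proof (intro exI conjI ballI)
    show "Poly_Mapping.keys (Abs_poly_mapping ?h) = f ` ?K"
    proof (intro Set.set_eqI iffI)
      fix y assume "y \<in> Poly_Mapping.keys (Abs_poly_mapping ?h)"
      then show "y \<in> f ` ?K" by (auto simp: in_keys_iff l split: if_splits)
    next
      fix y assume "y \<in> f ` ?K"
      then obtain k where k: "k \<in> ?K" "y = f k" by blast
      then show "y \<in> Poly_Mapping.keys (Abs_poly_mapping ?h)"
        using eq[OF k(1)] k(1) unfolding in_keys_iff l by metis
    qed
    show "Poly_Mapping.lookup (Abs_poly_mapping ?h) (f k) = Poly_Mapping.lookup c k" if "k \<in> ?K" for k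
      unfolding l using eq[OF that] .
  qed
qed

lemma unknowns_encoding:
  "\<exists>e :: (nat, 'a) equation list \<times> nat \<Rightarrow> 'a + nat. inj e"
proof -
  have "carrier (free_Abelian_group (UNIV :: nat set)) \<approx> (UNIV :: nat set)"
    by (rule eqpoll_free_Abelian_group_infinite) simp
  then have "(UNIV :: (nat \<Rightarrow>\<^sub>0 int) set) \<approx> (UNIV :: nat set)"
    by (simp add: free_Abelian_group_def)
  then obtain i :: "(nat \<Rightarrow>\<^sub>0 int) \<Rightarrow> nat" where i: "inj i"
    by (auto simp: eqpoll_def bij_betw_def)
  have inf: "infinite (UNIV :: ('a + nat) set)"
    by (simp add: UNIV_Plus_UNIV[symmetric] finite_Plus_iff del: UNIV_Plus_UNIV)
  have "|(UNIV :: ('a + nat) set) \<times> (UNIV :: ('a + nat) set)| =o |UNIV :: ('a + nat) set|"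
    by (rule card_of_Times_same_infinite[OF inf])
  then obtain p :: "('a + nat) \<times> ('a + nat) \<Rightarrow> 'a + nat" where p: "inj p"
    using card_of_ordIso[of "UNIV :: (('a + nat) \<times> ('a + nat)) set" "UNIV :: ('a + nat) set"]
    by (auto simp: bij_betw_def)
  have "|lists (UNIV :: ('a + nat) set)| =o |UNIV :: ('a + nat) set|"
    by (rule card_of_lists_infinite[OF inf])
  then obtain l :: "('a + nat) list \<Rightarrow> 'a + nat" where l: "inj l"
    using card_of_ordIso[of "UNIV :: ('a + nat) list set" "UNIV :: ('a + nat) set"]
    by (auto simp: bij_betw_def)
  let ?q = "\<lambda>(c, a). p (Inr (i c), Inl a)"
  have q: "inj ?q"
    by (rule injI) (auto dest!: injD[OF p] injD[OF i])
  have "inj (\<lambda>(xs, n). p (l (map ?q xs), Inr n))"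
    by (rule injI) (auto dest!: injD[OF p] injD[OF l] injD[OF inj_mapI[OF q]] simp del: map_eq_conv)
  then show ?thesis by blast
qed

context comm_group
begin

abbreviation lhs_value :: "('v \<Rightarrow> 'a) \<Rightarrow> ('v \<Rightarrow>\<^sub>0 int) \<Rightarrow> 'a" where
  "lhs_value s c \<equiv> \<Otimes>v\<in>Poly_Mapping.keys c. s v [^] Poly_Mapping.lookup c v"

lemma solves_eqD: "solves G s S \<Longrightarrow> (c, a) \<in> S \<Longrightarrow> lhs_value s c = a"
  by (auto simp: solves_def)

lemma lhs_value_cong:
  assumes "s' \<in> UNIV \<rightarrow> carrier G" "\<And>v. v \<in> Poly_Mapping.keys c \<Longrightarrow> s v = s' v"
  shows "lhs_value s c = lhs_value s' c"
  by (rule finprod_cong') (use assms in auto)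

lemma lhs_value_rename:
  assumes "inj_on f (Poly_Mapping.keys c)" "s \<in> UNIV \<rightarrow> carrier G"
    and "Poly_Mapping.keys c' = f ` Poly_Mapping.keys c"
    and "\<forall>k\<in>Poly_Mapping.keys c. Poly_Mapping.lookup c' (f k) = Poly_Mapping.lookup c k"
  shows "lhs_value s c' = lhs_value (s \<circ> f) c"
proof -
  have "lhs_value s c' = (\<Otimes>k\<in>Poly_Mapping.keys c. s (f k) [^] Poly_Mapping.lookup c' (f k))"
    unfolding assms(3) by (rule finprod_reindex) (use assms in auto)
  also have "\<dots> = lhs_value (s \<circ> f) c"
    by (rule finprod_cong') (use assms in auto)
  finally show ?thesis .
qed

lemma lhs_value_single:
  assumes "s \<in> UNIV \<rightarrow> carrier G"
  shows "lhs_value s (Poly_Mapping.single v 1) = s v"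
proof -
  have "s v \<in> carrier G" using assms by auto
  then show ?thesis by simp
qed

lemma finite_system_nat_unknowns:
  fixes F :: "('v, 'a) equation set"
  assumes "finite F"
  shows "\<exists>L :: (nat, 'a) equation list.
           {s 0 |s. solves G s (set L)} = {s v |s. solves G s F}"
proof -
  define V where "V = insert v (\<Union>(c, a)\<in>F. Poly_Mapping.keys c)"
  have "finite V" unfolding V_def using assms by auto
  then obtain r0 :: "'v \<Rightarrow> nat" where r0: "inj_on r0 V"
    using finite_imp_inj_to_nat_seg by blast
  define r where "r = (\<lambda>x. if x = v then 0 else Suc (r0 x))"
  have r: "inj_on r V" "r v = 0" using r0 by (auto simp: r_def inj_on_def)
  have rk: "inj_on r (Poly_Mapping.keys c)" if "(c, a) \<in> F" for c a
    by (rule inj_on_subset[OF r(1)]) (use that V_def in blast)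
  define R where "R c = (SOME c'. Poly_Mapping.keys c' = r ` Poly_Mapping.keys c \<and>
           (\<forall>k\<in>Poly_Mapping.keys c. Poly_Mapping.lookup c' (r k) = Poly_Mapping.lookup c k))"
    for c :: "'v \<Rightarrow>\<^sub>0 int"
  have R: "Poly_Mapping.keys (R c) = r ` Poly_Mapping.keys c \<and>
           (\<forall>k\<in>Poly_Mapping.keys c. Poly_Mapping.lookup (R c) (r k) = Poly_Mapping.lookup c k)"
    if "(c, a) \<in> F" for c a
    unfolding R_def by (rule someI_ex, rule rename_keys_exists, rule rk[OF that])
  obtain xs where xs: "set xs = F" using assms finite_list by blast
  define L where "L = map (\<lambda>(c, a). (R c, a)) xs"
  have L: "set L = {(R c, a) |c a. (c, a) \<in> F}"
    unfolding L_def by (auto simp: xs image_iff)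
  have val: "lhs_value s (R c) = lhs_value (s \<circ> r) c"
    if "(c, a) \<in> F" "s \<in> UNIV \<rightarrow> carrier G" for s c a
    using lhs_value_rename[OF rk[OF that(1)] that(2)] R[OF that(1)] by blast
  have eqv: "solves G s (set L) \<longleftrightarrow> solves G (s \<circ> r) F" if s: "s \<in> UNIV \<rightarrow> carrier G" for s
  proof -
    have 1: "lhs_value (s \<circ> r) c = a"
      if "\<forall>u\<in>set L. lhs_value s (fst u) = snd u" "(c, a) \<in> F" for c a
    proof -
      have "(R c, a) \<in> set L" using that(2) unfolding L by blast
      then have "lhs_value s (R c) = a" using that(1) by force
      then show ?thesis unfolding val[OF that(2) s] .
    qed
    have 2: "lhs_value s c = a"
      if h: "\<forall>u\<in>F. lhs_value (s \<circ> r) (fst u) = snd u" and u: "(c, a) \<in> set L" for c a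
    proof -
      obtain d where d: "c = R d" "(d, a) \<in> F" using u unfolding L by blast
      have "lhs_value (s \<circ> r) d = a" using h d(2) by force
      then show ?thesis unfolding d(1) val[OF d(2) s] .
    qed
    have sr: "s \<circ> r \<in> UNIV \<rightarrow> carrier G" using s by auto
    show ?thesis
    proof
      assume "solves G s (set L)"
      then have "\<forall>u\<in>set L. lhs_value s (fst u) = snd u" by (simp add: solves_def split_beta)
      from 1[OF this] show "solves G (s \<circ> r) F" unfolding solves_def using sr by blast
    next
      assume "solves G (s \<circ> r) F"
      then have "\<forall>u\<in>F. lhs_value (s \<circ> r) (fst u) = snd u" by (simp add: solves_def split_beta)
      from 2[OF this] show "solves G s (set L)" unfolding solves_def using s by blast
    qed
  qed
  have "{s 0 |s. solves G s (set L)} = {s v |s. solves G s F}"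
  proof (intro Set.set_eqI iffI)
    fix y assume "y \<in> {s 0 |s. solves G s (set L)}"
    then obtain s where s: "solves G s (set L)" "y = s 0" by blast
    then have "s \<in> UNIV \<rightarrow> carrier G" by (simp add: solves_def)
    from s(1)[unfolded eqv[OF this]] have "solves G (s \<circ> r) F" .
    moreover have "y = (s \<circ> r) v" using s r by simp
    ultimately show "y \<in> {s v |s. solves G s F}" by blast
  next
    fix y assume "y \<in> {s v |s. solves G s F}"
    then obtain s where s: "solves G s F" "y = s v" by blast
    define s' where "s' n = (if n \<in> r ` V then s (inv_into V r n) else \<one>)" for n
    have s'c: "s' \<in> UNIV \<rightarrow> carrier G" using s(1) by (auto simp: s'_def solves_def)
    have s'r: "s' (r x) = s x" if "x \<in> V" for x
      using that r(1) by (simp add: s'_def inv_into_f_f)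
    have sc: "s \<in> UNIV \<rightarrow> carrier G" using s(1) by (simp add: solves_def)
    have "lhs_value (s' \<circ> r) c = a" if "(c, a) \<in> F" for c a
    proof -
      have "lhs_value (s' \<circ> r) c = lhs_value s c"
        by (rule lhs_value_cong[OF sc]) (use that s'r in \<open>auto simp: V_def\<close>)
      then show ?thesis using s(1) that by (auto simp: solves_def)
    qed
    then have "solves G (s' \<circ> r) F" using s'c by (auto simp: solves_def)
    then have "solves G s' (set L)" using eqv[OF s'c] by simp
    moreover have "y = s' 0" using s'r[of v] s(2) r(2) by (simp add: V_def)
    ultimately show "y \<in> {s 0 |s. solves G s (set L)}" by blast
  qed
  then show ?thesis by blast
qed

lemma pure_injective_common_value:
  fixes T :: "('v, 'a) equation set"
  assumes pi: "pure_injective G" and T: "finitely_solvable_in G T"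
  shows "\<exists>a. \<forall>F\<subseteq>T. finite F \<longrightarrow> (\<exists>s. solves G s F \<and> s v = a)"
proof -
  obtain e :: "(nat, 'a) equation list \<times> nat \<Rightarrow> 'a + nat" where e: "inj e"
    using unknowns_encoding by blast
  define g where "g L n = (if n = 0 then e ([], 0) else e (L, n))" for L n
  have g: "inj_on (g L) A" for L A
    using e by (auto simp: g_def inj_on_def inj_def)
  define R where "R L c = (SOME c'. Poly_Mapping.keys c' = g L ` Poly_Mapping.keys c \<and>
           (\<forall>k\<in>Poly_Mapping.keys c. Poly_Mapping.lookup c' (g L k) = Poly_Mapping.lookup c k))"
    for L and c :: "nat \<Rightarrow>\<^sub>0 int"
  have R: "Poly_Mapping.keys (R L c) = g L ` Poly_Mapping.keys c \<and>
           (\<forall>k\<in>Poly_Mapping.keys c. Poly_Mapping.lookup (R L c) (g L k) = Poly_Mapping.lookup c k)" for L c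
    unfolding R_def by (rule someI_ex, rule rename_keys_exists, rule g)
  have val: "lhs_value s (R L c) = lhs_value (s \<circ> g L) c" if "s \<in> UNIV \<rightarrow> carrier G" for s L c
    by (rule lhs_value_rename[OF g that conjunct1[OF R] conjunct2[OF R]])
  define D where "D F = {s v |s. solves G s F}" for F :: "('v, 'a) equation set"
  define D' where "D' L = {s 0 |s. solves G s (set L)}" for L :: "(nat, 'a) equation list"
  define E where "E = {L. \<exists>F\<subseteq>T. finite F \<and> D' L = D F}"
  define U where "U = {(R L c, a) |L c a. L \<in> E \<and> (c, a) \<in> set L}"
  have "\<forall>L\<in>E. \<exists>F\<subseteq>T. finite F \<and> D' L = D F" by (simp add: E_def)
  then obtain \<phi> where \<phi>: "\<And>L. L \<in> E \<Longrightarrow> \<phi> L \<subseteq> T \<and> finite (\<phi> L) \<and> D' L = D (\<phi> L)"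
    by metis
  have sys: "system_over G U"
    unfolding system_over_def
  proof clarify
    fix c a assume "(c, a) \<in> U"
    then obtain L c' where L: "L \<in> E" "(c', a) \<in> set L" by (auto simp: U_def)
    then have "D (\<phi> L) \<noteq> {}"
      using \<phi>[OF L(1)] T unfolding finitely_solvable_in_def solvable_in_def D_def by blast
    then obtain s where s: "solves G s (set L)"
      using \<phi>[OF L(1)] by (auto simp: D'_def)
    then have "lhs_value s c' = a" "s \<in> UNIV \<rightarrow> carrier G" using L(2) by (auto simp: solves_def)
    moreover have "lhs_value s c' \<in> carrier G"
      using calculation(2) by (intro finprod_closed) auto
    ultimately show "a \<in> carrier G" by simp
  qed
  have fsol: "finitely_solvable_in G U"
    unfolding finitely_solvable_in_def
  proof (intro allI impI)
    fix U' assume U': "U' \<subseteq> U" "finite U'"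
    have "\<forall>u\<in>U'. \<exists>L. L \<in> E \<and> (\<exists>c a. u = (R L c, a) \<and> (c, a) \<in> set L)"
      using U'(1) by (fastforce simp: U_def)
    then obtain w where w: "\<And>u. u \<in> U' \<Longrightarrow> w u \<in> E \<and> (\<exists>c a. u = (R (w u) c, a) \<and> (c, a) \<in> set (w u))"
      by metis
    define E' where "E' = w ` U'"
    have E': "finite E'" "E' \<subseteq> E" using U'(2) w by (auto simp: E'_def)
    have "finite (\<Union>L\<in>E'. \<phi> L)" "(\<Union>L\<in>E'. \<phi> L) \<subseteq> T" using E' \<phi> by blast+
    then obtain s where s: "solves G s (\<Union>L\<in>E'. \<phi> L)"
      using T unfolding finitely_solvable_in_def solvable_in_def by blast
    have "\<forall>L\<in>E'. \<exists>t. solves G t (set L) \<and> t 0 = s v"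
    proof
      fix L assume L: "L \<in> E'"
      then have "solves G s (\<phi> L)" using s by (auto simp: solves_def)
      then have "s v \<in> D (\<phi> L)" by (auto simp: D_def)
      then have "s v \<in> D' L" using \<phi> L E' by blast
      then show "\<exists>t. solves G t (set L) \<and> t 0 = s v" by (auto simp: D'_def)
    qed
    then obtain \<sigma> where \<sigma>: "\<And>L. L \<in> E' \<Longrightarrow> solves G (\<sigma> L) (set L) \<and> \<sigma> L 0 = s v"
      by metis
    define t where "t x = (let (L, n) = inv_into UNIV e x in if n = 0 \<or> L \<notin> E' then s v else \<sigma> L n)" for x
    have sc: "s \<in> UNIV \<rightarrow> carrier G" using s by (simp add: solves_def)
    have \<sigma>c: "\<sigma> L \<in> UNIV \<rightarrow> carrier G" if "L \<in> E'" for L using \<sigma>[OF that] by (simp add: solves_def)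
    have tc: "t \<in> UNIV \<rightarrow> carrier G"
      using funcset_mem[OF sc] funcset_mem[OF \<sigma>c] by (auto simp: t_def Let_def split: prod.splits)
    have tg: "t \<circ> g L = \<sigma> L" if "L \<in> E'" for L
    proof
      fix n show "(t \<circ> g L) n = \<sigma> L n"
        using that \<sigma>[OF that] by (simp add: t_def g_def inv_f_f[OF e])
    qed
    have "solves G t U'"
      unfolding solves_def
    proof (intro conjI tc ballI, clarify)
      fix c a assume u: "(c, a) \<in> U'"
      define L where "L = w (c, a)"
      have L: "L \<in> E'" using u by (simp add: L_def E'_def)
      obtain d where d: "c = R L d" "(d, a) \<in> set L" using w[OF u] by (auto simp: L_def)
      have "lhs_value t c = lhs_value (\<sigma> L) d" unfolding d(1) val[OF tc] tg[OF L] ..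
      also have "\<dots> = a" using \<sigma>[OF L] d(2) by (auto simp: solves_def)
      finally show "lhs_value t c = a" .
    qed
    then show "solvable_in G U'" unfolding solvable_in_def by blast
  qed
  obtain t where t: "solves G t U"
    using pi sys fsol unfolding pure_injective_def solvable_in_def by blast
  have tc: "t \<in> UNIV \<rightarrow> carrier G" using t by (simp add: solves_def)
  have "\<exists>s. solves G s F \<and> s v = t (e ([], 0))" if F: "F \<subseteq> T" "finite F" for F
  proof -
    obtain L where L: "D' L = D F"
      using finite_system_nat_unknowns[OF F(2), of v] unfolding D_def D'_def by blast
    then have LE: "L \<in> E" using F by (auto simp: E_def)
    have "lhs_value (t \<circ> g L) c = a" if "(c, a) \<in> set L" for c a
    proof -
      have "(R L c, a) \<in> U" using that LE by (auto simp: U_def)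
      then have "lhs_value t (R L c) = a" using t by (auto simp: solves_def)
      then show ?thesis unfolding val[OF tc] .
    qed
    then have "solves G (t \<circ> g L) (set L)" using tc by (auto simp: solves_def)
    then have "(t \<circ> g L) 0 \<in> D' L" unfolding D'_def by blast
    then show ?thesis unfolding L D_def by (auto simp: g_def)
  qed
  then show ?thesis by blast
qed

theorem pure_injective_any_unknowns:
  fixes S :: "('v, 'a) equation set"
  assumes pi: "pure_injective G" and S: "finitely_solvable_in G S"
  shows "solvable_in G S"
proof -
  define Fam where "Fam = {T. S \<subseteq> T \<and> finitely_solvable_in G T}"
  have "\<exists>M\<in>Fam. \<forall>Y\<in>Fam. M \<subseteq> Y \<longrightarrow> Y = M"
  proof (rule subset_Zorn_nonempty)
    show "Fam \<noteq> {}" using S by (auto simp: Fam_def)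
  next
    fix Ch assume ne: "Ch \<noteq> {}" and ch: "subset.chain Fam Ch"
    have sub: "Ch \<subseteq> Fam" using ch by (simp add: subset_chain_def)
    have "solvable_in G F" if F: "F \<subseteq> \<Union>Ch" "finite F" for F
    proof -
      obtain Y where "Y \<in> Ch" "F \<subseteq> Y"
        using finite_subset_Union_chain[OF F(2,1) ne ch] by blast
      then show ?thesis using sub F(2) by (auto simp: Fam_def finitely_solvable_in_def)
    qed
    moreover have "S \<subseteq> \<Union>Ch" using ne sub unfolding Fam_def by blast
    ultimately show "\<Union>Ch \<in> Fam" by (simp add: Fam_def finitely_solvable_in_def)
  qed
  then obtain T where T: "S \<subseteq> T" "finitely_solvable_in G T"
    and max: "\<And>Y. \<lbrakk>T \<subseteq> Y; finitely_solvable_in G Y\<rbrakk> \<Longrightarrow> Y = T"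
    by (auto simp: Fam_def)
  have "\<exists>a. (Poly_Mapping.single v 1, a) \<in> T" for v
  proof -
    obtain a where a: "\<And>F. \<lbrakk>F \<subseteq> T; finite F\<rbrakk> \<Longrightarrow> \<exists>s. solves G s F \<and> s v = a"
      using pure_injective_common_value[OF pi T(2)] by blast
    let ?u = "(Poly_Mapping.single v 1, a)"
    have "finitely_solvable_in G (insert ?u T)"
      unfolding finitely_solvable_in_def
    proof (intro allI impI)
      fix F assume F: "F \<subseteq> insert ?u T" "finite F"
      obtain s where s: "solves G s (F - {?u})" "s v = a"
        using a[of "F - {?u}"] F by blast
      have sc: "s \<in> UNIV \<rightarrow> carrier G" using s by (simp add: solves_def)
      have "solves G s F"
        unfolding solves_def
      proof (intro conjI sc ballI, clarify)
        fix c b assume cb: "(c, b) \<in> F"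
        show "lhs_value s c = b"
        proof (cases "(c, b) = ?u")
          case True
          then show ?thesis using lhs_value_single[OF sc, of v] s(2) by simp
        next
          case False
          then have "(c, b) \<in> F - {?u}" using cb by blast
          from solves_eqD[OF s(1) this] show ?thesis .
        qed
      qed
      then show "solvable_in G F" unfolding solvable_in_def by blast
    qed
    then have "insert ?u T = T" using max by blast
    then show ?thesis by blast
  qed
  then obtain \<sigma> where \<sigma>: "\<And>v. (Poly_Mapping.single v 1, \<sigma> v) \<in> T" by metis
  have agree: "\<exists>s. solves G s F \<and> (\<forall>v\<in>W. s v = \<sigma> v)" if "F \<subseteq> T" "finite F" "finite W" for F W
  proof -
    let ?F = "F \<union> (\<lambda>v. (Poly_Mapping.single v 1, \<sigma> v)) ` W"
    have "?F \<subseteq> T" "finite ?F" using that \<sigma> by auto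
    then obtain s where s: "solves G s ?F"
      using T(2) unfolding finitely_solvable_in_def solvable_in_def by blast
    have sc: "s \<in> UNIV \<rightarrow> carrier G" using s by (simp add: solves_def)
    have "s v = \<sigma> v" if "v \<in> W" for v
    proof -
      have "lhs_value s (Poly_Mapping.single v 1) = \<sigma> v"
        by (rule solves_eqD[OF s]) (use that in blast)
      then show ?thesis using lhs_value_single[OF sc, of v] by simp
    qed
    moreover have "solves G s F" using s by (auto simp: solves_def)
    ultimately show ?thesis by blast
  qed
  have \<sigma>c: "\<sigma> \<in> UNIV \<rightarrow> carrier G"
  proof
    fix v
    obtain s where s: "solves G s {}" "s v = \<sigma> v" using agree[of "{}" "{v}"] by auto
    have "s \<in> UNIV \<rightarrow> carrier G" using s(1) by (simp add: solves_def)
    then have "s v \<in> carrier G" by blast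
    then show "\<sigma> v \<in> carrier G" using s(2) by simp
  qed
  have "lhs_value \<sigma> c = a" if "(c, a) \<in> S" for c a
  proof -
    have "(c, a) \<in> T" using that T(1) by blast
    then obtain s where s: "solves G s {(c, a)}" "\<And>v. v \<in> Poly_Mapping.keys c \<Longrightarrow> s v = \<sigma> v"
      using agree[of "{(c, a)}" "Poly_Mapping.keys c"] by auto
    have "lhs_value s c = lhs_value \<sigma> c" by (rule lhs_value_cong[OF \<sigma>c s(2)])
    then show ?thesis using s(1) by (simp add: solves_def)
  qed
  then have "solves G \<sigma> S" using \<sigma>c by (auto simp: solves_def)
  then show ?thesis unfolding solvable_in_def by blast
qed

end

end

theory Submission
  imports Defs
begin

text \<open>
  An indecomposable pure-injective abelian group is, up to isomorphism, cyclic of prime power order,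
  a Pruefer group, the rationals, or the \<open>p\<close>-adic integers: elements of prime order and finite height
  span a cyclic direct summand, divisible subgroups are direct summands, and in the remaining
  torsion-free case solvability of systems of congruences splits off first the part that is
  \<open>p\<close>-divisible and then a complement of the \<open>p\<close>-adic closure of an element outside \<open>p G\<close>.
  For each of these kinds there is an invariant, the dimension of a vector space which is a
  subquotient of the group, which is additive on direct sums, equal to one on its own kind and zero on
  the other kinds (for the cyclic groups these are the Ulm-Kaplansky invariants). The subquotients are
  functorial, and pure embeddings induce injections on them. Mutual pure embeddings therefore give
  injections in both directions between the sets of summands of each kind, and the
  Schroeder-Bernstein theorem matches the summands.
\<close>

text \<open>A direct sum of infinitely many pure-injective groups need not be pure-injective, so the
  image of a pure embedding need not be a direct summand, and no Schroeder-Bernstein argument can be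
  run on the groups themselves; it is run on the index sets. This dictates the form of the
  invariants: homomorphisms must preserve the top and the bottom of each subquotient, and pure
  embeddings must also pull the bottom back. Subgroups cut out by equations
  \<open>x [^] m = \<one>\<close> are pulled back by injectivity, those cut out by divisibility of a
  single element by purity. Hence the first Ulm subgroup takes the place of the largest divisible
  subgroup, whose description needs infinitely many linked roots. Dimensions are never formed as
  cardinals: an independent family is injected into a spanning one, which covers finite and infinite
  multiplicities alike. Nor is a concrete Pruefer group or ring of p-adic integers built: a kind is
  an intrinsic description, and groups of one kind are matched by a relation that turns out to be
  the graph of an isomorphism.\<close>

hide_const (open) Divisibility.prime

section \<open>Powers, complements and congruences\<close>

definition powers :: "('a, 'm) monoid_scheme \<Rightarrow> int \<Rightarrow> 'a set" where
  "powers G n = (\<lambda>x. x [^]\<^bsub>G\<^esub> n) ` carrier G"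

definition cyclic :: "('a, 'm) monoid_scheme \<Rightarrow> 'a \<Rightarrow> 'a set" where
  "cyclic G a = range (\<lambda>k::int. a [^]\<^bsub>G\<^esub> k)"

definition torsion_free :: "('a, 'm) monoid_scheme \<Rightarrow> bool" where
  "torsion_free G \<longleftrightarrow> (\<forall>x\<in>carrier G. \<forall>n::int. n \<noteq> 0 \<longrightarrow> x [^]\<^bsub>G\<^esub> n = \<one>\<^bsub>G\<^esub> \<longrightarrow> x = \<one>\<^bsub>G\<^esub>)"

lemma powersI: "x \<in> carrier G \<Longrightarrow> x [^]\<^bsub>G\<^esub> n \<in> powers G n"
  by (simp add: powers_def)

lemma powersE:
  assumes "y \<in> powers G n"
  obtains x where "x \<in> carrier G" "y = x [^]\<^bsub>G\<^esub> n"
  using assms by (auto simp: powers_def)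

lemma cyclicI: "a [^]\<^bsub>G\<^esub> (k::int) \<in> cyclic G a"
  by (simp add: cyclic_def)

lemma set_multI: "h \<in> H \<Longrightarrow> k \<in> K \<Longrightarrow> h \<otimes>\<^bsub>G\<^esub> k \<in> H <#>\<^bsub>G\<^esub> K"
  by (auto simp: set_mult_def)

lemma set_multE:
  assumes "x \<in> H <#>\<^bsub>G\<^esub> K"
  obtains h k where "h \<in> H" "k \<in> K" "x = h \<otimes>\<^bsub>G\<^esub> k"
  using assms by (auto simp: set_mult_def)

context group
begin

lemma subgroup_Union_chain:
  assumes "C \<noteq> {}" "\<And>H. H \<in> C \<Longrightarrow> subgroup H G"
    and ch: "\<And>H K. H \<in> C \<Longrightarrow> K \<in> C \<Longrightarrow> H \<subseteq> K \<or> K \<subseteq> H"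
  shows "subgroup (\<Union>C) G"
proof (rule subgroupI)
  show "\<Union>C \<subseteq> carrier G" using assms(2) subgroup.subset by blast
  show "\<Union>C \<noteq> {}" using assms(1,2) subgroup.one_closed by blast
  show "inv x \<in> \<Union>C" if "x \<in> \<Union>C" for x
    using that assms(2) subgroup.m_inv_closed by (metis UnionE UnionI)
  show "x \<otimes> y \<in> \<Union>C" if xy: "x \<in> \<Union>C" "y \<in> \<Union>C" for x y
  proof -
    obtain H K where HK: "H \<in> C" "x \<in> H" "K \<in> C" "y \<in> K" using xy by blast
    then have "\<exists>L\<in>C. x \<in> L \<and> y \<in> L" using ch by blast
    then show ?thesis using assms(2) subgroup.m_closed by (metis UnionI)
  qed
qed

text \<open>The forbidden set is arbitrary because two different ones are needed: the nontrivial
  elements of a subgroup when a complement is built, and the set \<open>Bad\<close> of the adic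
  case, which encodes a condition on all p-adic levels at once.\<close>

lemma maximal_subgroup_avoiding:
  assumes K0: "subgroup K0 G" "K0 \<inter> Y = {}"
  obtains K where "subgroup K G" "K0 \<subseteq> K" "K \<inter> Y = {}"
    "\<And>L. subgroup L G \<Longrightarrow> K \<subseteq> L \<Longrightarrow> L \<inter> Y = {} \<Longrightarrow> L = K"
proof -
  define Fam where "Fam = {L. subgroup L G \<and> K0 \<subseteq> L \<and> L \<inter> Y = {}}"
  have "\<exists>M\<in>Fam. \<forall>L\<in>Fam. M \<subseteq> L \<longrightarrow> L = M"
  proof (rule subset_Zorn_nonempty)
    show "Fam \<noteq> {}" using K0 by (auto simp: Fam_def)
    fix C assume C: "C \<noteq> {}" "subset.chain Fam C"
    have sub: "C \<subseteq> Fam" and ch: "\<And>H K. H \<in> C \<Longrightarrow> K \<in> C \<Longrightarrow> H \<subseteq> K \<or> K \<subseteq> H"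
      using C(2) by (auto simp: subset_chain_def)
    have "subgroup (\<Union>C) G"
      by (rule subgroup_Union_chain[OF C(1)]) (use sub ch in \<open>auto simp: Fam_def\<close>)
    then show "\<Union>C \<in> Fam" using sub C(1) by (auto simp: Fam_def)
  qed
  then show thesis using that by (auto simp: Fam_def)
qed

end

context comm_group
begin

lemma subgroup_powers: "subgroup (powers G n) G"
proof (rule subgroupI)
  show "inv x \<in> powers G n" if "x \<in> powers G n" for x
    using that by (elim powersE) (auto simp: int_pow_inv[symmetric] intro: powersI)
  show "x \<otimes> y \<in> powers G n" if "x \<in> powers G n" "y \<in> powers G n" for x y
    using that by (elim powersE) (auto simp: int_pow_distrib[symmetric] intro: powersI)
qed (auto simp: powers_def)

lemma subgroup_cyclic:
  assumes a: "a \<in> carrier G"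
  shows "subgroup (cyclic G a) G"
proof (rule subgroupI)
  show "inv x \<in> cyclic G a" if "x \<in> cyclic G a" for x
    using that a by (auto simp: cyclic_def int_pow_neg[symmetric])
  show "x \<otimes> y \<in> cyclic G a" if "x \<in> cyclic G a" "y \<in> cyclic G a" for x y
    using that a by (auto simp: cyclic_def int_pow_mult[symmetric])
qed (use a in \<open>auto simp: cyclic_def\<close>)

lemma set_mult_upper1: "subgroup H G \<Longrightarrow> subgroup K G \<Longrightarrow> H \<subseteq> H <#> K"
  using set_multI[of _ H \<one> K G] subgroup.one_closed[of K G] subgroup.mem_carrier[of H G] by force

lemma set_mult_upper2: "subgroup H G \<Longrightarrow> subgroup K G \<Longrightarrow> K \<subseteq> H <#> K"
  using set_multI[of \<one> H _ K G] subgroup.one_closed[of H G] subgroup.mem_carrier[of K G] by force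

lemma self_in_cyclic: "a \<in> carrier G \<Longrightarrow> a \<in> cyclic G a"
  by (metis cyclicI int_pow_1)

lemma powers_mono: "m dvd n \<Longrightarrow> powers G n \<subseteq> powers G m"
proof
  fix x assume "m dvd n" "x \<in> powers G n"
  then obtain k y where "n = k * m" "y \<in> carrier G" "x = y [^] n"
    by (metis dvd_def mult.commute powersE)
  then show "x \<in> powers G m"
    by (metis int_pow_closed int_pow_pow powersI)
qed

lemma powers_one: "powers G 1 = carrier G"
  by (force simp: powers_def)

text \<open>With \<open>u * m + v * n = 1\<close>, split \<open>x\<close> as
  \<open>x [^] (u * m) \<otimes> x [^] (v * n)\<close>; inserting the n-th root into the first
  factor and the m-th root into the second makes both of them powers with exponent
  \<open>m * n\<close>.\<close>

lemma powers_mult_coprime: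
  assumes "coprime m n" "x \<in> powers G m" "x \<in> powers G n"
  shows "x \<in> powers G (m * n)"
proof -
  obtain y z where y: "y \<in> carrier G" "x = y [^] m" and z: "z \<in> carrier G" "x = z [^] n"
    using assms by (metis powersE)
  obtain u v where uv: "u * m + v * n = 1"
    using assms(1) by (metis bezout_int coprime_iff_gcd_eq_1)
  have x: "x \<in> carrier G" using y by simp
  have "x = x [^] (u * m) \<otimes> x [^] (v * n)"
    using x uv by (simp add: int_pow_mult[symmetric])
  also have "x [^] (u * m) = (z [^] u) [^] (m * n)"
    using z by (simp add: int_pow_pow mult_ac)
  also have "x [^] (v * n) = (y [^] v) [^] (m * n)"
    using y by (simp add: int_pow_pow mult_ac)
  also have "(z [^] u) [^] (m * n) \<otimes> (y [^] v) [^] (m * n) = (z [^] u \<otimes> y [^] v) [^] (m * n)"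
    using y z by (simp add: int_pow_distrib)
  finally show ?thesis using y z by (auto intro: powersI)
qed

lemma subgroup_pow_dvd:
  assumes "subgroup S G" "a \<in> carrier G" "a [^] (m::int) \<in> S" "m dvd n"
  shows "a [^] n \<in> S"
  using assms by (metis dvdE int_pow_pow subgroup_int_pow_closed)

lemma subgroup_pow_add:
  assumes "subgroup S G" "a \<in> carrier G" "a [^] (m::int) \<in> S" "a [^] n \<in> S"
  shows "a [^] (m + n) \<in> S"
  using assms by (simp add: int_pow_mult subgroup.m_closed)

lemma subgroup_pow_gcd:
  assumes "subgroup S G" "a \<in> carrier G" "a [^] (m::int) \<in> S" "a [^] n \<in> S"
  shows "a [^] gcd m n \<in> S"
proof -
  obtain u v where "u * m + v * n = gcd m n" using bezout_int by blast
  moreover have "a [^] (u * m) \<in> S" "a [^] (v * n) \<in> S"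
    using assms by (auto intro: subgroup_pow_dvd)
  ultimately show ?thesis using subgroup_pow_add[OF assms(1,2)] by metis
qed

lemma subgroup_pow_coprime:
  assumes "subgroup S G" "a \<in> carrier G" "a [^] (m::int) \<in> S" "a [^] n \<in> S" "coprime m n"
  shows "a \<in> S"
  using subgroup_pow_gcd[OF assms(1-4)] assms(2,5) by simp

text \<open>The exponents sending \<open>a\<close> into \<open>S\<close> form an ideal, and the gcd
  of \<open>k\<close> and \<open>p ^ Suc n\<close> is some \<open>p ^ j\<close> with
  \<open>j \<le> n\<close>. With trivial \<open>S\<close> this computes orders, with a group of
  powers as \<open>S\<close> it computes heights.\<close>

lemma subgroup_pow_primepow:
  fixes p :: int
  assumes S: "subgroup S G" "a \<in> carrier G" "a [^] k \<in> S" "a [^] (p ^ Suc n) \<in> S"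
    and p: "prime p" "\<not> p ^ Suc n dvd k"
  shows "a [^] (p ^ n) \<in> S"
proof -
  have "gcd k (p ^ Suc n) dvd p ^ Suc n" by simp
  then obtain j where j: "j \<le> Suc n" "normalize (gcd k (p ^ Suc n)) = normalize (p ^ j)"
    using p(1) divides_primepow_weak[of p _ "Suc n"] by blast
  then have g: "gcd k (p ^ Suc n) = p ^ j"
    using prime_ge_0_int[OF p(1)] by simp
  have "j \<noteq> Suc n" using g p(2) by (metis gcd_dvd1)
  then have "p ^ j dvd p ^ n" using j(1) by (simp add: le_imp_power_dvd)
  then show ?thesis using subgroup_pow_gcd[OF S] g S by (metis subgroup_pow_dvd)
qed

text \<open>Induction on the prime factors of \<open>n\<close>. It is what allows divisibility and
  torsion to be tested at prime exponents only.\<close>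

lemma subgroup_prime_root_closed:
  fixes n :: int
  assumes S: "subgroup S G"
    and root: "\<And>x p::int. x \<in> carrier G \<Longrightarrow> prime p \<Longrightarrow> x [^] p \<in> S \<Longrightarrow> x \<in> S"
  shows "n \<noteq> 0 \<Longrightarrow> x \<in> carrier G \<Longrightarrow> x [^] n \<in> S \<Longrightarrow> x \<in> S"
proof (induction n arbitrary: x rule: prime_divisors_induct)
  case (unit n)
  then have "coprime n n" by (simp add: is_unit_left_imp_coprime)
  then show ?case using unit subgroup_pow_coprime[OF S] by blast
next
  case (factor p n)
  then have "(x [^] n) [^] p \<in> S" by (simp add: int_pow_pow mult.commute)
  then have "x [^] n \<in> S" using root[OF int_pow_closed factor(1)] factor(4) by blast
  moreover have "n \<noteq> 0" using factor(3) by auto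
  ultimately show ?case using factor(2) factor(4) by blast
qed simp

lemma powers_eq_carrier_if_prime:
  fixes n :: int
  assumes "\<And>p::int. prime p \<Longrightarrow> powers G p = carrier G"
  shows "n \<noteq> 0 \<Longrightarrow> powers G n = carrier G"
proof (induction n rule: prime_divisors_induct)
  case (unit n)
  then have "powers G 1 \<subseteq> powers G n" by (intro powers_mono)
  then show ?case using powers_one subgroup.subset[OF subgroup_powers] by blast
next
  case (factor p n)
  have "x \<in> powers G (p * n)" if x: "x \<in> carrier G" for x
  proof -
    obtain y where y: "y \<in> carrier G" "x = y [^] p" using x assms[OF factor(1)] by (metis powersE)
    moreover obtain z where z: "z \<in> carrier G" "y = z [^] n" using y factor by (metis mult_zero_right powersE)
    ultimately have "x = z [^] (p * n)" by (simp add: int_pow_pow mult.commute)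
    then show ?thesis using z powersI by metis
  qed
  then show ?case using subgroup.subset[OF subgroup_powers] by blast
qed simp

lemma torsion_freeI_prime:
  assumes "\<And>x p::int. x \<in> carrier G \<Longrightarrow> prime p \<Longrightarrow> x [^] p = \<one> \<Longrightarrow> x = \<one>"
  shows "torsion_free G"
  using subgroup_prime_root_closed[OF triv_subgroup] assms by (auto simp: torsion_free_def)

lemma torsion_free_pow_inj:
  fixes n :: int
  assumes "torsion_free G" "n \<noteq> 0" "x \<in> carrier G" "y \<in> carrier G" "x [^] n = y [^] n"
  shows "x = y"
proof -
  have "(x \<otimes> inv y) [^] n = \<one>"
    using assms by (simp add: int_pow_distrib int_pow_inv)
  then have "x \<otimes> inv y = \<one>" using assms by (auto simp: torsion_free_def)
  then show ?thesis using assms by (metis inv_equality inv_inv inv_closed)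
qed

lemma torsion_free_powers_cancel:
  assumes "torsion_free G" "m \<noteq> 0" "x \<in> carrier G" "x [^] m \<in> powers G (m * n)"
  shows "x \<in> powers G n"
proof -
  obtain y where y: "y \<in> carrier G" "x [^] m = y [^] (m * n)" using assms(4) by (metis powersE)
  then have "x [^] m = (y [^] n) [^] m" by (simp add: int_pow_pow mult.commute)
  then have "x = y [^] n" using torsion_free_pow_inj assms y by simp
  then show ?thesis using y powersI by metis
qed

text \<open>Take \<open>K\<close> maximal above \<open>K0\<close> with \<open>K \<inter> D\<close>
  trivial. If \<open>x [^] p = k \<otimes> d\<close> and \<open>d\<close> has a p-th root
  \<open>d'\<close> in \<open>D\<close>, then \<open>x\<close> divided by \<open>d'\<close> has its
  p-th power in \<open>K\<close>, and maximality puts it into \<open>D <#> K\<close>. So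
  \<open>D <#> K\<close> is closed under prime roots, and every element has a nonzero power in it.
  The root condition is asked for every \<open>K\<close> above \<open>K0\<close>, since nothing else
  is known about the maximal one; a good choice of \<open>K0\<close> is what makes it
  provable.\<close>

lemma complement_exists:
  assumes D: "subgroup D G" and K0: "subgroup K0 G" "K0 \<inter> D = {\<one>}"
    and step: "\<And>K (p::int) x k d. \<lbrakk>subgroup K G; K0 \<subseteq> K; K \<inter> D = {\<one>}; prime p; x \<in> carrier G;
                k \<in> K; d \<in> D; x [^] p = k \<otimes> d\<rbrakk> \<Longrightarrow> \<exists>d'\<in>D. d' [^] p = d"
  obtains K where "subgroup K G" "D \<inter> K = {\<one>}" "D <#> K = carrier G"
proof -
  obtain K where K: "subgroup K G" "K0 \<subseteq> K" "K \<inter> (D - {\<one>}) = {}"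
    and max: "\<And>L. subgroup L G \<Longrightarrow> K \<subseteq> L \<Longrightarrow> L \<inter> (D - {\<one>}) = {} \<Longrightarrow> L = K"
    by (rule maximal_subgroup_avoiding[of K0 "D - {\<one>}"]) (use K0 in auto)
  have one: "\<one> \<in> K" "\<one> \<in> D" using K D subgroup.one_closed by auto
  have KD: "K \<inter> D = {\<one>}" using K(3) one by blast
  define S where "S = D <#> K"
  have S: "subgroup S G" unfolding S_def by (rule mult_subgroups[OF D K(1)])
  have Dc: "D \<subseteq> carrier G" and Kc: "K \<subseteq> carrier G"
    using subgroup.subset D K(1) by blast+
  have DS: "D \<subseteq> S" and KS: "K \<subseteq> S"
    unfolding S_def using set_mult_upper1 set_mult_upper2 D K(1) by blast+
  \<comment> \<open>Maximality: an element outside \<open>K\<close> has a power in \<open>S\<close> that is nontrivial modulo \<open>K\<close>.\<close>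
  have outside: "\<exists>j::int. x [^] j \<in> S \<and> x [^] j \<notin> K" if x: "x \<in> carrier G" "x \<notin> K" for x
  proof -
    let ?L = "K <#> cyclic G x"
    have L: "subgroup ?L G" by (rule mult_subgroups[OF K(1) subgroup_cyclic[OF x(1)]])
    have KL: "K \<subseteq> ?L" by (rule set_mult_upper1[OF K(1) subgroup_cyclic[OF x(1)]])
    have "x \<in> ?L"
      using set_mult_upper2[OF K(1) subgroup_cyclic[OF x(1)]] self_in_cyclic[OF x(1)] by blast
    then have "?L \<noteq> K" using x by blast
    then obtain d where d: "d \<in> ?L" "d \<in> D" "d \<noteq> \<one>" using max[OF L KL] by blast
    then obtain k j where kj: "k \<in> K" "d = k \<otimes> x [^] (j::int)"
      by (auto elim!: set_multE simp: cyclic_def)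
    have "x [^] j = inv k \<otimes> d" using kj Kc x by (metis inv_solve_left int_pow_closed m_closed subsetD)
    then have "x [^] j \<in> S"
      using S KS DS kj d by (metis subgroup.m_closed subgroup.m_inv_closed subsetD)
    moreover have "x [^] j \<notin> K"
    proof
      assume "x [^] j \<in> K"
      then have "d \<in> K" using kj K(1) subgroup.m_closed by metis
      then show False using d KD by blast
    qed
    ultimately show ?thesis by blast
  qed
  have root: "x \<in> S" if x: "x \<in> carrier G" and p: "prime p" and xp: "x [^] p \<in> S" for x and p :: int
  proof -
    obtain d k where dk: "d \<in> D" "k \<in> K" "x [^] p = d \<otimes> k" using xp unfolding S_def by (metis set_multE)
    then have dkc: "d \<in> carrier G" "k \<in> carrier G" using Dc Kc by auto
    then have "x [^] p = k \<otimes> d" using dk m_comm[of d k] by simp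
    then obtain d' where d': "d' \<in> D" "d' [^] p = d" using step[OF K(1,2) KD p x] dk by blast
    define y where "y = x \<otimes> inv d'"
    have y: "y \<in> carrier G" and xy: "x = y \<otimes> d'" using x d' Dc by (auto simp: y_def m_assoc subsetD)
    have "x [^] p = y [^] p \<otimes> d" using xy d' y Dc by (auto simp: int_pow_distrib)
    then have yp: "y [^] p \<in> K" using dk dkc y m_comm[of d "y [^] p"] l_cancel[of d "y [^] p" k] by simp
    have "y \<in> S"
    proof (cases "y \<in> K")
      case False
      \<comment> \<open>As \<open>y [^] p\<close> lies in \<open>K\<close> and
        \<open>y [^] j\<close> does not, \<open>p\<close> cannot divide \<open>j\<close>; the two
        powers, both in \<open>S\<close>, then generate \<open>y\<close>.\<close>
      then obtain j :: int where j: "y [^] j \<in> S" "y [^] j \<notin> K" using outside[OF y] by blast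
      then have "\<not> p dvd j" using subgroup_pow_dvd[OF K(1) y yp] by blast
      then have "coprime p j" using p by (simp add: prime_imp_coprime)
      then show ?thesis using subgroup_pow_coprime[OF S y] yp KS j by blast
    qed (use KS in blast)
    then show ?thesis using xy d' DS S by (metis subgroup.m_closed subsetD)
  qed
  have "x \<in> S" if x: "x \<in> carrier G" for x
  proof (cases "x \<in> K")
    case False
    then obtain j :: int where j: "x [^] j \<in> S" "x [^] j \<notin> K" using outside[OF x] by blast
    then have "j \<noteq> 0" using one by auto
    then show ?thesis by (rule subgroup_prime_root_closed[OF S _ _ x j(1), rotated]) (rule root)
  qed (use KS in blast)
  then have "D <#> K = carrier G" using S subgroup.subset unfolding S_def by blast
  then show thesis using that K(1) KD by (simp add: Int_commute)
qed

lemma indecomposable_summand: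
  assumes "indecomposable G" "subgroup H G" "subgroup K G" "H \<inter> K = {\<one>}" "H <#> K = carrier G"
    and "H \<noteq> {\<one>}"
  shows "H = carrier G"
proof -
  have "K = {\<one>}" using assms unfolding indecomposable_def by blast
  then have "carrier G = H <#> {\<one>}" using assms by simp
  also have "\<dots> = H" using subgroup.subset[OF assms(2)] by (force simp: set_mult_def)
  finally show ?thesis by simp
qed

text \<open>A divisible \<open>D\<close> meets the root condition of
  \<open>complement_exists\<close> for every \<open>K\<close>, so \<open>K0\<close> can be taken
  trivial.\<close>

lemma indecomposable_divisible_subgroup:
  assumes "indecomposable G" "subgroup D G" "D \<noteq> {\<one>}"
    and div: "\<And>p d. prime (p::int) \<Longrightarrow> d \<in> D \<Longrightarrow> \<exists>d'\<in>D. d' [^] p = d"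
  shows "D = carrier G"
proof -
  have "{\<one>} \<inter> D = {\<one>}" using subgroup.one_closed[OF assms(2)] by blast
  then obtain K where "subgroup K G" "D \<inter> K = {\<one>}" "D <#> K = carrier G"
    by (rule complement_exists[OF assms(2) triv_subgroup]) (use div in blast)+
  then show ?thesis using indecomposable_summand assms by blast
qed

text \<open>Additively, each congruence becomes the equation \<open>y - n i * z i = x i\<close>. The
  unknowns form an option type, with \<open>None\<close> for the common solution \<open>y\<close>
  and \<open>Some i\<close> for the witness \<open>z i\<close> of the i-th congruence; this is why
  systems in unknowns of any type are needed. Nonzero moduli make the support of the i-th
  coefficient function exactly \<open>{None, Some i}\<close>.\<close>

lemma pure_injective_congruences:
  assumes pi: "pure_injective G" and x: "\<And>i. i \<in> I \<Longrightarrow> x i \<in> carrier G"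
    and n: "\<And>i. i \<in> I \<Longrightarrow> n i \<noteq> 0"
    and fin: "\<And>F. finite F \<Longrightarrow> F \<subseteq> I \<Longrightarrow> \<exists>y\<in>carrier G. \<forall>i\<in>F. y \<otimes> inv x i \<in> powers G (n i)"
  obtains y where "y \<in> carrier G" "\<And>i. i \<in> I \<Longrightarrow> y \<otimes> inv x i \<in> powers G (n i)"
proof -
  define c where "c i = Poly_Mapping.single None 1 + Poly_Mapping.single (Some i) (- n i)" for i
  have lk: "Poly_Mapping.lookup (c i) None = 1" "Poly_Mapping.lookup (c i) (Some i) = - n i" for i
    by (simp_all add: c_def lookup_add lookup_single)
  have keys: "Poly_Mapping.keys (c i) = {None, Some i}" if "i \<in> I" for i
    using n[OF that] by (auto simp: c_def in_keys_iff lookup_add lookup_single when_def split: if_splits)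
  have val: "lhs_value s (c i) = s None \<otimes> s (Some i) [^] (- n i)"
    if "i \<in> I" "s \<in> UNIV \<rightarrow> carrier G" for i s
  proof -
    have "s None \<in> carrier G" "s (Some i) \<in> carrier G" using that by auto
    then show ?thesis using that by (simp add: keys lk)
  qed
  define S where "S = (\<lambda>i. (c i, x i)) ` I"
  have "finitely_solvable_in G S"
    unfolding finitely_solvable_in_def
  proof (intro allI impI)
    fix T assume "T \<subseteq> S" "finite T"
    then obtain F where F: "F \<subseteq> I" "finite F" "T = (\<lambda>i. (c i, x i)) ` F"
      unfolding S_def by (meson finite_subset_image)
    obtain y where y: "y \<in> carrier G" "\<forall>i\<in>F. y \<otimes> inv x i \<in> powers G (n i)" using fin F by blast
    then have "\<forall>i\<in>F. \<exists>z\<in>carrier G. y \<otimes> inv x i = z [^] n i" by (metis powersE)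
    then obtain z where z: "\<And>i. i \<in> F \<Longrightarrow> z i \<in> carrier G \<and> y \<otimes> inv x i = z i [^] n i" by metis
    \<comment> \<open>Witnesses outside \<open>F\<close> occur in no equation of \<open>T\<close>;
      the default \<open>\<one>\<close> only keeps the assignment inside the carrier.\<close>
    define s where "s v = (case v of None \<Rightarrow> y | Some i \<Rightarrow> if i \<in> F then z i else \<one>)" for v
    have s: "s \<in> UNIV \<rightarrow> carrier G" using y z by (auto simp: s_def split: option.splits)
    have "lhs_value s (c i) = x i" if i: "i \<in> F" for i
    proof -
      have xi: "x i \<in> carrier G" "i \<in> I" using i F x by auto
      have "lhs_value s (c i) = y \<otimes> inv (z i [^] n i)"
        using val[OF xi(2) s] z[OF i] i by (simp add: s_def int_pow_neg)
      also have "\<dots> = y \<otimes> inv (y \<otimes> inv x i)" using z[OF i] by simp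
      also have "\<dots> = x i" using y xi by (simp add: inv_mult m_assoc[symmetric])
      finally show ?thesis .
    qed
    then have "solves G s T" using s unfolding F(3) solves_def by blast
    then show "solvable_in G T" by (auto simp: solvable_in_def)
  qed
  then obtain s where s: "solves G s S"
    using pure_injective_any_unknowns[OF pi] by (auto simp: solvable_in_def)
  then have sc: "s \<in> UNIV \<rightarrow> carrier G" by (simp add: solves_def)
  show thesis
  proof
    show c: "s None \<in> carrier G" using sc by auto
    fix i assume i: "i \<in> I"
    have si: "s (Some i) \<in> carrier G" using sc by auto
    have "s None \<otimes> s (Some i) [^] (- n i) = x i"
      using solves_eqD[OF s, of "c i" "x i"] val[OF i sc] i by (simp add: S_def)
    then have "x i = s None \<otimes> inv (s (Some i) [^] n i)" using si by (simp add: int_pow_neg)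
    then have "s None \<otimes> inv x i = s (Some i) [^] n i"
      using c si by (simp add: inv_mult m_assoc[symmetric])
    then show "s None \<otimes> inv x i \<in> powers G (n i)" using si powersI by metis
  qed
qed

end

section \<open>Indecomposable pure-injective groups\<close>

text \<open>
  \<open>Cyclic p n\<close> stands for the cyclic group of order \<open>p ^ Suc n\<close>.
\<close>

datatype kind = Cyclic int nat | Pruefer int | Rational | Adic int

text \<open>Each clause determines a group up to isomorphism without exhibiting one.
  \<open>Rational\<close> describes torsion-free divisible groups of rank one. In
  \<open>Adic\<close>, the intersection clause is separatedness of the p-adic topology, the last
  clause is density of a cyclic subgroup, and \<open>pure_injective\<close> stands in for
  completeness; since the dense generator has height zero, the coefficients approximating an element
  are determined modulo \<open>p ^ n\<close>.\<close>

primrec has_kind :: "('a, 'm) monoid_scheme \<Rightarrow> kind \<Rightarrow> bool" where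
  "has_kind G (Cyclic p n) \<longleftrightarrow> prime p \<and>
     (\<exists>a\<in>carrier G. carrier G = cyclic G a \<and> a [^]\<^bsub>G\<^esub> (p ^ n) \<noteq> \<one>\<^bsub>G\<^esub> \<and> a [^]\<^bsub>G\<^esub> (p ^ Suc n) = \<one>\<^bsub>G\<^esub>)"
| "has_kind G (Pruefer p) \<longleftrightarrow> prime p \<and>
     (\<exists>a. a 0 \<noteq> \<one>\<^bsub>G\<^esub> \<and> a 0 [^]\<^bsub>G\<^esub> p = \<one>\<^bsub>G\<^esub> \<and>
       (\<forall>n::nat. a n \<in> carrier G \<and> a (Suc n) [^]\<^bsub>G\<^esub> p = a n) \<and> carrier G = (\<Union>n. cyclic G (a n)))"
| "has_kind G Rational \<longleftrightarrow> torsion_free G \<and> (\<forall>n. n \<noteq> 0 \<longrightarrow> powers G n = carrier G) \<and>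
     (\<exists>a\<in>carrier G. a \<noteq> \<one>\<^bsub>G\<^esub> \<and>
       (\<forall>x\<in>carrier G. \<exists>(m::int) (k::int). m \<noteq> 0 \<and> x [^]\<^bsub>G\<^esub> m = a [^]\<^bsub>G\<^esub> k))"
| "has_kind G (Adic p) \<longleftrightarrow> prime p \<and> torsion_free G \<and> pure_injective G \<and>
     (\<forall>m. \<not> p dvd m \<longrightarrow> powers G m = carrier G) \<and> (\<Inter>n. powers G (p ^ n)) = {\<one>\<^bsub>G\<^esub>} \<and>
     (\<exists>a\<in>carrier G. a \<notin> powers G p \<and> (\<forall>n. carrier G \<subseteq> cyclic G a <#>\<^bsub>G\<^esub> powers G (p ^ n)))"

section \<open>Splitting off cyclic, divisible and p-divisible parts\<close>

context comm_group
begin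

lemma coprime_root_in_cyclic:
  fixes q N :: int
  assumes d: "d \<in> carrier G" "d [^] N = \<one>" and c: "coprime q N"
  obtains u :: int where "(d [^] u) [^] q = d"
proof -
  obtain u v where uv: "u * q + v * N = 1"
    using c by (metis bezout_int coprime_iff_gcd_eq_1)
  have "d = d [^] (u * q) \<otimes> d [^] (N * v)"
    using d uv by (simp add: int_pow_mult[symmetric] mult.commute)
  also have "d [^] (N * v) = \<one>" using d by (simp add: int_pow_pow[symmetric])
  finally show thesis using that[of u] d by (simp add: int_pow_pow)
qed

text \<open>Every nontrivial subgroup of \<open>cyclic G y\<close> contains \<open>x\<close>, and
  \<open>x\<close> is not in \<open>powers G (p ^ Suc n)\<close>; so these powers can serve as the
  initial part \<open>K0\<close> of a complement. Having them inside \<open>K\<close> is what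
  verifies the root condition at the prime \<open>p\<close>.\<close>

lemma indecomposable_cyclic:
  fixes p :: int
  assumes ind: "indecomposable G" and p: "prime p"
    and x: "x [^] p = \<one>" "x \<in> powers G (p ^ n)" "x \<notin> powers G (p ^ Suc n)"
  shows "has_kind G (Cyclic p n)"
proof -
  obtain y where y: "y \<in> carrier G" "x = y [^] (p ^ n)" using x by (metis powersE)
  define K0 where "K0 = powers G (p ^ Suc n)"
  have K0: "subgroup K0 G" unfolding K0_def by (rule subgroup_powers)
  have D: "subgroup (cyclic G y) G" by (rule subgroup_cyclic[OF y(1)])
  have yN: "y [^] (p ^ Suc n) = \<one>" using x y by (simp add: int_pow_pow mult.commute)
  have x1: "y [^] (p ^ n) \<noteq> \<one>"
    using x(3) y(2) subgroup.one_closed[OF K0] by (auto simp: K0_def)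
  have K0D: "K0 \<inter> cyclic G y = {\<one>}"
  proof -
    have "z = \<one>" if z: "z \<in> K0" "z \<in> cyclic G y" for z
    proof -
      obtain k :: int where k: "z = y [^] k" using z by (auto simp: cyclic_def)
      have "p ^ Suc n dvd k"
        using subgroup_pow_primepow[OF K0 y(1), of k p n] k z yN subgroup.one_closed[OF K0] p x(3) y(2)
        by (auto simp: K0_def)
      then show ?thesis using subgroup_pow_dvd[OF triv_subgroup y(1)] yN k by blast
    qed
    then show ?thesis using subgroup.one_closed[OF K0] subgroup.one_closed[OF D] by blast
  qed
  obtain K where "subgroup K G" "cyclic G y \<inter> K = {\<one>}" "cyclic G y <#> K = carrier G"
  proof (rule complement_exists[OF D K0 K0D])
    fix K and q :: int and z k d
    assume K: "subgroup K G" "K0 \<subseteq> K" "K \<inter> cyclic G y = {\<one>}" and q: "prime q"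
      and z: "z \<in> carrier G" "k \<in> K" "d \<in> cyclic G y" "z [^] q = k \<otimes> d"
    obtain j :: int where j: "d = y [^] j" using z by (auto simp: cyclic_def)
    have d: "d \<in> carrier G" using j y by simp
    have k: "k \<in> carrier G" using z K(1) subgroup.mem_carrier by metis
    show "\<exists>d'\<in>cyclic G y. d' [^] q = d"
    proof (cases "q = p")
      case True
      \<comment> \<open>Raising \<open>z [^] p = k \<otimes> d\<close> to the power
        \<open>p ^ n\<close> puts the left side into \<open>K0\<close>, hence into \<open>K\<close>.
        So \<open>d [^] (p ^ n)\<close> lies in \<open>K\<close> as well as in
        \<open>cyclic G y\<close> and is trivial, which forces \<open>d\<close> to be a p-th power
        in \<open>cyclic G y\<close>.\<close>
      have "z [^] (p ^ Suc n) = (z [^] p) [^] (p ^ n)" using z by (simp add: int_pow_pow)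
      also have "\<dots> = k [^] (p ^ n) \<otimes> d [^] (p ^ n)" using z True d k by (simp add: int_pow_distrib)
      finally have "d [^] (p ^ n) = inv (k [^] (p ^ n)) \<otimes> z [^] (p ^ Suc n)"
        using d k z by (simp add: m_assoc[symmetric])
      moreover have "z [^] (p ^ Suc n) \<in> K" using powersI[OF z(1)] K(2) unfolding K0_def by blast
      ultimately have "d [^] (p ^ n) \<in> K"
        using K(1) z(2) subgroup_int_pow_closed subgroup.m_closed subgroup.m_inv_closed by metis
      moreover have "d [^] (p ^ n) \<in> cyclic G y" using subgroup_int_pow_closed[OF D z(3)] .
      ultimately have "y [^] (j * p ^ n) \<in> {\<one>}" using K(3) j y by (auto simp: int_pow_pow)
      then have "p ^ Suc n dvd j * p ^ n"
        using subgroup_pow_primepow[OF triv_subgroup y(1), of "j * p ^ n" p n] yN p x1 by auto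
      then have "p dvd j" using prime_gt_0_int[OF p] by simp
      then obtain i where "j = i * p" by (metis dvdE mult.commute)
      then have "(y [^] i) [^] q = d" using j y True by (simp add: int_pow_pow)
      then show ?thesis using cyclicI by metis
    next
      case False
      then have "coprime q (p ^ Suc n)" using p q by (simp add: primes_coprime)
      moreover have "d [^] (p ^ Suc n) = \<one>"
        using j y yN by (metis int_pow_one int_pow_pow mult.commute)
      ultimately obtain u :: int where "(d [^] u) [^] q = d"
        using coprime_root_in_cyclic[OF d] by metis
      then show ?thesis using subgroup_int_pow_closed[OF D z(3)] by metis
    qed
  qed
  moreover have "cyclic G y \<noteq> {\<one>}" using cyclicI[of G y "p ^ n"] x1 by auto
  ultimately have "cyclic G y = carrier G" using indecomposable_summand[OF ind D] by blast
  then show ?thesis using p y(1) x1 yN by auto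
qed

text \<open>Infinite height in the socle gives p-th roots for all elements of p-power order, hence
  an infinite chain of successive roots of \<open>x\<close>. The union of the cyclic groups along
  the chain is divisible and therefore the whole group.\<close>

lemma indecomposable_pruefer:
  fixes p :: int
  assumes ind: "indecomposable G" and p: "prime p"
    and x: "x \<in> carrier G" "x \<noteq> \<one>" "x [^] p = \<one>"
    and height: "\<And>y n. y \<in> carrier G \<Longrightarrow> y [^] p = \<one> \<Longrightarrow> y \<in> powers G (p ^ n)"
  shows "has_kind G (Pruefer p)"
proof -
  have root: "\<exists>z\<in>carrier G. z [^] p = y" if "y \<in> carrier G" "y [^] (p ^ n) = \<one>" for y n
    using that
  proof (induction n arbitrary: y)
    case 0
    then show ?case by (auto intro!: bexI[of _ \<one>])
  next
    case (Suc n)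
    \<comment> \<open>This power lies in the socle, so it equals \<open>z [^] (p ^ Suc n)\<close>
      for some \<open>z\<close>. Dividing \<open>y\<close> by \<open>z [^] p\<close> lowers the
      order, and a root of the quotient times \<open>z\<close> is a root of
      \<open>y\<close>.\<close>
    have "y [^] (p ^ n) \<in> powers G (p ^ Suc n)"
      by (rule height) (use Suc in \<open>auto simp: int_pow_pow mult.commute\<close>)
    then obtain z where z: "z \<in> carrier G" "y [^] (p ^ n) = z [^] (p ^ Suc n)" by (metis powersE)
    have "(y \<otimes> inv (z [^] p)) [^] (p ^ n) = \<one>"
      using z Suc(2) by (simp add: int_pow_distrib int_pow_inv int_pow_pow)
    then obtain t where t: "t \<in> carrier G" "t [^] p = y \<otimes> inv (z [^] p)"
      using Suc(1)[of "y \<otimes> inv (z [^] p)"] Suc(2) z by auto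
    have "(t \<otimes> z) [^] p = y" using t z Suc(2) by (simp add: int_pow_distrib m_assoc)
    then show ?case using t z by (metis m_closed)
  qed
  obtain a where a: "\<And>n. (a n \<in> carrier G \<and> a n [^] (p ^ Suc n) = \<one> \<and> (n = 0 \<longrightarrow> a n = x)) \<and> a (Suc n) [^] p = a n"
  proof -
    \<comment> \<open>The bound on the order is carried along so that \<open>root\<close> applies at
      every stage; the conjunct on \<open>n = 0\<close> fixes the start of the chain at
      \<open>x\<close>.\<close>
    have "\<exists>a. \<forall>n. (a n \<in> carrier G \<and> a n [^] (p ^ Suc n) = \<one> \<and> (n = 0 \<longrightarrow> a n = x)) \<and> a (Suc n) [^] p = a n"
    proof (rule dependent_nat_choice)
      show "\<exists>y. y \<in> carrier G \<and> y [^] (p ^ Suc 0) = \<one> \<and> (0 = (0::nat) \<longrightarrow> y = x)" using x by auto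
      fix y n assume y: "y \<in> carrier G \<and> y [^] (p ^ Suc n) = \<one> \<and> (n = 0 \<longrightarrow> y = x)"
      then obtain z where z: "z \<in> carrier G" "z [^] p = y" using root by blast
      have "z [^] (p ^ Suc (Suc n)) = (z [^] p) [^] (p ^ Suc n)" using z(1) by (simp add: int_pow_pow)
      then show "\<exists>z. (z \<in> carrier G \<and> z [^] (p ^ Suc (Suc n)) = \<one> \<and> (Suc n = 0 \<longrightarrow> z = x)) \<and> z [^] p = y"
        using z y by auto
    qed
    then show thesis using that by blast
  qed
  then have ac: "a n \<in> carrier G" and aN: "a n [^] (p ^ Suc n) = \<one>" and aS: "a (Suc n) [^] p = a n"
    and a0: "a 0 = x" for n by auto
  define D where "D = (\<Union>n. cyclic G (a n))"
  have incr: "cyclic G (a m) \<subseteq> cyclic G (a n)" if "m \<le> n" for m n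
    using that
  proof (rule lift_Suc_mono_le[rotated])
    fix n show "cyclic G (a n) \<subseteq> cyclic G (a (Suc n))"
    proof
      fix y assume "y \<in> cyclic G (a n)"
      then obtain k :: int where "y = a n [^] k" by (auto simp: cyclic_def)
      then have "y = a (Suc n) [^] (p * k)" using aS[of n] ac by (metis int_pow_pow)
      then show "y \<in> cyclic G (a (Suc n))" using cyclicI by metis
    qed
  qed
  have D: "subgroup D G" unfolding D_def
  proof (rule subgroup_Union_chain)
    fix H K assume "H \<in> range (\<lambda>n. cyclic G (a n))" "K \<in> range (\<lambda>n. cyclic G (a n))"
    then show "H \<subseteq> K \<or> K \<subseteq> H" using incr by (metis nat_le_linear rangeE)
  qed (use subgroup_cyclic ac in auto)
  have "D = carrier G"
  proof (rule indecomposable_divisible_subgroup[OF ind D])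
    have "x \<in> D" using self_in_cyclic[OF ac[of 0]] a0 by (auto simp: D_def)
    then show "D \<noteq> {\<one>}" using x by blast
    fix q :: int and d assume q: "prime q" and d: "d \<in> D"
    then obtain n and k :: int where k: "d = a n [^] k" by (auto simp: D_def cyclic_def)
    show "\<exists>d'\<in>D. d' [^] q = d"
    proof (cases "q = p")
      case True
      have "(a (Suc n) [^] k) [^] q = d"
        using True k aS[of n] ac[of "Suc n"] by (metis int_pow_pow mult.commute)
      then show ?thesis using cyclicI[of G "a (Suc n)" k] by (auto simp: D_def)
    next
      case False
      then have "coprime q (p ^ Suc n)" using p q by (simp add: primes_coprime)
      moreover have "d [^] (p ^ Suc n) = \<one>"
        using k ac aN by (metis int_pow_one int_pow_pow mult.commute)
      ultimately obtain u :: int where "(d [^] u) [^] q = d"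
        using coprime_root_in_cyclic k ac by (metis int_pow_closed)
      then show ?thesis using subgroup_int_pow_closed[OF D d] by metis
    qed
  qed
  then show ?thesis using p ac aS a0 x by (auto simp: D_def intro!: exI[of _ a])
qed

text \<open>The elements with a nonzero multiple in \<open>cyclic G a\<close> form a subgroup
  \<open>D\<close> closed under roots in \<open>G\<close>, so the divisibility of \<open>G\<close>
  passes to \<open>D\<close>.\<close>

lemma indecomposable_rational:
  assumes ind: "indecomposable G" and tf: "torsion_free G"
    and div: "\<And>p::int. prime p \<Longrightarrow> powers G p = carrier G"
  shows "has_kind G Rational"
proof -
  obtain a where a: "a \<in> carrier G" "a \<noteq> \<one>"
    using ind unfolding indecomposable_def by (metis one_closed singletonI subsetI subset_antisym subset_singletonD insert_iff)
  define D where "D = {x \<in> carrier G. \<exists>(m::int) (k::int). m \<noteq> 0 \<and> x [^] m = a [^] k}"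
  have DI: "x \<in> D" if "x \<in> carrier G" "m \<noteq> 0" "x [^] m = a [^] k" for x and m k :: int
    unfolding D_def using that by blast
  have D: "subgroup D G"
  proof (rule subgroupI)
    have "\<one> \<in> D" by (rule DI[of _ 1 0]) auto
    then show "D \<noteq> {}" by blast
    show "inv x \<in> D" if xD: "x \<in> D" for x
    proof -
      obtain m k :: int where mk: "x \<in> carrier G" "m \<noteq> 0" "x [^] m = a [^] k"
        using xD by (auto simp: D_def)
      then have "inv x [^] m = a [^] (- k)" using a by (simp add: int_pow_inv int_pow_neg)
      then show ?thesis using mk by (auto simp: D_def)
    qed
    show "x \<otimes> y \<in> D" if xy: "x \<in> D" "y \<in> D" for x y
    proof -
      obtain m k :: int where mk: "x \<in> carrier G" "m \<noteq> 0" "x [^] m = a [^] k"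
        using xy by (auto simp: D_def)
      obtain n j :: int where nj: "y \<in> carrier G" "n \<noteq> 0" "y [^] n = a [^] j"
        using xy by (auto simp: D_def)
      have "(x \<otimes> y) [^] (m * n) = (x [^] m) [^] n \<otimes> (y [^] n) [^] m"
        using mk(1) nj(1) by (simp add: int_pow_distrib int_pow_pow mult.commute)
      also have "\<dots> = a [^] (k * n + j * m)"
        unfolding mk(3) nj(3) using a by (simp add: int_pow_pow int_pow_mult)
      finally show ?thesis using DI[of "x \<otimes> y" "m * n"] mk(1,2) nj(1,2) by auto
    qed
  qed (auto simp: D_def)
  have "D = carrier G"
  proof (rule indecomposable_divisible_subgroup[OF ind D])
    have "a \<in> D" using a by (intro DI[of _ 1 1]) auto
    then show "D \<noteq> {\<one>}" using a by blast
    fix p :: int and d assume p: "prime p" and d: "d \<in> D"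
    then obtain m k :: int where mk: "d \<in> carrier G" "m \<noteq> 0" "d [^] m = a [^] k"
      by (auto simp: D_def)
    obtain z where z: "z \<in> carrier G" "d = z [^] p" using mk div[OF p] by (metis powersE)
    have "z [^] (p * m) = a [^] k" using z mk by (simp add: int_pow_pow)
    then have "z \<in> D" using DI[OF z(1), of "p * m"] mk(2) p by auto
    then show "\<exists>d'\<in>D. d' [^] p = d" using z by auto
  qed
  then have "\<forall>x\<in>carrier G. \<exists>(m::int) (k::int). m \<noteq> 0 \<and> x [^] m = a [^] k" by (auto simp: D_def)
  then show ?thesis using tf a powers_eq_carrier_if_prime[OF div] by auto
qed

text \<open>In a torsion-free group this intersection is divisible: if \<open>d = z [^] q\<close>
  lies in \<open>powers G (q * n)\<close>, cancelling \<open>q\<close> puts \<open>z\<close> into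
  \<open>powers G n\<close>. So it is trivial or everything, and \<open>p\<close> excludes the
  latter.\<close>

lemma indecomposable_torsion_free_reduced:
  fixes p :: int
  assumes ind: "indecomposable G" and tf: "torsion_free G" and p: "powers G p \<noteq> carrier G" "prime p"
  shows "(\<Inter>n\<in>{n. n \<noteq> 0}. powers G n) = {\<one>}"
proof -
  define D where "D = (\<Inter>n\<in>{n. n \<noteq> 0}. powers G n)"
  have D: "subgroup D G" unfolding D_def
    by (rule subgroup_Inter) (use subgroup_powers in \<open>auto intro!: exI[of _ 1]\<close>)
  have "D \<noteq> carrier G"
  proof
    assume "D = carrier G"
    moreover have "D \<subseteq> powers G p" using p(2) unfolding D_def by (intro INF_lower) auto
    ultimately have "carrier G \<subseteq> powers G p" by simp
    then show False using p(1) subgroup.subset[OF subgroup_powers] by blast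
  qed
  moreover have "\<exists>d'\<in>D. d' [^] q = d" if q: "prime q" and d: "d \<in> D" for q :: int and d
  proof -
    have "q \<noteq> 0" using q by auto
    then have "d \<in> powers G q" using d by (simp add: D_def)
    then obtain z where z: "z \<in> carrier G" "d = z [^] q" by (rule powersE)
    have "z \<in> powers G n" if "n \<noteq> 0" for n
    proof (rule torsion_free_powers_cancel[OF tf _ z(1)])
      show "q \<noteq> 0" using q by auto
      show "z [^] q \<in> powers G (q * n)" using d z q that unfolding D_def by auto
    qed
    then show ?thesis using z by (auto simp: D_def)
  qed
  ultimately show ?thesis using indecomposable_divisible_subgroup[OF ind D] unfolding D_def by blast
qed

text \<open>\<open>G\<close> is the direct sum of the p-divisible part \<open>H\<close> and the part
  \<open>K\<close> divisible by all integers prime to \<open>p\<close>. An element of both is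
  divisible by every nonzero integer, hence trivial. As \<open>H\<close> lies in
  \<open>powers G p\<close> it is proper, so indecomposability leaves only \<open>K\<close>.\<close>

lemma indecomposable_adic_local:
  fixes p :: int
  assumes ind: "indecomposable G" and pi: "pure_injective G" and tf: "torsion_free G"
    and p: "powers G p \<noteq> carrier G" "prime p"
  shows "(\<Inter>n. powers G (p ^ n)) = {\<one>}" "\<And>m. \<not> p dvd m \<Longrightarrow> powers G m = carrier G"
proof -
  define H where "H = (\<Inter>n. powers G (p ^ n))"
  define K where "K = (\<Inter>m\<in>{m. \<not> p dvd m}. powers G m)"
  have H: "subgroup H G" unfolding H_def by (rule subgroup_Inter) (use subgroup_powers in auto)
  have p1: "\<not> p dvd 1" using p(2) not_prime_unit by blast
  have K: "subgroup K G" unfolding K_def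
    by (rule subgroup_Inter) (use subgroup_powers p1 in \<open>auto intro!: exI[of _ 1]\<close>)
  have HK: "H \<inter> K = {\<one>}"
  proof -
    have "x \<in> powers G n" if x: "x \<in> H" "x \<in> K" and n: "n \<noteq> 0" for x n
    proof -
      obtain m where m: "n = p ^ multiplicity p n * m" "\<not> p dvd m"
        using multiplicity_decompose'[OF n] p(2) not_prime_unit by metis
      have "coprime (p ^ multiplicity p n) m" using p(2) m(2) by (simp add: prime_imp_coprime)
      then have "x \<in> powers G (p ^ multiplicity p n * m)"
        using x m(2) by (intro powers_mult_coprime) (auto simp: H_def K_def)
      then show ?thesis using m(1) by simp
    qed
    then have "H \<inter> K \<subseteq> {\<one>}" using indecomposable_torsion_free_reduced[OF ind tf p] by blast
    then show ?thesis using subgroup.one_closed[OF H] subgroup.one_closed[OF K] by blast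
  qed
  have "H <#> K = carrier G"
  proof
    show "H <#> K \<subseteq> carrier G" using subgroup.subset[OF mult_subgroups[OF H K]] .
    show "carrier G \<subseteq> H <#> K"
    proof
      fix x assume x: "x \<in> carrier G"
      \<comment> \<open>The component \<open>y\<close> of \<open>x\<close> in \<open>H\<close> is
        found from congruences: it should be trivial modulo powers of \<open>p\<close> and agree
        with \<open>x\<close> modulo integers prime to \<open>p\<close>. The modulus
        \<open>p ^ 0 = 1\<close> falls under the second rule, harmlessly, since every element is a
        first power.\<close>
      define I where "I = {r. (\<exists>n. r = p ^ n) \<or> \<not> p dvd r}"
      define t where "t r = (if p dvd r then \<one> else x)" for r
      \<comment> \<open>Chinese remainder theorem: for \<open>u A + v B = 1\<close> the element \<open>x [^] (u A)\<close> is trivial modulo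
          \<open>A\<close>-th powers and equals \<open>x\<close> modulo \<open>B\<close>-th powers.\<close>
      obtain y where y: "y \<in> carrier G" "\<And>r. r \<in> I \<Longrightarrow> y \<otimes> inv t r \<in> powers G r"
      proof (rule pure_injective_congruences[OF pi, of I t "\<lambda>r. r"])
        fix F assume F: "finite F" "F \<subseteq> I"
        define A where "A = \<Prod>{r \<in> F. p dvd r}"
        define B where "B = \<Prod>{r \<in> F. \<not> p dvd r}"
        have "coprime r s" if rs: "r \<in> F" "p dvd r" "\<not> p dvd s" for r s
        proof -
          obtain n where "r = p ^ n" using F rs by (auto simp: I_def)
          then show ?thesis using p(2) rs by (simp add: prime_imp_coprime)
        qed
        then have "coprime A B" unfolding A_def B_def by (intro prod_coprime_left prod_coprime_right) auto
        then obtain u v where uv: "u * A + v * B = 1"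
          by (metis bezout_int coprime_iff_gcd_eq_1)
        show "\<exists>y\<in>carrier G. \<forall>r\<in>F. y \<otimes> inv t r \<in> powers G r"
        proof (intro bexI ballI)
          fix r assume r: "r \<in> F"
          show "x [^] (u * A) \<otimes> inv t r \<in> powers G r"
          proof (cases "p dvd r")
            case True
            then have "r dvd A" unfolding A_def using r F by (intro dvd_prodI) auto
            then have "x [^] (u * A) \<in> powers G r" using powersI[OF x, of "u * A"] powers_mono[of r "u * A"] by auto
            then show ?thesis using True x by (simp add: t_def)
          next
            case False
            then have "r dvd B" unfolding B_def using r F by (intro dvd_prodI) auto
            then have "x [^] (- v * B) \<in> powers G r" using powersI[OF x, of "- v * B"] powers_mono[of r "- v * B"] by auto
            also have "- v * B = u * A - 1" using uv by simp
            also have "x [^] (u * A - 1) = x [^] (u * A) \<otimes> inv x" using x by (simp add: int_pow_diff)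
            finally show ?thesis using False by (simp add: t_def)
          qed
        qed (use x in auto)
      next
        fix r assume "r \<in> I"
        then show "r \<noteq> 0" using p(2) by (auto simp: I_def)
      qed (use x in \<open>auto simp: t_def\<close>)
      have "y \<in> H"
      proof -
        have "y \<in> powers G (p ^ n)" for n
        proof (cases n)
          case 0
          then show ?thesis using y(1) powers_one by simp
        next
          case (Suc k)
          then have "t (p ^ n) = \<one>" by (simp add: t_def)
          then show ?thesis using y(2)[of "p ^ n"] y(1) by (auto simp: I_def)
        qed
        then show ?thesis by (auto simp: H_def)
      qed
      moreover have "x \<otimes> inv y \<in> K"
      proof -
        have "x \<otimes> inv y \<in> powers G m" if "\<not> p dvd m" for m
        proof -
          have "y \<otimes> inv x \<in> powers G m" using y(2)[of m] that by (simp add: I_def t_def)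
          then have "inv (y \<otimes> inv x) \<in> powers G m" by (rule subgroup.m_inv_closed[OF subgroup_powers])
          then show ?thesis using x y(1) by (simp add: inv_mult m_comm)
        qed
        then show ?thesis by (auto simp: K_def)
      qed
      ultimately have "y \<otimes> (x \<otimes> inv y) \<in> H <#> K" by (rule set_multI)
      moreover have "y \<otimes> (x \<otimes> inv y) = x" using x y(1) by (simp add: m_lcomm)
      ultimately show "x \<in> H <#> K" by simp
    qed
  qed
  moreover have "H \<noteq> carrier G"
  proof
    assume "H = carrier G"
    then have "carrier G \<subseteq> powers G (p ^ 1)" unfolding H_def by blast
    then show False using p(1) subgroup.subset[OF subgroup_powers] by auto
  qed
  ultimately have H1: "H = {\<one>}" using indecomposable_summand[OF ind H K HK] by blast
  then show "(\<Inter>n. powers G (p ^ n)) = {\<one>}" by (simp add: H_def)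
  have "K \<noteq> {\<one>}"
    using \<open>H <#> K = carrier G\<close> H1 ind by (auto simp: set_mult_def indecomposable_def)
  moreover have "K <#> H = carrier G"
    using \<open>H <#> K = carrier G\<close> commut_normal[OF K] subgroup_imp_normal[OF H] by simp
  ultimately have "K = carrier G" using indecomposable_summand[OF ind K H] HK by blast
  then show "powers G m = carrier G" if "\<not> p dvd m" for m
    using that subgroup.subset[OF subgroup_powers] by (auto simp: K_def)
qed

end

section \<open>p-adic limits and density in the torsion-free reduced case\<close>

context comm_group
begin

lemma mult_div_cancel:
  assumes "x \<in> carrier G" "y \<in> carrier G"
  shows "y \<otimes> (x \<otimes> inv y) = x"
  using assms m_comm[of y "x \<otimes> inv y"] by (simp add: m_assoc)

lemma div_div_cancel_left:
  assumes "x \<in> carrier G" "u \<in> carrier G" "v \<in> carrier G"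
  shows "(x \<otimes> inv u) \<otimes> inv (x \<otimes> inv v) = v \<otimes> inv u"
proof -
  have "(x \<otimes> inv u) \<otimes> inv (x \<otimes> inv v) = (inv u \<otimes> x) \<otimes> (inv x \<otimes> v)"
    using assms m_comm[of x "inv u"] by (simp add: inv_mult)
  also have "\<dots> = inv u \<otimes> ((x \<otimes> inv x) \<otimes> v)"
    using assms by (simp only: m_assoc m_closed inv_closed)
  finally show ?thesis using assms m_comm[of "inv u" v] by simp
qed

lemma div_div_cancel_right:
  assumes "x \<in> carrier G" "y \<in> carrier G" "u \<in> carrier G"
  shows "(x \<otimes> inv u) \<otimes> inv (y \<otimes> inv u) = x \<otimes> inv y"
proof -
  have "(x \<otimes> inv u) \<otimes> inv (y \<otimes> inv u) = (x \<otimes> inv u) \<otimes> (u \<otimes> inv y)"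
    using assms m_comm[of u "inv y"] by (simp add: inv_mult)
  also have "\<dots> = x \<otimes> ((inv u \<otimes> u) \<otimes> inv y)"
    using assms by (simp only: m_assoc m_closed inv_closed)
  finally show ?thesis using assms by simp
qed

lemma div_mult_div:
  assumes "x \<in> carrier G" "y \<in> carrier G" "u \<in> carrier G" "v \<in> carrier G"
  shows "(x \<otimes> inv y) \<otimes> inv (u \<otimes> inv v) = (x \<otimes> inv u) \<otimes> inv (y \<otimes> inv v)"
  using assms by (simp add: inv_mult m_ac)

text \<open>Completeness: the powers of \<open>a\<close> with p-adically Cauchy exponents have a
  limit. A finite set of the congruences is solved by the term of largest index occurring in
  it.\<close>

lemma pure_injective_adic_limit:
  fixes p :: int and k :: "nat \<Rightarrow> int"
  assumes pi: "pure_injective G" and p: "p \<noteq> 0" and a: "a \<in> carrier G"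
    and diff: "\<And>m n. n \<le> m \<Longrightarrow> p ^ n dvd k m - k n"
  obtains c where "c \<in> carrier G" "\<And>n. c \<otimes> inv (a [^] k n) \<in> powers G (p ^ n)"
proof (rule pure_injective_congruences[OF pi, of UNIV "\<lambda>n. a [^] k n" "\<lambda>n. p ^ n"])
  fix F :: "nat set" assume F: "finite F"
  define m where "m = Max F"
  show "\<exists>y\<in>carrier G. \<forall>n\<in>F. y \<otimes> inv (a [^] k n) \<in> powers G (p ^ n)"
  proof (intro bexI ballI)
    fix n assume "n \<in> F"
    then have "p ^ n dvd k m - k n" using F diff by (simp add: m_def)
    then have "a [^] (k m - k n) \<in> powers G (p ^ n)" using powersI[OF a] powers_mono by blast
    then show "a [^] k m \<otimes> inv (a [^] k n) \<in> powers G (p ^ n)" using a by (simp add: int_pow_diff)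
  qed (use a in auto)
qed (use a p that in auto)

text \<open>The p-adic closure \<open>C\<close> of \<open>cyclic G a\<close> is a direct summand.
  Its complement \<open>E\<close> is maximal among the subgroups modulo which every
  \<open>a [^] (p ^ n)\<close> keeps height exactly \<open>n\<close>. The condition gives
  \<open>C \<inter> E = {\<one>}\<close>; maximality makes \<open>E\<close> closed under p-th roots
  and p-adically closed, and makes \<open>a\<close> generate the group modulo \<open>E\<close> and
  each \<open>powers G (p ^ n)\<close>. Every \<open>x\<close> then has Cauchy coefficients with
  respect to \<open>a\<close>; their limit is its component in \<open>C\<close>.\<close>

lemma indecomposable_adic_dense:
  fixes p :: int
  assumes ind: "indecomposable G" and pi: "pure_injective G" and tf: "torsion_free G" and p: "prime p"
    and sep: "(\<Inter>n. powers G (p ^ n)) = {\<one>}" and a: "a \<in> carrier G" "a \<notin> powers G p"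
  shows "carrier G \<subseteq> cyclic G a <#> powers G (p ^ n)"
proof -
  define S where "S L n = L <#> powers G (p ^ n)" for L and n :: nat
  \<comment> \<open>The condition that no \<open>a [^] (p ^ n)\<close> lies in
    \<open>S L (Suc n)\<close> is rephrased as disjointness of \<open>L\<close> from one fixed set,
    the form to which the maximality lemma applies.\<close>
  define Bad where "Bad = {e \<in> carrier G. \<exists>n. \<exists>y\<in>carrier G. a [^] (p ^ n) = e \<otimes> y [^] (p ^ Suc n)}"
  have p0: "p \<noteq> 0" using p by auto
  have subS: "subgroup (S L n) G" and upS: "L \<subseteq> S L n" "powers G (p ^ n) \<subseteq> S L n"
    if "subgroup L G" for L n
    using that mult_subgroups subgroup_powers set_mult_upper1 set_mult_upper2 unfolding S_def by auto
  have mono: "S L n \<subseteq> S L m" if "m \<le> n" for L m n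
    using powers_mono[of "p ^ m" "p ^ n"] that by (auto simp: S_def set_mult_def le_imp_power_dvd)
  have bad: "L \<inter> Bad = {} \<longleftrightarrow> (\<forall>n. a [^] (p ^ n) \<notin> S L (Suc n))" if "subgroup L G" for L
    using subgroup.mem_carrier[OF that] unfolding Bad_def S_def set_mult_def powers_def by blast
  have "{\<one>} \<inter> Bad = {}"
  proof -
    have False if y: "y \<in> carrier G" "a [^] (p ^ n) = \<one> \<otimes> y [^] (p ^ Suc n)" for n y
    proof -
      have "a [^] (p ^ n) \<in> powers G (p ^ n * p)" using y powersI[of y G "p ^ n * p"] by (simp add: mult.commute)
      then have "a \<in> powers G p" using torsion_free_powers_cancel[OF tf _ a(1), of "p ^ n" p] p0 by simp
      then show False using a by blast
    qed
    then show ?thesis unfolding Bad_def by blast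
  qed
  then obtain E where E: "subgroup E G" "E \<inter> Bad = {}"
    and max: "\<And>L. subgroup L G \<Longrightarrow> E \<subseteq> L \<Longrightarrow> L \<inter> Bad = {} \<Longrightarrow> L = E"
    by (rule maximal_subgroup_avoiding[OF triv_subgroup]) blast
  have good: "a [^] (p ^ n) \<notin> S E (Suc n)" for n using E bad by blast
  have dvd: "p ^ n dvd k" if k: "a [^] k \<in> S E n" for k n
  proof (cases n)
    case (Suc m)
    show ?thesis
    proof (rule ccontr)
      assume nd: "\<not> p ^ n dvd k"
      have "a [^] (p ^ n) \<in> S E n" using powersI[OF a(1)] upS(2)[OF E(1)] by blast
      then have "a [^] (p ^ m) \<in> S E n"
        using subgroup_pow_primepow[OF subS[OF E(1)] a(1) k, of p m] nd p Suc by simp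
      then show False using good Suc by blast
    qed
  qed simp
  \<comment> \<open>If adjoining \<open>x\<close> to \<open>E\<close> violated the condition at
    level \<open>n\<close>, the p-th power of the offending equation would violate it for
    \<open>E\<close> itself at level \<open>Suc n\<close>, because \<open>x [^] p\<close> is already
    in \<open>E\<close>.\<close>
  have root: "x \<in> E" if x: "x \<in> carrier G" and xp: "x [^] p \<in> E" for x
  proof -
    define L where "L = E <#> cyclic G x"
    have L: "subgroup L G" unfolding L_def by (rule mult_subgroups[OF E(1) subgroup_cyclic[OF x]])
    have "a [^] (p ^ n) \<notin> S L (Suc n)" for n
    proof
      assume "a [^] (p ^ n) \<in> S L (Suc n)"
      then obtain l y where l: "l \<in> L" "y \<in> carrier G" "a [^] (p ^ n) = l \<otimes> y [^] (p ^ Suc n)"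
        unfolding S_def by (metis set_multE powersE)
      obtain e and k :: int where e: "e \<in> E" "l = e \<otimes> x [^] k"
        using l(1) unfolding L_def by (auto elim!: set_multE simp: cyclic_def)
      have ec: "e \<in> carrier G" using e E(1) subgroup.mem_carrier by metis
      have "a [^] (p ^ Suc n) = (a [^] (p ^ n)) [^] p" using a by (simp add: int_pow_pow mult.commute)
      also have "\<dots> = (e [^] p \<otimes> (x [^] p) [^] k) \<otimes> y [^] (p ^ Suc (Suc n))"
        unfolding l(3) e(2) using ec x l(2) by (simp add: int_pow_distrib int_pow_pow mult_ac)
      also have "\<dots> \<in> S E (Suc (Suc n))"
        unfolding S_def
        by (rule set_multI[OF subgroup.m_closed[OF E(1) subgroup_int_pow_closed[OF E(1) e(1)]
              subgroup_int_pow_closed[OF E(1) xp]] powersI[OF l(2)]])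
      finally show False using good by blast
    qed
    then have "L = E" using max[OF L] bad[OF L] set_mult_upper1[OF E(1) subgroup_cyclic[OF x]]
      unfolding L_def by blast
    then show ?thesis using set_mult_upper2[OF E(1) subgroup_cyclic[OF x]] self_in_cyclic[OF x]
      unfolding L_def by blast
  qed
  define T where "T n = cyclic G a <#> S E n" for n
  have subT: "subgroup (T n) G" for n
    unfolding T_def by (rule mult_subgroups[OF subgroup_cyclic[OF a(1)] subS[OF E(1)]])
  have upT: "cyclic G a \<subseteq> T n" "E \<subseteq> T n" "powers G (p ^ n) \<subseteq> T n" for n
    unfolding T_def using set_mult_upper1[OF subgroup_cyclic[OF a(1)] subS[OF E(1)]]
      set_mult_upper2[OF subgroup_cyclic[OF a(1)] subS[OF E(1)]] upS[OF E(1)] by blast+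
  have T1: "x \<in> T 1" if x: "x \<in> carrier G" for x
  proof (cases "x \<in> E")
    case False
    \<comment> \<open>For \<open>x\<close> outside \<open>E\<close>, maximality yields a relation
      between \<open>a\<close> and \<open>x\<close> at some level; at the least such level the
      exponent \<open>j\<close> of \<open>x\<close> is prime to \<open>p\<close>, so that the
      relation can be solved for \<open>x\<close>.\<close>
    define R where "R n \<longleftrightarrow> (\<exists>e\<in>E. \<exists>j::int. \<exists>y\<in>carrier G. a [^] (p ^ n) = (e \<otimes> x [^] j) \<otimes> y [^] (p ^ Suc n))" for n
    define L where "L = E <#> cyclic G x"
    have L: "subgroup L G" unfolding L_def by (rule mult_subgroups[OF E(1) subgroup_cyclic[OF x]])
    have EL: "E \<subseteq> L" unfolding L_def by (rule set_mult_upper1[OF E(1) subgroup_cyclic[OF x]])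
    have "x \<in> L" using set_mult_upper2[OF E(1) subgroup_cyclic[OF x]] self_in_cyclic[OF x]
      unfolding L_def by blast
    then have "L \<noteq> E" using False by blast
    then obtain n where "a [^] (p ^ n) \<in> S L (Suc n)" using max[OF L EL] bad[OF L] by blast
    then have "R n" unfolding S_def L_def R_def set_mult_def cyclic_def powers_def by blast
    then obtain n where n: "R n" and least: "\<And>m. m < n \<Longrightarrow> \<not> R m"
      using exists_least_iff[of R] by blast
    obtain e and j :: int and y where e: "e \<in> E" and y: "y \<in> carrier G"
      and eq: "a [^] (p ^ n) = (e \<otimes> x [^] j) \<otimes> y [^] (p ^ Suc n)"
      using n unfolding R_def by blast
    have ec: "e \<in> carrier G" using e E(1) subgroup.mem_carrier by metis
    have "\<not> p dvd j"
    proof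
      assume "p dvd j"
      then obtain i where i: "j = i * p" by (metis dvdE mult.commute)
      show False
      proof (cases n)
        case 0
        have "a [^] (p ^ n) = e \<otimes> (x [^] i \<otimes> y) [^] p"
          unfolding eq using 0 i ec x y by (simp add: int_pow_distrib int_pow_pow m_assoc)
        also have "\<dots> \<in> S E (Suc 0)"
          unfolding S_def using e x y by (intro set_multI) (auto intro: powersI)
        finally show False using good[of 0] 0 by simp
      next
        case (Suc m)
        \<comment> \<open>Chosen as the p-th root of \<open>e\<close> that the relation suggests
          once \<open>x [^] j\<close> is a p-th power. As \<open>E\<close> is closed under p-th
          roots, \<open>w\<close> lies in \<open>E\<close>, and the relation descends to level
          \<open>m\<close>.\<close>
        define w where "w = a [^] (p ^ m) \<otimes> inv (x [^] i \<otimes> y [^] (p ^ n))"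
        have w: "w \<in> carrier G" using a x y by (simp add: w_def)
        have aw: "a [^] (p ^ m) = (w \<otimes> x [^] i) \<otimes> y [^] (p ^ Suc m)"
          using a x y Suc by (simp add: w_def m_assoc)
        have "(w \<otimes> x [^] i) [^] p \<otimes> y [^] (p ^ Suc n) = (a [^] (p ^ m)) [^] p"
          unfolding aw using w x y Suc by (simp add: int_pow_distrib int_pow_pow mult_ac)
        also have "\<dots> = a [^] (p ^ n)" using a Suc by (simp add: int_pow_pow mult.commute)
        also have "\<dots> = (e \<otimes> x [^] j) \<otimes> y [^] (p ^ Suc n)" by (rule eq)
        finally have "w [^] p \<otimes> x [^] j = e \<otimes> x [^] j"
          using w x y ec i by (simp add: int_pow_distrib int_pow_pow)
        then have "w [^] p = e" using w x ec by simp
        then have "w \<in> E" using root[OF w] e by simp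
        then have "R m" unfolding R_def using aw y by blast
        then show False using least Suc by simp
      qed
    qed
    then have cop: "coprime j p" using p by (metis coprime_commute prime_imp_coprime)
    have "x [^] j = inv e \<otimes> (a [^] (p ^ n) \<otimes> inv (y [^] (p ^ Suc n)))"
      unfolding eq using ec x y by (simp add: m_assoc) (simp add: m_assoc[symmetric])
    also have "\<dots> \<in> T 1"
    proof (intro subgroup.m_closed[OF subT] subgroup.m_inv_closed[OF subT])
      show "e \<in> T 1" using e upT by blast
      show "a [^] (p ^ n) \<in> T 1" using cyclicI[of G a "p ^ n"] upT by blast
      have "y [^] (p ^ Suc n) \<in> powers G (p ^ 1)"
        using powersI[OF y, of "p ^ Suc n"] powers_mono[of "p ^ 1" "p ^ Suc n"] by auto
      then show "y [^] (p ^ Suc n) \<in> T 1" using upT by blast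
    qed
    finally have "x [^] j \<in> T 1" .
    moreover have "x [^] p \<in> T 1" using powersI[OF x, of "p ^ 1"] upT(3)[of 1] by auto
    ultimately show ?thesis using subgroup_pow_coprime[OF subT x _ _ cop] by blast
  qed (use upT in blast)
  \<comment> \<open>Density modulo \<open>p\<close> is iterated: the factor \<open>y\<close> of the
    remainder \<open>y [^] (p ^ n)\<close> is decomposed modulo \<open>p\<close> in its
    turn.\<close>
  have T: "x \<in> T n" if "x \<in> carrier G" for x n
    using that
  proof (induction n arbitrary: x)
    case 0
    then show ?case using upT(3)[of 0] powers_one by auto
  next
    case (Suc n)
    have "x \<in> cyclic G a <#> (E <#> powers G (p ^ n))" using Suc unfolding T_def S_def by blast
    then obtain k e y where 1: "k \<in> cyclic G a" "e \<in> E" "y \<in> carrier G" "x = k \<otimes> (e \<otimes> y [^] (p ^ n))"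
      by (metis set_multE powersE)
    have "y \<in> cyclic G a <#> (E <#> powers G p)" using T1[OF 1(3)] unfolding T_def S_def by simp
    then obtain k' e' z where 2: "k' \<in> cyclic G a" "e' \<in> E" "z \<in> carrier G" "y = k' \<otimes> (e' \<otimes> z [^] p)"
      by (metis set_multE powersE)
    have c: "k' \<in> carrier G" "e' \<in> carrier G"
      using 2 subgroup.mem_carrier[OF subgroup_cyclic[OF a(1)]] subgroup.mem_carrier[OF E(1)] by auto
    have "y [^] (p ^ n) = k' [^] (p ^ n) \<otimes> (e' [^] (p ^ n) \<otimes> z [^] (p ^ Suc n))"
      unfolding 2(4) using c 2(3) by (simp add: int_pow_distrib int_pow_pow)
    moreover have "k' [^] (p ^ n) \<in> T (Suc n)" "e' [^] (p ^ n) \<in> T (Suc n)"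
      using 2 upT subgroup_int_pow_closed[OF subT] by blast+
    moreover have "z [^] (p ^ Suc n) \<in> T (Suc n)" using powersI[OF 2(3)] upT by blast
    ultimately have "y [^] (p ^ n) \<in> T (Suc n)" using subgroup.m_closed[OF subT] by simp
    moreover have "k \<in> T (Suc n)" "e \<in> T (Suc n)" using 1 upT by blast+
    ultimately show ?case unfolding 1(4) using subgroup.m_closed[OF subT] by simp
  qed
  define C where "C = (\<Inter>n. cyclic G a <#> powers G (p ^ n))"
  have C: "subgroup C G" unfolding C_def
    by (rule subgroup_Inter) (use mult_subgroups[OF subgroup_cyclic[OF a(1)] subgroup_powers] in auto)
  have CE: "C \<inter> E = {\<one>}"
  proof -
    have "x \<in> powers G (p ^ n)" if x: "x \<in> C" "x \<in> E" for x n
    proof -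
      have "x \<in> cyclic G a <#> powers G (p ^ n)" using x by (auto simp: C_def)
      then obtain k :: int and y where y: "y \<in> powers G (p ^ n)" "x = a [^] k \<otimes> y"
        by (auto elim!: set_multE simp: cyclic_def)
      have yc: "y \<in> carrier G" using y subgroup.mem_carrier[OF subgroup_powers] by metis
      have "a [^] k = x \<otimes> inv y" using y yc a by (simp add: m_assoc)
      also have "\<dots> \<in> S E n" unfolding S_def
        by (rule set_multI[OF x(2) subgroup.m_inv_closed[OF subgroup_powers y(1)]])
      finally have "p ^ n dvd k" by (rule dvd)
      then have "a [^] k \<in> powers G (p ^ n)" using powersI[OF a(1)] powers_mono by blast
      then show ?thesis using y subgroup.m_closed[OF subgroup_powers] by metis
    qed
    then have "C \<inter> E \<subseteq> {\<one>}" using sep by blast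
    then show ?thesis using subgroup.one_closed[OF C] subgroup.one_closed[OF E(1)] by blast
  qed
  \<comment> \<open>The p-adic closure of \<open>E\<close> satisfies the same height condition,
    since it agrees with \<open>E\<close> modulo each \<open>powers G (p ^ n)\<close>; maximality
    makes it equal to \<open>E\<close>.\<close>
  have closed: "x \<in> E" if "\<And>n. x \<in> S E n" for x
  proof -
    define E' where "E' = (\<Inter>n. S E n)"
    have E': "subgroup E' G" unfolding E'_def by (rule subgroup_Inter) (use subS[OF E(1)] in auto)
    have "S E' (Suc n) \<subseteq> S E (Suc n)" for n
    proof
      fix z assume "z \<in> S E' (Suc n)"
      then obtain u v where uv: "u \<in> E'" "v \<in> powers G (p ^ Suc n)" "z = u \<otimes> v"
        unfolding S_def by (metis set_multE)
      have "u \<in> S E (Suc n)" using uv(1) unfolding E'_def by blast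
      moreover have "v \<in> S E (Suc n)" using uv(2) upS(2)[OF E(1)] by blast
      ultimately show "z \<in> S E (Suc n)" using uv subgroup.m_closed[OF subS[OF E(1)]] by simp
    qed
    then have "E' \<inter> Bad = {}" using bad[OF E'] good by blast
    moreover have "E \<subseteq> E'" using upS[OF E(1)] by (auto simp: E'_def)
    ultimately have "E' = E" using max[OF E'] by blast
    then show ?thesis using that by (auto simp: E'_def)
  qed
  have "carrier G \<subseteq> C <#> E"
  proof
    fix x assume x: "x \<in> carrier G"
    have "\<exists>k::int. x \<otimes> inv (a [^] k) \<in> S E n" for n
    proof -
      have "x \<in> cyclic G a <#> S E n" using T[OF x] by (simp add: T_def)
      then obtain k :: int and s where s: "s \<in> S E n" "x = a [^] k \<otimes> s"
        by (auto elim!: set_multE simp: cyclic_def)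
      have sc: "s \<in> carrier G" using s subgroup.mem_carrier[OF subS[OF E(1)]] by metis
      then have "x = s \<otimes> a [^] k" using s a m_comm by simp
      then have "x \<otimes> inv (a [^] k) = s" using sc a by (simp add: m_assoc)
      then show ?thesis using s by metis
    qed
    then obtain k :: "nat \<Rightarrow> int" where k: "\<And>n. x \<otimes> inv (a [^] k n) \<in> S E n" by metis
    have diff: "p ^ n dvd k m - k n" if "n \<le> m" for m n
    proof (rule dvd)
      have 1: "x \<otimes> inv (a [^] k m) \<in> S E n" using k mono[OF that] by blast
      have "a [^] (k m - k n) = (x \<otimes> inv (a [^] k n)) \<otimes> inv (x \<otimes> inv (a [^] k m))"
        using x a by (simp add: int_pow_diff div_div_cancel_left)
      also have "\<dots> \<in> S E n"
        using k 1 subgroup.m_closed[OF subS[OF E(1)]] subgroup.m_inv_closed[OF subS[OF E(1)]] by blast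
      finally show "a [^] (k m - k n) \<in> S E n" .
    qed
    obtain c where c: "c \<in> carrier G" "\<And>n. c \<otimes> inv (a [^] k n) \<in> powers G (p ^ n)"
      using pure_injective_adic_limit[OF pi p0 a(1) diff] by blast
    have "c \<in> C" unfolding C_def
    proof
      fix n
      have "a [^] k n \<otimes> (c \<otimes> inv (a [^] k n)) \<in> cyclic G a <#> powers G (p ^ n)"
        by (rule set_multI[OF cyclicI c(2)])
      then show "c \<in> cyclic G a <#> powers G (p ^ n)" using mult_div_cancel a(1) c(1) by simp
    qed
    moreover have "x \<otimes> inv c \<in> E"
    proof (rule closed)
      fix n
      have 1: "c \<otimes> inv (a [^] k n) \<in> S E n" using c(2) upS[OF E(1)] by blast
      have "x \<otimes> inv c = (x \<otimes> inv (a [^] k n)) \<otimes> inv (c \<otimes> inv (a [^] k n))"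
        using x a c by (simp add: div_div_cancel_right)
      also have "\<dots> \<in> S E n"
        using k 1 subgroup.m_closed[OF subS[OF E(1)]] subgroup.m_inv_closed[OF subS[OF E(1)]] by blast
      finally show "x \<otimes> inv c \<in> S E n" .
    qed
    ultimately have "c \<otimes> (x \<otimes> inv c) \<in> C <#> E" by (rule set_multI)
    then show "x \<in> C <#> E" using mult_div_cancel[OF x c(1)] by simp
  qed
  then have "C <#> E = carrier G" using subgroup.subset[OF mult_subgroups[OF C E(1)]] by blast
  moreover have "C \<noteq> {\<one>}"
  proof -
    have "a \<in> C" unfolding C_def
      using set_mult_upper1[OF subgroup_cyclic[OF a(1)] subgroup_powers] self_in_cyclic[OF a(1)] by blast
    moreover have "a \<noteq> \<one>" using a subgroup.one_closed[OF subgroup_powers] by metis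
    ultimately show ?thesis by blast
  qed
  ultimately have "C = carrier G" using indecomposable_summand[OF ind C E(1) CE] by blast
  then show ?thesis by (auto simp: C_def)
qed

theorem indecomposable_pure_injective_has_kind:
  assumes ind: "indecomposable G" and pi: "pure_injective G"
  shows "\<exists>t. has_kind G t"
proof (cases "torsion_free G")
  case False
  then obtain p :: int and x where x: "x \<in> carrier G" "prime p" "x [^] p = \<one>" "x \<noteq> \<one>"
    using torsion_freeI_prime by blast
  show ?thesis
  proof (cases "\<forall>y n. y \<in> carrier G \<longrightarrow> y [^] p = \<one> \<longrightarrow> y \<in> powers G (p ^ n)")
    case True
    then show ?thesis using indecomposable_pruefer[OF ind x(2,1,4,3)] by blast
  next
    case False
    then obtain y n where y: "y \<in> carrier G" "y [^] p = \<one>" "y \<notin> powers G (p ^ n)" by blast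
    \<comment> \<open>Every element is divisible by \<open>p ^ 0\<close>, and \<open>y\<close> fails
      at some later exponent; in between lies its exact height.\<close>
    then have "\<exists>n. y \<in> powers G (p ^ n) \<and> y \<notin> powers G (p ^ Suc n)"
      using powers_one by (induction n) auto
    then show ?thesis using indecomposable_cyclic[OF ind x(2) y(2)] by blast
  qed
next
  case tf: True
  show ?thesis
  proof (cases "\<forall>p::int. prime p \<longrightarrow> powers G p = carrier G")
    case True
    then show ?thesis using indecomposable_rational[OF ind tf] by blast
  next
    case False
    then obtain p :: int where p: "powers G p \<noteq> carrier G" "prime p" by blast
    then obtain a where a: "a \<in> carrier G" "a \<notin> powers G p"
      using subgroup.subset[OF subgroup_powers] by blast
    note loc = indecomposable_adic_local[OF ind pi tf p]
    have "has_kind G (Adic p)"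
      unfolding has_kind.simps
      using loc p(2) tf pi a indecomposable_adic_dense[OF ind pi tf p(2) loc(1) a] by blast
    then show ?thesis by blast
  qed
qed

end

section \<open>Groups of the same kind are isomorphic\<close>

text \<open>Closure under quotients makes \<open>R\<close> a subgroup of the product; trivial
  kernels on both sides make it single-valued and injective. In the applications this replaces the
  choice of coefficients and the proof that the choice does not matter.\<close>

lemma is_iso_of_relation:
  assumes A: "group A" and B: "group B"
    and R: "R \<subseteq> carrier A \<times> carrier B"
    and div: "\<And>x y x' y'. (x, y) \<in> R \<Longrightarrow> (x', y') \<in> R \<Longrightarrow> (x \<otimes>\<^bsub>A\<^esub> inv\<^bsub>A\<^esub> x', y \<otimes>\<^bsub>B\<^esub> inv\<^bsub>B\<^esub> y') \<in> R"
    and tot: "\<And>x. x \<in> carrier A \<Longrightarrow> \<exists>y. (x, y) \<in> R"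
    and sur: "\<And>y. y \<in> carrier B \<Longrightarrow> \<exists>x. (x, y) \<in> R"
    and ker1: "\<And>y. (\<one>\<^bsub>A\<^esub>, y) \<in> R \<Longrightarrow> y = \<one>\<^bsub>B\<^esub>"
    and ker2: "\<And>x. (x, \<one>\<^bsub>B\<^esub>) \<in> R \<Longrightarrow> x = \<one>\<^bsub>A\<^esub>"
  shows "A \<cong> B"
proof -
  interpret A: group A by fact
  interpret B: group B by fact
  have uniq1: "y = y'" if "(x, y) \<in> R" "(x, y') \<in> R" for x y y'
  proof -
    have c: "x \<in> carrier A" "y \<in> carrier B" "y' \<in> carrier B" using that R by auto
    then have "y \<otimes>\<^bsub>B\<^esub> inv\<^bsub>B\<^esub> y' = \<one>\<^bsub>B\<^esub>" using div[OF that] ker1 by simp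
    then show ?thesis using c by (metis B.inv_equality B.inv_inv B.inv_closed)
  qed
  have uniq2: "x = x'" if "(x, y) \<in> R" "(x', y) \<in> R" for x x' y
  proof -
    have c: "x \<in> carrier A" "x' \<in> carrier A" "y \<in> carrier B" using that R by auto
    then have "x \<otimes>\<^bsub>A\<^esub> inv\<^bsub>A\<^esub> x' = \<one>\<^bsub>A\<^esub>" using div[OF that] ker2 by simp
    then show ?thesis using c by (metis A.inv_equality A.inv_inv A.inv_closed)
  qed
  obtain f where f: "\<And>x. x \<in> carrier A \<Longrightarrow> (x, f x) \<in> R" using tot by metis
  have fc: "f x \<in> carrier B" if "x \<in> carrier A" for x using f[OF that] R by auto
  have one: "(\<one>\<^bsub>A\<^esub>, \<one>\<^bsub>B\<^esub>) \<in> R" using f[of "\<one>\<^bsub>A\<^esub>"] ker1 by fastforce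
  have mult: "(x \<otimes>\<^bsub>A\<^esub> x', y \<otimes>\<^bsub>B\<^esub> y') \<in> R" if "(x, y) \<in> R" "(x', y') \<in> R" for x y x' y'
  proof -
    have c: "x' \<in> carrier A" "y' \<in> carrier B" using that R by auto
    have "(inv\<^bsub>A\<^esub> x', inv\<^bsub>B\<^esub> y') \<in> R" using div[OF one that(2)] c by simp
    from div[OF that(1) this] show ?thesis using c by simp
  qed
  have "f \<in> iso A B"
  proof (rule isoI)
    show "f \<in> hom A B"
    proof (rule homI)
      fix x y assume "x \<in> carrier A" "y \<in> carrier A"
      then show "f (x \<otimes>\<^bsub>A\<^esub> y) = f x \<otimes>\<^bsub>B\<^esub> f y"
        using uniq1[OF f mult[OF f f]] by simp
    qed (rule fc)
    show "bij_betw f (carrier A) (carrier B)"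
    proof (rule bij_betwI')
      fix x y assume xy: "x \<in> carrier A" "y \<in> carrier A"
      then show "(f x = f y) = (x = y)" using f[of x] f[of y] uniq2 by metis
    next
      fix y assume y: "y \<in> carrier B"
      then obtain x where x: "(x, y) \<in> R" using sur by blast
      then have xc: "x \<in> carrier A" using R by auto
      then show "\<exists>x\<in>carrier A. y = f x" using uniq1[OF x f[OF xc]] by blast
    qed (rule fc)
  qed
  then show ?thesis by (auto simp: is_iso_def)
qed

context comm_group
begin

lemma primepow_order_iff:
  fixes p :: int
  assumes "a \<in> carrier G" "prime p" "a [^] (p ^ n) \<noteq> \<one>" "a [^] (p ^ Suc n) = \<one>"
  shows "a [^] k = \<one> \<longleftrightarrow> p ^ Suc n dvd k"
  using subgroup_pow_primepow[OF triv_subgroup assms(1), of k p n] assms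
    subgroup_pow_dvd[OF triv_subgroup assms(1), of "p ^ Suc n" k] by blast

lemma root_sequence_pow:
  fixes p :: int
  assumes a: "\<And>n. a n \<in> carrier G" "\<And>n. a (Suc n) [^] p = a n"
  shows "a (n + m) [^] (p ^ m) = a n"
proof (induction m)
  case 0
  then show ?case using a(1) by simp
next
  case (Suc m)
  have "a (n + Suc m) [^] (p ^ Suc m) = (a (Suc (n + m)) [^] p) [^] (p ^ m)"
    using a(1) by (simp add: int_pow_pow)
  then show ?case using Suc a(2) by simp
qed

lemma root_sequence_pow_eq_one_iff:
  fixes p :: int
  assumes a: "\<And>n. a n \<in> carrier G" "\<And>n. a (Suc n) [^] p = a n"
    and p: "prime p" and a0: "a 0 \<noteq> \<one>" "a 0 [^] p = \<one>"
  shows "a n [^] k = \<one> \<longleftrightarrow> p ^ Suc n dvd k"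
proof (rule primepow_order_iff[OF a(1) p])
  have 1: "a n [^] (p ^ n) = a 0" using root_sequence_pow[of a p 0 n] a by simp
  then show "a n [^] (p ^ n) \<noteq> \<one>" using a0 by simp
  have "a n [^] (p ^ Suc n) = (a n [^] (p ^ n)) [^] p"
    using a(1) by (simp add: int_pow_pow mult.commute)
  then show "a n [^] (p ^ Suc n) = \<one>" using 1 a0 by simp
qed

text \<open>If \<open>a\<close> has p-height zero, the height of \<open>a [^] k\<close> is no larger
  than the exponent of \<open>p\<close> in \<open>k\<close>. Thus coefficients with respect to
  \<open>a\<close> are unique modulo \<open>p ^ n\<close>.\<close>

lemma torsion_free_pow_in_powers:
  fixes p :: int
  assumes tf: "torsion_free G" and p: "prime p" and a: "a \<in> carrier G" "a \<notin> powers G p"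
    and k: "a [^] k \<in> powers G (p ^ n)"
  shows "p ^ n dvd k"
proof (cases n)
  case (Suc m)
  show ?thesis
  proof (rule ccontr)
    assume "\<not> p ^ n dvd k"
    then have "a [^] (p ^ m) \<in> powers G (p ^ n)"
      using subgroup_pow_primepow[OF subgroup_powers a(1) k, of p m] p powersI[OF a(1)] Suc by blast
    then have "a [^] (p ^ m) \<in> powers G (p ^ m * p)" using Suc by (simp add: mult.commute)
    then show False using torsion_free_powers_cancel[OF tf _ a(1), of "p ^ m" p] a(2) p by auto
  qed
qed simp

lemma mem_cyclic_mult_powersE:
  assumes "x \<in> cyclic G a <#> powers G n" "a \<in> carrier G"
  obtains k :: int where "x \<otimes> inv (a [^] k) \<in> powers G n"
proof -
  obtain k :: int and s where s: "s \<in> powers G n" "x = a [^] k \<otimes> s"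
    using assms(1) by (auto elim!: set_multE simp: cyclic_def)
  have sc: "s \<in> carrier G" using s subgroup.mem_carrier[OF subgroup_powers] by metis
  then have "x = s \<otimes> a [^] k" using s assms(2) m_comm by simp
  then have "x \<otimes> inv (a [^] k) = s" using sc assms(2) by (simp add: m_assoc)
  then show thesis using that s by metis
qed

end

lemma cyclic_kind_iso:
  assumes A: "comm_group A" "has_kind A (Cyclic p n)" and B: "comm_group B" "has_kind B (Cyclic p n)"
  shows "A \<cong> B"
proof -
  interpret A: comm_group A by fact
  interpret B: comm_group B by fact
  obtain a where p: "prime p" and a: "a \<in> carrier A" "carrier A = cyclic A a" "a [^]\<^bsub>A\<^esub> (p ^ n) \<noteq> \<one>\<^bsub>A\<^esub>" "a [^]\<^bsub>A\<^esub> (p ^ Suc n) = \<one>\<^bsub>A\<^esub>"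
    using A(2) unfolding has_kind.simps by blast
  obtain b where b: "b \<in> carrier B" "carrier B = cyclic B b" "b [^]\<^bsub>B\<^esub> (p ^ n) \<noteq> \<one>\<^bsub>B\<^esub>" "b [^]\<^bsub>B\<^esub> (p ^ Suc n) = \<one>\<^bsub>B\<^esub>"
    using B(2) unfolding has_kind.simps by blast
  note iffA = A.primepow_order_iff[OF a(1) p a(3,4)] and iffB = B.primepow_order_iff[OF b(1) p b(3,4)]
  define R where "R = range (\<lambda>k::int. (a [^]\<^bsub>A\<^esub> k, b [^]\<^bsub>B\<^esub> k))"
  show ?thesis
  proof (rule is_iso_of_relation[OF A.is_group B.is_group, of R])
    show "R \<subseteq> carrier A \<times> carrier B" using a(1) b(1) by (auto simp: R_def)
    show "\<exists>y. (x, y) \<in> R" if "x \<in> carrier A" for x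
      using that unfolding a(2) cyclic_def R_def by blast
    show "\<exists>x. (x, y) \<in> R" if "y \<in> carrier B" for y
      using that unfolding b(2) cyclic_def R_def by blast
    show "y = \<one>\<^bsub>B\<^esub>" if r: "(\<one>\<^bsub>A\<^esub>, y) \<in> R" for y
    proof -
      obtain k :: int where "\<one>\<^bsub>A\<^esub> = a [^]\<^bsub>A\<^esub> k" "y = b [^]\<^bsub>B\<^esub> k" using r by (auto simp: R_def)
      then show ?thesis using iffA iffB by metis
    qed
    show "x = \<one>\<^bsub>A\<^esub>" if r: "(x, \<one>\<^bsub>B\<^esub>) \<in> R" for x
    proof -
      obtain k :: int where "x = a [^]\<^bsub>A\<^esub> k" "\<one>\<^bsub>B\<^esub> = b [^]\<^bsub>B\<^esub> k" using r by (auto simp: R_def)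
      then show ?thesis using iffA iffB by metis
    qed
    fix x y x' y' assume "(x, y) \<in> R" "(x', y') \<in> R"
    then obtain k l :: int where "x = a [^]\<^bsub>A\<^esub> k" "y = b [^]\<^bsub>B\<^esub> k" "x' = a [^]\<^bsub>A\<^esub> l" "y' = b [^]\<^bsub>B\<^esub> l"
      by (auto simp: R_def)
    then have "(x \<otimes>\<^bsub>A\<^esub> inv\<^bsub>A\<^esub> x', y \<otimes>\<^bsub>B\<^esub> inv\<^bsub>B\<^esub> y') = (a [^]\<^bsub>A\<^esub> (k - l), b [^]\<^bsub>B\<^esub> (k - l))"
      using a(1) b(1) by (simp add: A.int_pow_diff B.int_pow_diff)
    then show "(x \<otimes>\<^bsub>A\<^esub> inv\<^bsub>A\<^esub> x', y \<otimes>\<^bsub>B\<^esub> inv\<^bsub>B\<^esub> y') \<in> R" by (auto simp: R_def)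
  qed
qed

lemma pruefer_kind_iso:
  assumes A: "comm_group A" "has_kind A (Pruefer p)" and B: "comm_group B" "has_kind B (Pruefer p)"
  shows "A \<cong> B"
proof -
  interpret A: comm_group A by fact
  interpret B: comm_group B by fact
  obtain a where p: "prime p" and a0: "a 0 \<noteq> \<one>\<^bsub>A\<^esub>" "a 0 [^]\<^bsub>A\<^esub> p = \<one>\<^bsub>A\<^esub>"
    and a: "\<And>n. a n \<in> carrier A" "\<And>n. a (Suc n) [^]\<^bsub>A\<^esub> p = a n" and A_eq: "carrier A = (\<Union>n. cyclic A (a n))"
    using A(2) unfolding has_kind.simps by blast
  obtain b where b0: "b 0 \<noteq> \<one>\<^bsub>B\<^esub>" "b 0 [^]\<^bsub>B\<^esub> p = \<one>\<^bsub>B\<^esub>"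
    and b: "\<And>n. b n \<in> carrier B" "\<And>n. b (Suc n) [^]\<^bsub>B\<^esub> p = b n" and B_eq: "carrier B = (\<Union>n. cyclic B (b n))"
    using B(2) unfolding has_kind.simps by blast
  note iffA = A.root_sequence_pow_eq_one_iff[OF a p a0] and iffB = B.root_sequence_pow_eq_one_iff[OF b p b0]
  define R where "R = {(a n [^]\<^bsub>A\<^esub> k, b n [^]\<^bsub>B\<^esub> k) |n (k::int). True}"
  show ?thesis
  proof (rule is_iso_of_relation[OF A.is_group B.is_group, of R])
    show "R \<subseteq> carrier A \<times> carrier B" using a(1) b(1) by (auto simp: R_def)
    show "\<exists>y. (x, y) \<in> R" if "x \<in> carrier A" for x
      using that unfolding A_eq cyclic_def R_def by blast
    show "\<exists>x. (x, y) \<in> R" if "y \<in> carrier B" for y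
      using that unfolding B_eq cyclic_def R_def by blast
    show "y = \<one>\<^bsub>B\<^esub>" if r: "(\<one>\<^bsub>A\<^esub>, y) \<in> R" for y
    proof -
      obtain n and k :: int where "\<one>\<^bsub>A\<^esub> = a n [^]\<^bsub>A\<^esub> k" "y = b n [^]\<^bsub>B\<^esub> k" using r by (auto simp: R_def)
      then show ?thesis using iffA iffB by metis
    qed
    show "x = \<one>\<^bsub>A\<^esub>" if r: "(x, \<one>\<^bsub>B\<^esub>) \<in> R" for x
    proof -
      obtain n and k :: int where "x = a n [^]\<^bsub>A\<^esub> k" "\<one>\<^bsub>B\<^esub> = b n [^]\<^bsub>B\<^esub> k" using r by (auto simp: R_def)
      then show ?thesis using iffA iffB by metis
    qed
    fix x y x' y' assume "(x, y) \<in> R" "(x', y') \<in> R"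
    then obtain n m and k l :: int where eq: "x = a n [^]\<^bsub>A\<^esub> k" "y = b n [^]\<^bsub>B\<^esub> k" "x' = a m [^]\<^bsub>A\<^esub> l" "y' = b m [^]\<^bsub>B\<^esub> l"
      by (auto simp: R_def)
    \<comment> \<open>Both pairs are rewritten over the common index \<open>n + m\<close>, where
      subtracting exponents makes sense.\<close>
    have "x = a (n + m) [^]\<^bsub>A\<^esub> (p ^ m * k)" "x' = a (n + m) [^]\<^bsub>A\<^esub> (p ^ n * l)"
      using A.root_sequence_pow[of a p n m] A.root_sequence_pow[of a p m n] a eq
      by (simp_all add: A.int_pow_pow[symmetric] add.commute)
    moreover have "y = b (n + m) [^]\<^bsub>B\<^esub> (p ^ m * k)" "y' = b (n + m) [^]\<^bsub>B\<^esub> (p ^ n * l)"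
      using B.root_sequence_pow[of b p n m] B.root_sequence_pow[of b p m n] b eq
      by (simp_all add: B.int_pow_pow[symmetric] add.commute)
    ultimately have "(x \<otimes>\<^bsub>A\<^esub> inv\<^bsub>A\<^esub> x', y \<otimes>\<^bsub>B\<^esub> inv\<^bsub>B\<^esub> y') =
        (a (n + m) [^]\<^bsub>A\<^esub> (p ^ m * k - p ^ n * l), b (n + m) [^]\<^bsub>B\<^esub> (p ^ m * k - p ^ n * l))"
      using a(1) b(1) by (simp add: A.int_pow_diff B.int_pow_diff)
    then show "(x \<otimes>\<^bsub>A\<^esub> inv\<^bsub>A\<^esub> x', y \<otimes>\<^bsub>B\<^esub> inv\<^bsub>B\<^esub> y') \<in> R" by (auto simp: R_def)
  qed
qed

text \<open>Both sides are the same rational multiple \<open>k / m\<close> of their base points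
  \<open>a\<close> and \<open>b\<close>.\<close>

definition rational_rel ::
  "('a, 'm) monoid_scheme \<Rightarrow> 'a \<Rightarrow> ('b, 'n) monoid_scheme \<Rightarrow> 'b \<Rightarrow> ('a \<times> 'b) set" where
  "rational_rel A a B b = {(x, y). x \<in> carrier A \<and> y \<in> carrier B \<and>
     (\<exists>(m::int) (k::int). m \<noteq> 0 \<and> x [^]\<^bsub>A\<^esub> m = a [^]\<^bsub>A\<^esub> k \<and> y [^]\<^bsub>B\<^esub> m = b [^]\<^bsub>B\<^esub> k)}"

lemma rational_rel_sym: "(x, y) \<in> rational_rel A a B b \<longleftrightarrow> (y, x) \<in> rational_rel B b A a"
  unfolding rational_rel_def by blast

lemma rational_rel_total:
  assumes "comm_group A" "comm_group B" "\<And>n. n \<noteq> 0 \<Longrightarrow> powers B n = carrier B" "b \<in> carrier B"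
    and "\<forall>x\<in>carrier A. \<exists>(m::int) (k::int). m \<noteq> 0 \<and> x [^]\<^bsub>A\<^esub> m = a [^]\<^bsub>A\<^esub> k" "x \<in> carrier A"
  shows "\<exists>y. (x, y) \<in> rational_rel A a B b"
proof -
  interpret B: comm_group B by fact
  obtain m k :: int where mk: "m \<noteq> 0" "x [^]\<^bsub>A\<^esub> m = a [^]\<^bsub>A\<^esub> k" using assms(5,6) by blast
  have "b [^]\<^bsub>B\<^esub> k \<in> powers B m" using assms(3)[OF mk(1)] assms(4) by simp
  then obtain y where y: "y \<in> carrier B" "y [^]\<^bsub>B\<^esub> m = b [^]\<^bsub>B\<^esub> k" by (metis powersE)
  then have "(x, y) \<in> rational_rel A a B b" using mk assms(6) unfolding rational_rel_def by blast
  then show ?thesis by blast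
qed

lemma rational_rel_kernel:
  assumes "comm_group A" "comm_group B" "torsion_free A" "torsion_free B" "a \<in> carrier A" "a \<noteq> \<one>\<^bsub>A\<^esub>"
    and "(\<one>\<^bsub>A\<^esub>, y) \<in> rational_rel A a B b"
  shows "y = \<one>\<^bsub>B\<^esub>"
proof -
  interpret A: comm_group A by fact
  interpret B: comm_group B by fact
  obtain m k :: int where mk: "y \<in> carrier B" "m \<noteq> 0" "\<one>\<^bsub>A\<^esub> [^]\<^bsub>A\<^esub> m = a [^]\<^bsub>A\<^esub> k" "y [^]\<^bsub>B\<^esub> m = b [^]\<^bsub>B\<^esub> k"
    using assms(7) unfolding rational_rel_def by blast
  have "a [^]\<^bsub>A\<^esub> k = \<one>\<^bsub>A\<^esub>" using mk by simp
  then have "k = 0" using assms(3,5,6) unfolding torsion_free_def by blast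
  then have "y [^]\<^bsub>B\<^esub> m = \<one>\<^bsub>B\<^esub>" using mk by simp
  then show ?thesis using mk assms(4) unfolding torsion_free_def by blast
qed

lemma rational_kind_iso:
  assumes A: "comm_group A" "has_kind A Rational" and B: "comm_group B" "has_kind B Rational"
  shows "A \<cong> B"
proof -
  interpret A: comm_group A by fact
  interpret B: comm_group B by fact
  obtain a where tfA: "torsion_free A" and dA: "\<And>n. n \<noteq> 0 \<Longrightarrow> powers A n = carrier A"
    and a: "a \<in> carrier A" "a \<noteq> \<one>\<^bsub>A\<^esub>" "\<forall>x\<in>carrier A. \<exists>(m::int) (k::int). m \<noteq> 0 \<and> x [^]\<^bsub>A\<^esub> m = a [^]\<^bsub>A\<^esub> k"
    using A(2) unfolding has_kind.simps by blast
  obtain b where tfB: "torsion_free B" and dB: "\<And>n. n \<noteq> 0 \<Longrightarrow> powers B n = carrier B"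
    and b: "b \<in> carrier B" "b \<noteq> \<one>\<^bsub>B\<^esub>" "\<forall>x\<in>carrier B. \<exists>(m::int) (k::int). m \<noteq> 0 \<and> x [^]\<^bsub>B\<^esub> m = b [^]\<^bsub>B\<^esub> k"
    using B(2) unfolding has_kind.simps by blast
  show ?thesis
  proof (rule is_iso_of_relation[OF A.is_group B.is_group, of "rational_rel A a B b"])
    show "rational_rel A a B b \<subseteq> carrier A \<times> carrier B" by (auto simp: rational_rel_def)
    show "\<exists>y. (x, y) \<in> rational_rel A a B b" if "x \<in> carrier A" for x
      using rational_rel_total[OF A(1) B(1) dB b(1) a(3) that] .
    show "\<exists>x. (x, y) \<in> rational_rel A a B b" if "y \<in> carrier B" for y
      using rational_rel_total[OF B(1) A(1) dA a(1) b(3) that] rational_rel_sym by metis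
    show "y = \<one>\<^bsub>B\<^esub>" if "(\<one>\<^bsub>A\<^esub>, y) \<in> rational_rel A a B b" for y
      using rational_rel_kernel[OF A(1) B(1) tfA tfB a(1,2) that] .
    show "x = \<one>\<^bsub>A\<^esub>" if "(x, \<one>\<^bsub>B\<^esub>) \<in> rational_rel A a B b" for x
      using rational_rel_kernel[OF B(1) A(1) tfB tfA b(1,2)] that rational_rel_sym by metis
    fix x y x' y' assume xy: "(x, y) \<in> rational_rel A a B b" "(x', y') \<in> rational_rel A a B b"
    obtain m k :: int where mk: "x \<in> carrier A" "y \<in> carrier B" "m \<noteq> 0"
      "x [^]\<^bsub>A\<^esub> m = a [^]\<^bsub>A\<^esub> k" "y [^]\<^bsub>B\<^esub> m = b [^]\<^bsub>B\<^esub> k"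
      using xy(1) unfolding rational_rel_def by blast
    obtain n l :: int where nl: "x' \<in> carrier A" "y' \<in> carrier B" "n \<noteq> 0"
      "x' [^]\<^bsub>A\<^esub> n = a [^]\<^bsub>A\<^esub> l" "y' [^]\<^bsub>B\<^esub> n = b [^]\<^bsub>B\<^esub> l"
      using xy(2) unfolding rational_rel_def by blast
    have "(x \<otimes>\<^bsub>A\<^esub> inv\<^bsub>A\<^esub> x') [^]\<^bsub>A\<^esub> (m * n) = (x [^]\<^bsub>A\<^esub> m) [^]\<^bsub>A\<^esub> n \<otimes>\<^bsub>A\<^esub> inv\<^bsub>A\<^esub> ((x' [^]\<^bsub>A\<^esub> n) [^]\<^bsub>A\<^esub> m)"
      using mk(1) nl(1) by (simp add: A.int_pow_distrib A.int_pow_inv A.int_pow_pow mult.commute)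
    also have "\<dots> = a [^]\<^bsub>A\<^esub> (k * n - l * m)"
      unfolding mk(4) nl(4) using a(1) by (simp add: A.int_pow_pow A.int_pow_diff)
    finally have 1: "(x \<otimes>\<^bsub>A\<^esub> inv\<^bsub>A\<^esub> x') [^]\<^bsub>A\<^esub> (m * n) = a [^]\<^bsub>A\<^esub> (k * n - l * m)" .
    have "(y \<otimes>\<^bsub>B\<^esub> inv\<^bsub>B\<^esub> y') [^]\<^bsub>B\<^esub> (m * n) = (y [^]\<^bsub>B\<^esub> m) [^]\<^bsub>B\<^esub> n \<otimes>\<^bsub>B\<^esub> inv\<^bsub>B\<^esub> ((y' [^]\<^bsub>B\<^esub> n) [^]\<^bsub>B\<^esub> m)"
      using mk(2) nl(2) by (simp add: B.int_pow_distrib B.int_pow_inv B.int_pow_pow mult.commute)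
    also have "\<dots> = b [^]\<^bsub>B\<^esub> (k * n - l * m)"
      unfolding mk(5) nl(5) using b(1) by (simp add: B.int_pow_pow B.int_pow_diff)
    finally have 2: "(y \<otimes>\<^bsub>B\<^esub> inv\<^bsub>B\<^esub> y') [^]\<^bsub>B\<^esub> (m * n) = b [^]\<^bsub>B\<^esub> (k * n - l * m)" .
    have "m * n \<noteq> 0" using mk nl by simp
    then show "(x \<otimes>\<^bsub>A\<^esub> inv\<^bsub>A\<^esub> x', y \<otimes>\<^bsub>B\<^esub> inv\<^bsub>B\<^esub> y') \<in> rational_rel A a B b"
      using 1 2 mk(1,2) nl(1,2) unfolding rational_rel_def by blast
  qed
qed

text \<open>Both sides are the same p-adic multiple of their base points: at each precision
  \<open>n\<close> one integer \<open>k\<close> approximates both. No coherence between the values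
  of \<open>k\<close> is demanded; it follows from uniqueness modulo \<open>p ^ n\<close>.\<close>

definition adic_rel ::
  "int \<Rightarrow> ('a, 'm) monoid_scheme \<Rightarrow> 'a \<Rightarrow> ('b, 'n) monoid_scheme \<Rightarrow> 'b \<Rightarrow> ('a \<times> 'b) set" where
  "adic_rel p A a B b = {(x, y). x \<in> carrier A \<and> y \<in> carrier B \<and>
     (\<forall>n::nat. \<exists>k::int. x \<otimes>\<^bsub>A\<^esub> inv\<^bsub>A\<^esub> (a [^]\<^bsub>A\<^esub> k) \<in> powers A (p ^ n) \<and> y \<otimes>\<^bsub>B\<^esub> inv\<^bsub>B\<^esub> (b [^]\<^bsub>B\<^esub> k) \<in> powers B (p ^ n))}"

lemma adic_rel_sym: "(x, y) \<in> adic_rel p A a B b \<longleftrightarrow> (y, x) \<in> adic_rel p B b A a"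
  unfolding adic_rel_def by blast

text \<open>Density in \<open>A\<close> supplies approximating coefficients, height zero of
  \<open>a\<close> makes them Cauchy, and pure-injectivity of \<open>B\<close> supplies their limit
  there.\<close>

lemma adic_rel_total:
  assumes "comm_group A" "comm_group B" and pi: "pure_injective B" and tf: "torsion_free A" and p: "prime p"
    and a: "a \<in> carrier A" "a \<notin> powers A p" and b: "b \<in> carrier B"
    and dense: "\<And>n. carrier A \<subseteq> cyclic A a <#>\<^bsub>A\<^esub> powers A (p ^ n)" and x: "x \<in> carrier A"
  shows "\<exists>y. (x, y) \<in> adic_rel p A a B b"
proof -
  interpret A: comm_group A by fact
  interpret B: comm_group B by fact
  have "\<exists>k::int. x \<otimes>\<^bsub>A\<^esub> inv\<^bsub>A\<^esub> (a [^]\<^bsub>A\<^esub> k) \<in> powers A (p ^ n)" for n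
    by (rule A.mem_cyclic_mult_powersE[OF subsetD[OF dense x] a(1)]) (rule exI)
  then obtain k :: "nat \<Rightarrow> int" where k: "\<And>n. x \<otimes>\<^bsub>A\<^esub> inv\<^bsub>A\<^esub> (a [^]\<^bsub>A\<^esub> k n) \<in> powers A (p ^ n)" by metis
  have diff: "p ^ n dvd k m - k n" if "n \<le> m" for m n
  proof (rule A.torsion_free_pow_in_powers[OF tf p a])
    have 1: "x \<otimes>\<^bsub>A\<^esub> inv\<^bsub>A\<^esub> (a [^]\<^bsub>A\<^esub> k m) \<in> powers A (p ^ n)"
      using k A.powers_mono le_imp_power_dvd[OF that] by blast
    have "a [^]\<^bsub>A\<^esub> (k m - k n) = (x \<otimes>\<^bsub>A\<^esub> inv\<^bsub>A\<^esub> (a [^]\<^bsub>A\<^esub> k n)) \<otimes>\<^bsub>A\<^esub> inv\<^bsub>A\<^esub> (x \<otimes>\<^bsub>A\<^esub> inv\<^bsub>A\<^esub> (a [^]\<^bsub>A\<^esub> k m))"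
      using x a(1) by (simp add: A.int_pow_diff A.div_div_cancel_left)
    also have "\<dots> \<in> powers A (p ^ n)"
      using k 1 subgroup.m_closed[OF A.subgroup_powers] subgroup.m_inv_closed[OF A.subgroup_powers] by blast
    finally show "a [^]\<^bsub>A\<^esub> (k m - k n) \<in> powers A (p ^ n)" .
  qed
  have "p \<noteq> 0" using p by auto
  then obtain y where "y \<in> carrier B" "\<And>n. y \<otimes>\<^bsub>B\<^esub> inv\<^bsub>B\<^esub> (b [^]\<^bsub>B\<^esub> k n) \<in> powers B (p ^ n)"
    using B.pure_injective_adic_limit[OF pi _ b diff] by blast
  then have "(x, y) \<in> adic_rel p A a B b" using k x unfolding adic_rel_def by blast
  then show ?thesis by blast
qed

lemma adic_rel_kernel:
  assumes "comm_group A" "comm_group B" and tf: "torsion_free A" and p: "prime p"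
    and a: "a \<in> carrier A" "a \<notin> powers A p" and b: "b \<in> carrier B"
    and sep: "(\<Inter>n. powers B (p ^ n)) = {\<one>\<^bsub>B\<^esub>}" and y: "(\<one>\<^bsub>A\<^esub>, y) \<in> adic_rel p A a B b"
  shows "y = \<one>\<^bsub>B\<^esub>"
proof -
  interpret A: comm_group A by fact
  interpret B: comm_group B by fact
  have yc: "y \<in> carrier B" using y by (auto simp: adic_rel_def)
  have "y \<in> powers B (p ^ n)" for n
  proof -
    obtain k :: int where k: "\<one>\<^bsub>A\<^esub> \<otimes>\<^bsub>A\<^esub> inv\<^bsub>A\<^esub> (a [^]\<^bsub>A\<^esub> k) \<in> powers A (p ^ n)" "y \<otimes>\<^bsub>B\<^esub> inv\<^bsub>B\<^esub> (b [^]\<^bsub>B\<^esub> k) \<in> powers B (p ^ n)"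
      using y unfolding adic_rel_def by blast
    then have "a [^]\<^bsub>A\<^esub> (- k) \<in> powers A (p ^ n)" using a(1) by (simp add: A.int_pow_neg)
    then have "p ^ n dvd - k" by (rule A.torsion_free_pow_in_powers[OF tf p a])
    then have "p ^ n dvd k" by simp
    then have "b [^]\<^bsub>B\<^esub> k \<in> powers B (p ^ n)" using powersI[OF b] B.powers_mono by blast
    from subgroup.m_closed[OF B.subgroup_powers k(2) this] show ?thesis using yc b by (simp add: B.m_assoc)
  qed
  then show ?thesis using sep by blast
qed

lemma adic_kind_iso:
  assumes A: "comm_group A" "has_kind A (Adic p)" and B: "comm_group B" "has_kind B (Adic p)"
  shows "A \<cong> B"
proof -
  interpret A: comm_group A by fact
  interpret B: comm_group B by fact
  obtain a where p: "prime p" and tfA: "torsion_free A" and piA: "pure_injective A"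
    and sA: "(\<Inter>n. powers A (p ^ n)) = {\<one>\<^bsub>A\<^esub>}"
    and a: "a \<in> carrier A" "a \<notin> powers A p" "\<And>n. carrier A \<subseteq> cyclic A a <#>\<^bsub>A\<^esub> powers A (p ^ n)"
    using A(2) unfolding has_kind.simps by blast
  obtain b where tfB: "torsion_free B" and piB: "pure_injective B"
    and sB: "(\<Inter>n. powers B (p ^ n)) = {\<one>\<^bsub>B\<^esub>}"
    and b: "b \<in> carrier B" "b \<notin> powers B p" "\<And>n. carrier B \<subseteq> cyclic B b <#>\<^bsub>B\<^esub> powers B (p ^ n)"
    using B(2) unfolding has_kind.simps by blast
  show ?thesis
  proof (rule is_iso_of_relation[OF A.is_group B.is_group, of "adic_rel p A a B b"])
    show "adic_rel p A a B b \<subseteq> carrier A \<times> carrier B" by (auto simp: adic_rel_def)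
    show "\<exists>y. (x, y) \<in> adic_rel p A a B b" if "x \<in> carrier A" for x
      using adic_rel_total[OF A(1) B(1) piB tfA p a(1,2) b(1) a(3) that] .
    show "\<exists>x. (x, y) \<in> adic_rel p A a B b" if "y \<in> carrier B" for y
      using adic_rel_total[OF B(1) A(1) piA tfB p b(1,2) a(1) b(3) that] adic_rel_sym by metis
    show "y = \<one>\<^bsub>B\<^esub>" if "(\<one>\<^bsub>A\<^esub>, y) \<in> adic_rel p A a B b" for y
      using adic_rel_kernel[OF A(1) B(1) tfA p a(1,2) b(1) sB that] .
    show "x = \<one>\<^bsub>A\<^esub>" if "(x, \<one>\<^bsub>B\<^esub>) \<in> adic_rel p A a B b" for x
      using adic_rel_kernel[OF B(1) A(1) tfB p b(1,2) a(1) sA] that adic_rel_sym by metis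
    fix x y x' y' assume xy: "(x, y) \<in> adic_rel p A a B b" "(x', y') \<in> adic_rel p A a B b"
    then have c: "x \<in> carrier A" "y \<in> carrier B" "x' \<in> carrier A" "y' \<in> carrier B"
      by (auto simp: adic_rel_def)
    have "\<exists>j::int. (x \<otimes>\<^bsub>A\<^esub> inv\<^bsub>A\<^esub> x') \<otimes>\<^bsub>A\<^esub> inv\<^bsub>A\<^esub> (a [^]\<^bsub>A\<^esub> j) \<in> powers A (p ^ n) \<and>
        (y \<otimes>\<^bsub>B\<^esub> inv\<^bsub>B\<^esub> y') \<otimes>\<^bsub>B\<^esub> inv\<^bsub>B\<^esub> (b [^]\<^bsub>B\<^esub> j) \<in> powers B (p ^ n)" for n
    proof -
      obtain k :: int where k: "x \<otimes>\<^bsub>A\<^esub> inv\<^bsub>A\<^esub> (a [^]\<^bsub>A\<^esub> k) \<in> powers A (p ^ n)" "y \<otimes>\<^bsub>B\<^esub> inv\<^bsub>B\<^esub> (b [^]\<^bsub>B\<^esub> k) \<in> powers B (p ^ n)"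
        using xy(1) unfolding adic_rel_def by blast
      obtain l :: int where l: "x' \<otimes>\<^bsub>A\<^esub> inv\<^bsub>A\<^esub> (a [^]\<^bsub>A\<^esub> l) \<in> powers A (p ^ n)" "y' \<otimes>\<^bsub>B\<^esub> inv\<^bsub>B\<^esub> (b [^]\<^bsub>B\<^esub> l) \<in> powers B (p ^ n)"
        using xy(2) unfolding adic_rel_def by blast
      have "(x \<otimes>\<^bsub>A\<^esub> inv\<^bsub>A\<^esub> x') \<otimes>\<^bsub>A\<^esub> inv\<^bsub>A\<^esub> (a [^]\<^bsub>A\<^esub> (k - l)) \<in> powers A (p ^ n)"
        using subgroup.m_closed[OF A.subgroup_powers k(1) subgroup.m_inv_closed[OF A.subgroup_powers l(1)]]
          a(1) c by (simp add: A.int_pow_diff A.div_mult_div)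
      moreover have "(y \<otimes>\<^bsub>B\<^esub> inv\<^bsub>B\<^esub> y') \<otimes>\<^bsub>B\<^esub> inv\<^bsub>B\<^esub> (b [^]\<^bsub>B\<^esub> (k - l)) \<in> powers B (p ^ n)"
        using subgroup.m_closed[OF B.subgroup_powers k(2) subgroup.m_inv_closed[OF B.subgroup_powers l(2)]]
          b(1) c by (simp add: B.int_pow_diff B.div_mult_div)
      ultimately show ?thesis by blast
    qed
    then show "(x \<otimes>\<^bsub>A\<^esub> inv\<^bsub>A\<^esub> x', y \<otimes>\<^bsub>B\<^esub> inv\<^bsub>B\<^esub> y') \<in> adic_rel p A a B b"
      using c unfolding adic_rel_def by auto
  qed
qed

theorem same_kind_iso:
  assumes "comm_group A" "has_kind A t" "comm_group B" "has_kind B t"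
  shows "A \<cong> B"
  using assms cyclic_kind_iso pruefer_kind_iso rational_kind_iso adic_kind_iso by (cases t) blast+

section \<open>Independent and spanning families\<close>

lemma strict_well_order_exists:
  obtains r :: "'a rel" where "wf r" "trans r" "total r"
proof -
  obtain r :: "'a rel" where r: "well_order_on UNIV r" using well_order_on by blast
  then have "wf (r - Id)" "trans (r - Id)" "total (r - Id)"
    by (auto simp: order_on_defs intro: trans_diff_Id)
  then show thesis by (rule that)
qed

lemma finite_total_trans_max:
  assumes "finite K" "K \<noteq> {}" "trans r" "total r"
  shows "\<exists>m\<in>K. \<forall>k\<in>K. k = m \<or> (k, m) \<in> r"
  using assms(1,2)
proof (induction rule: finite_ne_induct)
  case (insert x F)
  then obtain m where m: "m \<in> F" "\<forall>k\<in>F. k = m \<or> (k, m) \<in> r" by blast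
  have "x = m \<or> (x, m) \<in> r \<or> (m, x) \<in> r" using assms(4) by (auto simp: total_on_def)
  then show ?case
  proof (elim disjE)
    assume "(m, x) \<in> r"
    then have "\<forall>k\<in>insert x F. k = x \<or> (k, x) \<in> r" using m assms(3) by (auto dest: transD)
    then show ?thesis by blast
  qed (use m in auto)
qed simp

text \<open>
  Index both families by well-orders. The index assigned to \<open>i\<close> is the least \<open>j\<close> such that
  \<open>e i\<close> lies in the span of the earlier \<open>e\<close>'s and of the \<open>b\<close>'s up to \<open>j\<close>; by exchange,
  \<open>b j\<close> is then in the span of \<open>e i\<close>, the earlier \<open>e\<close>'s and the earlier \<open>b\<close>'s, so that no later
  index can be assigned the same \<open>j\<close>.
\<close>

lemma independent_family_injects:
  fixes cl :: "'a set \<Rightarrow> 'a set" and e :: "'i \<Rightarrow> 'a" and b :: "'j \<Rightarrow> 'a"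
  assumes mono: "\<And>S T. S \<subseteq> T \<Longrightarrow> cl S \<subseteq> cl T"
    and finitary: "\<And>x S. x \<in> cl S \<Longrightarrow> \<exists>F\<subseteq>S. finite F \<and> x \<in> cl F"
    and exch: "\<And>x y S. x \<in> cl (insert y S) \<Longrightarrow> x \<notin> cl S \<Longrightarrow> y \<in> cl (insert x S)"
    and absorb: "\<And>y S. y \<in> cl S \<Longrightarrow> cl (insert y S) \<subseteq> cl S"
    and indep: "\<And>i. i \<in> I \<Longrightarrow> e i \<notin> cl (e ` (I - {i}))"
    and span: "\<And>i. i \<in> I \<Longrightarrow> e i \<in> cl (b ` J)"
  shows "\<exists>f. inj_on f I \<and> f ` I \<subseteq> J"
proof -
  obtain rI :: "'i rel" where rI: "wf rI" "trans rI" "total rI" by (rule strict_well_order_exists)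
  obtain rJ :: "'j rel" where rJ: "wf rJ" "trans rJ" "total rJ" by (rule strict_well_order_exists)
  define Il where "Il i = {i' \<in> I. (i', i) \<in> rI}" for i
  define Jl where "Jl j = {j' \<in> J. (j', j) \<in> rJ}" for j
  define Q where "Q i j \<longleftrightarrow> e i \<in> cl (e ` Il i \<union> b ` insert j (Jl j))" for i j
  have Q_ex: "\<exists>j\<in>K. Q i j" if i: "i \<in> I" and K: "K \<subseteq> J" "e i \<in> cl (e ` Il i \<union> b ` K)" for i K
  proof -
    obtain F where F: "F \<subseteq> e ` Il i \<union> b ` K" "finite F" "e i \<in> cl F" using finitary[OF K(2)] by blast
    have "finite (F \<inter> b ` K)" using F by simp
    then obtain K' where K': "K' \<subseteq> K" "finite K'" "F \<inter> b ` K = b ` K'"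
      by (metis finite_subset_image inf_le2)
    have FK: "F \<subseteq> e ` Il i \<union> b ` K'" using F K' by blast
    \<comment> \<open>Without any of the \<open>b\<close>'s, \<open>e i\<close> would lie in the
      span of earlier \<open>e\<close>'s, contrary to independence. So \<open>K'\<close> has a
      largest element, which is the required index.\<close>
    have "K' \<noteq> {}"
    proof
      assume "K' = {}"
      moreover have "e ` Il i \<subseteq> e ` (I - {i})" using wf_irrefl[OF rI(1)] by (auto simp: Il_def)
      ultimately have "F \<subseteq> e ` (I - {i})" using FK by auto
      then show False using mono F(3) indep[OF i] by blast
    qed
    then obtain j where j: "j \<in> K'" "\<forall>k\<in>K'. k = j \<or> (k, j) \<in> rJ"
      using finite_total_trans_max[OF K'(2) _ rJ(2,3)] by blast
    then have "K' \<subseteq> insert j (Jl j)" using K' K by (auto simp: Jl_def)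
    then have "F \<subseteq> e ` Il i \<union> b ` insert j (Jl j)" using FK by blast
    then have "Q i j" unfolding Q_def using mono F(3) by blast
    then show ?thesis using j K' by blast
  qed
  have "\<exists>j\<in>J. Q i j \<and> e i \<notin> cl (e ` Il i \<union> b ` Jl j)" if i: "i \<in> I" for i
  proof -
    have "e i \<in> cl (e ` Il i \<union> b ` J)" using span[OF i] mono[of "b ` J" "e ` Il i \<union> b ` J"] by blast
    then obtain j0 where "j0 \<in> {j \<in> J. Q i j}" using Q_ex[OF i] by blast
    then obtain j where j: "j \<in> {j \<in> J. Q i j}" "\<And>k. (k, j) \<in> rJ \<Longrightarrow> k \<notin> {j \<in> J. Q i j}"
      by (rule wfE_min[OF rJ(1)]) blast
    have "e i \<notin> cl (e ` Il i \<union> b ` Jl j)"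
    proof
      assume "e i \<in> cl (e ` Il i \<union> b ` Jl j)"
      then obtain k where "k \<in> Jl j" "Q i k" using Q_ex[OF i, of "Jl j"] by (auto simp: Jl_def)
      then show False using j(2)[of k] by (auto simp: Jl_def)
    qed
    then show ?thesis using j by blast
  qed
  then obtain f where f: "\<And>i. i \<in> I \<Longrightarrow> f i \<in> J \<and> Q i (f i) \<and> e i \<notin> cl (e ` Il i \<union> b ` Jl (f i))"
    by metis
  have no: False if i: "i \<in> I" "i' \<in> I" "(i, i') \<in> rI" and eq: "f i = f i'" for i i'
  proof -
    let ?j = "f i"
    have "e i \<in> cl (insert (b ?j) (e ` Il i \<union> b ` Jl ?j))" using f[OF i(1)] by (simp add: Q_def)
    then have "b ?j \<in> cl (insert (e i) (e ` Il i \<union> b ` Jl ?j))" using exch f[OF i(1)] by blast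
    moreover have "insert (e i) (e ` Il i \<union> b ` Jl ?j) \<subseteq> e ` Il i' \<union> b ` Jl ?j"
      using i rI(2) by (auto simp: Il_def dest: transD)
    ultimately have "b ?j \<in> cl (e ` Il i' \<union> b ` Jl ?j)" using mono by blast
    moreover have "e i' \<in> cl (insert (b ?j) (e ` Il i' \<union> b ` Jl ?j))" using f[OF i(2)] eq by (simp add: Q_def)
    ultimately have "e i' \<in> cl (e ` Il i' \<union> b ` Jl ?j)" using absorb by blast
    then show False using f[OF i(2)] eq by simp
  qed
  have "inj_on f I"
  proof (rule inj_onI, rule ccontr)
    fix i i' assume h: "i \<in> I" "i' \<in> I" "f i = f i'" "i \<noteq> i'"
    then have "(i, i') \<in> rI \<or> (i', i) \<in> rI" using rI(3) by (auto simp: total_on_def)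
    then show False using no h by metis
  qed
  then show ?thesis using f by blast
qed

text \<open>The preimage in \<open>P\<close> of a linear span in \<open>P\<close> modulo
  \<open>M\<close>, written so that both characteristics are covered. For prime \<open>p\<close> the
  multiplier \<open>m\<close> is invertible modulo \<open>p\<close> and changes nothing; for
  \<open>p = 0\<close> it is any nonzero integer, and the span is the one in the rationalization.
  Intersecting with \<open>P\<close> lets \<open>S\<close> be any set.\<close>

definition relative_span :: "('a, 'm) monoid_scheme \<Rightarrow> int \<Rightarrow> 'a set \<Rightarrow> 'a set \<Rightarrow> 'a set \<Rightarrow> 'a set" where
  "relative_span G p P M S = {x \<in> P. \<exists>m. \<not> p dvd m \<and> x [^]\<^bsub>G\<^esub> m \<in> generate G (S \<inter> P \<union> M)}"

context comm_group
begin

lemma generate_insert: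
  assumes "T \<subseteq> carrier G" "y \<in> carrier G" "z \<in> generate G (insert y T)"
  obtains s and k :: int where "s \<in> generate G T" "z = s \<otimes> y [^] k"
proof -
  have T: "subgroup (generate G T) G" by (rule generate_is_subgroup[OF assms(1)])
  have "insert y T \<subseteq> generate G T <#> cyclic G y"
    using set_mult_upper1[OF T subgroup_cyclic[OF assms(2)]] set_mult_upper2[OF T subgroup_cyclic[OF assms(2)]]
      self_in_cyclic[OF assms(2)] by (auto intro: generate.incl)
  from generate_subgroup_incl[OF this mult_subgroups[OF T subgroup_cyclic[OF assms(2)]]] assms(3)
  show thesis using that by (auto elim!: set_multE simp: cyclic_def)
qed

lemma generate_finitary:
  assumes "x \<in> generate G (S \<union> M)"
  shows "\<exists>F\<subseteq>S. finite F \<and> x \<in> generate G (F \<union> M)"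
  using assms
proof (induction rule: generate.induct)
  case one
  show ?case by (rule exI[of _ "{}"]) (auto intro: generate.one)
next
  case (incl h)
  then have "{h} \<inter> S \<subseteq> S" "finite ({h} \<inter> S)" "h \<in> generate G ({h} \<inter> S \<union> M)"
    by (auto intro: generate.incl)
  then show ?case by blast
next
  case (inv h)
  then have "{h} \<inter> S \<subseteq> S" "finite ({h} \<inter> S)" "inv h \<in> generate G ({h} \<inter> S \<union> M)"
    by (auto intro: generate.inv)
  then show ?case by blast
next
  case (eng h1 h2)
  then obtain F1 F2 where F: "F1 \<subseteq> S" "finite F1" "h1 \<in> generate G (F1 \<union> M)"
    "F2 \<subseteq> S" "finite F2" "h2 \<in> generate G (F2 \<union> M)" by blast
  then have "h1 \<in> generate G ((F1 \<union> F2) \<union> M)" "h2 \<in> generate G ((F1 \<union> F2) \<union> M)"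
    using mono_generate[of "F1 \<union> M" "(F1 \<union> F2) \<union> M"] mono_generate[of "F2 \<union> M" "(F1 \<union> F2) \<union> M"] by blast+
  then have "h1 \<otimes> h2 \<in> generate G ((F1 \<union> F2) \<union> M)" by (rule generate.eng)
  then show ?case using F by (metis Un_least finite_UnI)
qed

end

text \<open>For prime \<open>p\<close> the last assumption makes the quotient of \<open>P\<close> by
  \<open>M\<close> a vector space over the field with \<open>p\<close> elements; for
  \<open>p = 0\<close> it is void, as \<open>x [^] 0 = \<one>\<close>, and dimension means
  torsion-free rank. The aim is that \<open>rspan\<close> meets the closure conditions of
  \<open>independent_family_injects\<close>.\<close>

locale elementary_section = comm_group +
  fixes p :: int and P M :: "'a set"
  assumes p: "p = 0 \<or> prime p" and P: "subgroup P G" and M: "subgroup M G" "M \<subseteq> P"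
    and pow_p: "\<And>x. x \<in> P \<Longrightarrow> x [^] p \<in> M"
begin

abbreviation "rspan S \<equiv> relative_span G p P M S"

lemma not_dvd_mult: "\<not> p dvd m \<Longrightarrow> \<not> p dvd n \<Longrightarrow> \<not> p dvd m * n"
  using p by (auto simp: prime_dvd_mult_iff)

lemma not_dvd_one: "\<not> p dvd 1"
  using p not_prime_unit by auto

lemma P_carrier: "x \<in> P \<Longrightarrow> x \<in> carrier G"
  using P subgroup.mem_carrier by metis

lemma generate_subgroup: "subgroup (generate G (S \<inter> P \<union> M)) G"
  by (rule generate_is_subgroup) (use P_carrier M in blast)

lemma spanI: "x \<in> P \<Longrightarrow> \<not> p dvd m \<Longrightarrow> x [^] m \<in> generate G (S \<inter> P \<union> M) \<Longrightarrow> x \<in> rspan S"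
  by (auto simp: relative_span_def)

lemma subgroup_span: "subgroup (rspan S) G"
proof (rule subgroupI)
  show "rspan S \<subseteq> carrier G" using P_carrier by (auto simp: relative_span_def)
  have "\<one> \<in> rspan S"
    by (rule spanI[OF subgroup.one_closed[OF P] not_dvd_one]) (simp add: generate.one)
  then show "rspan S \<noteq> {}" by blast
  show "inv x \<in> rspan S" if "x \<in> rspan S" for x
    using that P_carrier subgroup.m_inv_closed[OF P] subgroup.m_inv_closed[OF generate_subgroup]
    unfolding relative_span_def by (auto simp: int_pow_inv)
  show "x \<otimes> y \<in> rspan S" if xy: "x \<in> rspan S" "y \<in> rspan S" for x y
  proof -
    obtain m where m: "x \<in> P" "\<not> p dvd m" "x [^] m \<in> generate G (S \<inter> P \<union> M)"
      using xy unfolding relative_span_def by blast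
    obtain n where n: "y \<in> P" "\<not> p dvd n" "y [^] n \<in> generate G (S \<inter> P \<union> M)"
      using xy unfolding relative_span_def by blast
    have "x [^] (m * n) \<in> generate G (S \<inter> P \<union> M)" "y [^] (m * n) \<in> generate G (S \<inter> P \<union> M)"
      using m n P_carrier by (auto intro: subgroup_pow_dvd[OF generate_subgroup])
    then have "(x \<otimes> y) [^] (m * n) \<in> generate G (S \<inter> P \<union> M)"
      using m(1) n(1) P_carrier by (simp add: int_pow_distrib generate.eng)
    then show ?thesis
      by (rule spanI[OF subgroup.m_closed[OF P m(1) n(1)] not_dvd_mult[OF m(2) n(2)]])
  qed
qed

lemma span_mono: "S \<subseteq> T \<Longrightarrow> rspan S \<subseteq> rspan T"
  using mono_generate[of "S \<inter> P \<union> M" "T \<inter> P \<union> M"] by (auto simp: relative_span_def)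

lemma span_finitary:
  assumes "x \<in> rspan S"
  shows "\<exists>F\<subseteq>S. finite F \<and> x \<in> rspan F"
proof -
  obtain m where m: "x \<in> P" "\<not> p dvd m" "x [^] m \<in> generate G (S \<inter> P \<union> M)"
    using assms unfolding relative_span_def by blast
  obtain F where F: "F \<subseteq> S \<inter> P" "finite F" "x [^] m \<in> generate G (F \<union> M)"
    using generate_finitary[OF m(3)] by blast
  then have "F \<inter> P = F" by blast
  then have "x \<in> rspan F" using spanI[OF m(1,2)] F(3) by metis
  then show ?thesis using F by blast
qed

lemma span_insertE:
  assumes "x \<in> rspan (insert y S)" "x \<notin> rspan S"
  obtains s and m k :: int where "x \<in> P" "y \<in> P" "\<not> p dvd m" "s \<in> generate G (S \<inter> P \<union> M)" "x [^] m = s \<otimes> y [^] k"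
proof -
  obtain m where m: "x \<in> P" "\<not> p dvd m" "x [^] m \<in> generate G (insert y S \<inter> P \<union> M)"
    using assms unfolding relative_span_def by blast
  have y: "y \<in> P" using m assms(2) spanI[OF m(1,2)] by (cases "y \<in> P") auto
  then have "x [^] m \<in> generate G (insert y (S \<inter> P \<union> M))" using m(3) by simp
  then obtain s and k :: int where "s \<in> generate G (S \<inter> P \<union> M)" "x [^] m = s \<otimes> y [^] k"
    by (rule generate_insert[rotated 2]) (use P_carrier y M in blast)+
  then show thesis using that m y by blast
qed

text \<open>The coefficient \<open>k\<close> of \<open>y\<close> is not divisible by
  \<open>p\<close>, for otherwise \<open>y [^] k\<close> would lie in \<open>M\<close> and
  \<open>x\<close> in the span of \<open>S\<close> alone. Hence \<open>k\<close> is an admissible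
  multiplier for \<open>y\<close>.\<close>

lemma span_exchange:
  assumes "x \<in> rspan (insert y S)" "x \<notin> rspan S"
  shows "y \<in> rspan (insert x S)"
proof -
  obtain s and m k :: int where m: "x \<in> P" "y \<in> P" "\<not> p dvd m" "s \<in> generate G (S \<inter> P \<union> M)" "x [^] m = s \<otimes> y [^] k"
    using span_insertE[OF assms] by metis
  let ?N = "generate G (S \<inter> P \<union> M)" and ?N' = "generate G (insert x S \<inter> P \<union> M)"
  have "\<not> p dvd k"
  proof
    assume "p dvd k"
    then have "y [^] k \<in> M" using subgroup_pow_dvd[OF M(1) P_carrier[OF m(2)] pow_p[OF m(2)]] by blast
    then have "y [^] k \<in> ?N" by (auto intro: generate.incl)
    then have "x [^] m \<in> ?N" using m generate.eng by metis
    then show False using assms(2) spanI[OF m(1,3)] by blast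
  qed
  moreover have "y [^] k \<in> ?N'"
  proof -
    have s: "s \<in> ?N'" using m(4) mono_generate[of "S \<inter> P \<union> M" "insert x S \<inter> P \<union> M"] by blast
    have "x \<in> ?N'" using m(1) by (auto intro: generate.incl)
    then have "x [^] m \<in> ?N'" using subgroup_int_pow_closed[OF generate_subgroup] by blast
    moreover have "y [^] k = inv s \<otimes> x [^] m"
      using m(5) P_carrier[OF m(2)] subgroup.mem_carrier[OF generate_subgroup s]
      by (simp add: m_assoc[symmetric])
    ultimately show ?thesis
      using s subgroup.m_closed[OF generate_subgroup] subgroup.m_inv_closed[OF generate_subgroup] by metis
  qed
  ultimately show ?thesis by (rule spanI[OF m(2)])
qed

lemma span_absorb:
  assumes y: "y \<in> rspan S"
  shows "rspan (insert y S) \<subseteq> rspan S"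
proof (rule subsetI, rule ccontr)
  fix x assume x: "x \<in> rspan (insert y S)" "x \<notin> rspan S"
  let ?N = "generate G (S \<inter> P \<union> M)"
  obtain s and m k :: int where m: "x \<in> P" "y \<in> P" "\<not> p dvd m" "s \<in> ?N" "x [^] m = s \<otimes> y [^] k"
    using span_insertE[OF x] by metis
  obtain l where l: "\<not> p dvd l" "y [^] l \<in> ?N" using y unfolding relative_span_def by blast
  have sc: "s \<in> carrier G" using subgroup.mem_carrier[OF generate_subgroup m(4)] .
  have "x [^] (m * l) = (s \<otimes> y [^] k) [^] l" using P_carrier[OF m(1)] by (simp add: int_pow_pow[symmetric] m(5))
  also have "\<dots> = s [^] l \<otimes> (y [^] l) [^] k"
    using sc P_carrier[OF m(2)] by (simp add: int_pow_distrib int_pow_pow mult.commute)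
  also have "\<dots> \<in> ?N"
    using m(4) l(2) subgroup_int_pow_closed[OF generate_subgroup] by (intro generate.eng) auto
  finally show False using x(2) spanI[OF m(1) not_dvd_mult[OF m(3) l(1)]] by blast
qed

end

section \<open>Invariants\<close>

text \<open>The first Ulm subgroup. On a group of one of the four kinds it is trivial or everything,
  so on their direct sums it picks out the divisible summands.\<close>

definition ulm :: "('a, 'm) monoid_scheme \<Rightarrow> 'a set" where
  "ulm G = (\<Inter>n\<in>{n. n \<noteq> 0}. powers G n)"

definition socle :: "('a, 'm) monoid_scheme \<Rightarrow> int \<Rightarrow> 'a set" where
  "socle G p = {x \<in> carrier G. x [^]\<^bsub>G\<^esub> p = \<one>\<^bsub>G\<^esub>}"

definition torsion_part :: "('a, 'm) monoid_scheme \<Rightarrow> 'a set" where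
  "torsion_part G = {x \<in> carrier G. \<exists>m::int. m \<noteq> 0 \<and> x [^]\<^bsub>G\<^esub> m = \<one>\<^bsub>G\<^esub>}"

text \<open>The preimage of \<open>p (G / t G)\<close> under the quotient by the torsion subgroup \<open>t G\<close>.\<close>

definition powers_mod_torsion :: "('a, 'm) monoid_scheme \<Rightarrow> int \<Rightarrow> 'a set" where
  "powers_mod_torsion G p =
     {x \<in> carrier G. \<exists>m::int. m \<noteq> 0 \<and> (\<exists>y\<in>carrier G. x [^]\<^bsub>G\<^esub> m = y [^]\<^bsub>G\<^esub> (p * m))}"

text \<open>
  For each kind, the multiplicity of that kind in a direct sum is the dimension of the quotient of
  \<open>kind_top\<close> by \<open>kind_bot\<close> over the prime field of characteristic \<open>kind_char\<close>.
\<close>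

primrec kind_char :: "kind \<Rightarrow> int" where
  "kind_char (Cyclic p n) = p"
| "kind_char (Pruefer p) = p"
| "kind_char Rational = 0"
| "kind_char (Adic p) = p"

text \<open>Improper parameters have to be excluded: \<open>socle G 0\<close>, for example, is the
  whole group, so the invariant of \<open>Pruefer 0\<close> would see the rationals.\<close>

definition valid_kind :: "kind \<Rightarrow> bool" where
  "valid_kind t \<longleftrightarrow> t = Rational \<or> prime (kind_char t)"

lemma valid_kind_char: "valid_kind t \<Longrightarrow> kind_char t = 0 \<or> prime (kind_char t)"
  by (auto simp: valid_kind_def)

lemma has_kind_valid: "has_kind G t \<Longrightarrow> valid_kind t"
  by (cases t) (auto simp: valid_kind_def)

primrec kind_top :: "('a, 'm) monoid_scheme \<Rightarrow> kind \<Rightarrow> 'a set" where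
  "kind_top G (Cyclic p n) = powers G (p ^ n) \<inter> socle G p"
| "kind_top G (Pruefer p) = ulm G \<inter> socle G p"
| "kind_top G Rational = ulm G"
| "kind_top G (Adic p) = carrier G"

text \<open>Torsion is divided out in two clauses to silence other kinds: Pruefer summands lie in
  the Ulm subgroup and would count as rationals, and cyclic p-groups have a nontrivial quotient
  modulo \<open>p\<close> and would count as p-adic integers.\<close>

primrec kind_bot :: "('a, 'm) monoid_scheme \<Rightarrow> kind \<Rightarrow> 'a set" where
  "kind_bot G (Cyclic p n) = powers G (p ^ Suc n) \<inter> socle G p"
| "kind_bot G (Pruefer p) = {\<one>\<^bsub>G\<^esub>}"
| "kind_bot G Rational = ulm G \<inter> torsion_part G"
| "kind_bot G (Adic p) = powers_mod_torsion G p"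

lemma torsion_partI: "x \<in> carrier G \<Longrightarrow> (m::int) \<noteq> 0 \<Longrightarrow> x [^]\<^bsub>G\<^esub> m = \<one>\<^bsub>G\<^esub> \<Longrightarrow> x \<in> torsion_part G"
  unfolding torsion_part_def by blast

lemma powers_mod_torsionI:
  "x \<in> carrier G \<Longrightarrow> (m::int) \<noteq> 0 \<Longrightarrow> y \<in> carrier G \<Longrightarrow> x [^]\<^bsub>G\<^esub> m = y [^]\<^bsub>G\<^esub> (p * m) \<Longrightarrow>
     x \<in> powers_mod_torsion G p"
  unfolding powers_mod_torsion_def by blast

context comm_group
begin

lemma subgroup_ulm: "subgroup (ulm G) G"
  unfolding ulm_def by (rule subgroup_Inter) (use subgroup_powers in \<open>auto intro!: exI[of _ 1]\<close>)

lemma subgroup_socle: "subgroup (socle G p) G"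
  by (rule subgroupI) (auto simp: socle_def int_pow_inv int_pow_distrib intro!: exI[of _ \<one>])

lemma subgroup_torsion_part: "subgroup (torsion_part G) G"
proof (rule subgroupI)
  have "\<one> \<in> torsion_part G" by (rule torsion_partI[of _ _ 1]) auto
  then show "torsion_part G \<noteq> {}" by blast
  show "inv x \<in> torsion_part G" if "x \<in> torsion_part G" for x
    using that by (auto simp: torsion_part_def int_pow_inv)
  show "x \<otimes> y \<in> torsion_part G" if xy: "x \<in> torsion_part G" "y \<in> torsion_part G" for x y
  proof -
    obtain m n :: int where c: "x \<in> carrier G" "y \<in> carrier G" "m \<noteq> 0" "n \<noteq> 0" "x [^] m = \<one>" "y [^] n = \<one>"
      using xy unfolding torsion_part_def by blast
    have "x [^] (m * n) = \<one>" "y [^] (m * n) = \<one>"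
      using c subgroup_pow_dvd[OF triv_subgroup, of x m "m * n"] subgroup_pow_dvd[OF triv_subgroup, of y n "m * n"]
      by auto
    then have "(x \<otimes> y) [^] (m * n) = \<one>" using c by (simp add: int_pow_distrib)
    then show ?thesis using c by (intro torsion_partI[of _ _ "m * n"]) auto
  qed
qed (auto simp: torsion_part_def)

lemma subgroup_powers_mod_torsion: "subgroup (powers_mod_torsion G p) G"
proof (rule subgroupI)
  have "\<one> \<in> powers_mod_torsion G p" by (rule powers_mod_torsionI[of _ _ 1 \<one>]) auto
  then show "powers_mod_torsion G p \<noteq> {}" by blast
  show "inv x \<in> powers_mod_torsion G p" if x: "x \<in> powers_mod_torsion G p" for x
  proof -
    obtain m :: int and y where c: "x \<in> carrier G" "m \<noteq> 0" "y \<in> carrier G" "x [^] m = y [^] (p * m)"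
      using x unfolding powers_mod_torsion_def by blast
    then show ?thesis by (intro powers_mod_torsionI[of _ _ m "inv y"]) (auto simp: int_pow_inv)
  qed
  show "x \<otimes> y \<in> powers_mod_torsion G p"
    if xy: "x \<in> powers_mod_torsion G p" "y \<in> powers_mod_torsion G p" for x y
  proof -
    obtain m :: int and u where c: "x \<in> carrier G" "m \<noteq> 0" "u \<in> carrier G" "x [^] m = u [^] (p * m)"
      using xy(1) unfolding powers_mod_torsion_def by blast
    obtain n :: int and v where d: "y \<in> carrier G" "n \<noteq> 0" "v \<in> carrier G" "y [^] n = v [^] (p * n)"
      using xy(2) unfolding powers_mod_torsion_def by blast
    have "(x \<otimes> y) [^] (m * n) = (x [^] m) [^] n \<otimes> (y [^] n) [^] m"
      using c(1) d(1) by (simp add: int_pow_distrib int_pow_pow mult.commute)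
    also have "\<dots> = (u \<otimes> v) [^] (p * (m * n))"
      unfolding c(4) d(4) using c(3) d(3) by (simp add: int_pow_distrib int_pow_pow mult_ac)
    finally show ?thesis using c d by (intro powers_mod_torsionI[of _ _ "m * n" "u \<otimes> v"]) auto
  qed
qed (auto simp: powers_mod_torsion_def)

lemma subgroup_kind_top: "subgroup (kind_top G t) G"
  by (cases t) (auto intro: subgroup_Int subgroup_powers subgroup_socle subgroup_ulm subgroup_self)

lemma subgroup_kind_bot: "subgroup (kind_bot G t) G"
  by (cases t) (auto simp del: power_Suc intro: subgroup_Int subgroup_powers subgroup_socle subgroup_ulm
      subgroup_torsion_part triv_subgroup subgroup_powers_mod_torsion)

lemma one_in_kind_bot: "\<one> \<in> kind_bot G t"
  by (rule subgroup.one_closed[OF subgroup_kind_bot])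

lemma kind_bot_le_top: "kind_bot G t \<subseteq> kind_top G t"
  using powers_mono[of "p ^ n" "p ^ Suc n" for p n] subgroup.one_closed[OF subgroup_ulm]
    subgroup.one_closed[OF subgroup_socle] by (cases t) (auto simp: powers_mod_torsion_def)

lemma kind_top_pow_char: "x \<in> kind_top G t \<Longrightarrow> x [^] kind_char t \<in> kind_bot G t"
proof (cases t)
  case (Adic p)
  assume "x \<in> kind_top G t"
  then show ?thesis using Adic by (auto intro!: powers_mod_torsionI[of _ _ 1 x])
next
  case Rational
  then show ?thesis using one_in_kind_bot[of t] by simp
next
  case (Cyclic p n)
  assume "x \<in> kind_top G t"
  then show ?thesis using one_in_kind_bot[of t] Cyclic by (simp add: socle_def)
next
  case (Pruefer p)
  assume "x \<in> kind_top G t"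
  then show ?thesis using Pruefer by (simp add: socle_def)
qed

lemma elementary_section_kind:
  "valid_kind t \<Longrightarrow> elementary_section G (kind_char t) (kind_top G t) (kind_bot G t)"
  by (intro elementary_section.intro elementary_section_axioms.intro comm_group_axioms valid_kind_char
      subgroup_kind_top subgroup_kind_bot kind_bot_le_top kind_top_pow_char)

end

section \<open>Functoriality of the subquotients and their reflection along pure embeddings\<close>

lemma hom_powers:
  assumes "f \<in> hom G H" "group G" "group H" "x \<in> powers G n"
  shows "f x \<in> powers H n"
proof -
  obtain y where "y \<in> carrier G" "x = y [^]\<^bsub>G\<^esub> n" using assms(4) by (rule powersE)
  then show ?thesis using hom_int_pow[OF assms(1) _ assms(2,3)] powersI[OF hom_in_carrier[OF assms(1)]] by simp
qed

lemma hom_ulm: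
  assumes "f \<in> hom G H" "group G" "group H" "x \<in> ulm G"
  shows "f x \<in> ulm H"
  using hom_powers[OF assms(1-3)] assms(4) by (auto simp: ulm_def)

lemma hom_socle:
  assumes f: "f \<in> hom G H" "group G" "group H" and x: "x \<in> socle G p"
  shows "f x \<in> socle H p"
proof -
  have "x \<in> carrier G" "x [^]\<^bsub>G\<^esub> p = \<one>\<^bsub>G\<^esub>" using x by (auto simp: socle_def)
  then show ?thesis
    using hom_int_pow[OF f(1) _ f(2,3), of x p] hom_one[OF f] hom_in_carrier[OF f(1)] by (simp add: socle_def)
qed

lemma hom_torsion_part:
  assumes f: "f \<in> hom G H" "group G" "group H" and x: "x \<in> torsion_part G"
  shows "f x \<in> torsion_part H"
proof -
  obtain m :: int where "x \<in> carrier G" "m \<noteq> 0" "x [^]\<^bsub>G\<^esub> m = \<one>\<^bsub>G\<^esub>" using x unfolding torsion_part_def by blast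
  then show ?thesis
    using hom_int_pow[OF f(1) _ f(2,3), of x m] hom_one[OF f] hom_in_carrier[OF f(1)]
    by (intro torsion_partI[of _ _ m]) auto
qed

lemma hom_powers_mod_torsion:
  assumes f: "f \<in> hom G H" "group G" "group H" and x: "x \<in> powers_mod_torsion G p"
  shows "f x \<in> powers_mod_torsion H p"
proof -
  obtain m :: int and y where c: "x \<in> carrier G" "m \<noteq> 0" "y \<in> carrier G" "x [^]\<^bsub>G\<^esub> m = y [^]\<^bsub>G\<^esub> (p * m)"
    using x unfolding powers_mod_torsion_def by blast
  then show ?thesis
    using hom_int_pow[OF f(1) _ f(2,3), of x m] hom_int_pow[OF f(1) _ f(2,3), of y "p * m"] hom_in_carrier[OF f(1)]
    by (intro powers_mod_torsionI[of _ _ m "f y"]) auto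
qed

lemma hom_kind_top:
  assumes "f \<in> hom G H" "group G" "group H" "x \<in> kind_top G t"
  shows "f x \<in> kind_top H t"
  using assms(4) hom_powers[OF assms(1-3)] hom_ulm[OF assms(1-3)] hom_socle[OF assms(1-3)] hom_in_carrier[OF assms(1)]
  by (cases t) auto

lemma hom_kind_bot:
  assumes "f \<in> hom G H" "group G" "group H" "x \<in> kind_bot G t"
  shows "f x \<in> kind_bot H t"
  using assms(4) hom_powers[OF assms(1-3)] hom_ulm[OF assms(1-3)] hom_socle[OF assms(1-3)]
    hom_torsion_part[OF assms(1-3)] hom_powers_mod_torsion[OF assms(1-3)] hom_one[OF assms(1-3)]
  by (cases t) auto

lemma pure_embedding_powers:
  assumes G: "comm_group G" and H: "comm_group H" and f: "pure_embedding G H f"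
    and x: "x \<in> carrier G" "f x \<in> powers H n"
  shows "x \<in> powers G n"
proof -
  interpret G: comm_group G by fact
  interpret H: comm_group H by fact
  have hom: "f \<in> hom G H" and inj: "inj_on f (carrier G)" and pure: "pure_subgroup (f ` carrier G) H"
    using f by (auto simp: pure_embedding_def)
  \<comment> \<open>Purity speaks of natural exponents only; \<open>n\<close> and its absolute value
    divide each other and hence give the same powers.\<close>
  define m where "m = nat \<bar>n\<bar>"
  have m: "int m dvd n" "n dvd int m" by (auto simp: m_def)
  have "f x \<in> powers H (int m)" using x(2) H.powers_mono[OF m(1)] by blast
  then have "\<exists>y\<in>carrier H. y [^]\<^bsub>H\<^esub> m = f x" by (metis powersE int_pow_int)
  then have "\<exists>y\<in>f ` carrier G. y [^]\<^bsub>H\<^esub> m = f x"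
    using pure imageI[OF x(1), of f] by (simp only: pure_subgroup_def)
  then obtain z where z: "z \<in> carrier G" "f z [^]\<^bsub>H\<^esub> m = f x" by blast
  then have "f (z [^]\<^bsub>G\<^esub> m) = f x" using hom_nat_pow[OF hom z(1) G.is_group H.is_group] by simp
  then have "z [^]\<^bsub>G\<^esub> m = x" using inj z(1) x(1) by (auto dest: inj_onD)
  then have "x \<in> powers G (int m)" using powersI[OF z(1), of "int m"] by (simp add: int_pow_int)
  then show ?thesis using G.powers_mono[OF m(2)] by blast
qed

text \<open>Injectivity reflects being killed by an exponent, purity reflects being divisible by
  one, and every \<open>kind_bot\<close> is built from these two. Together with
  \<open>hom_kind_top\<close> and \<open>hom_kind_bot\<close> this says that a pure embedding is
  injective on each subquotient.\<close>

lemma pure_embedding_kind_bot: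
  assumes G: "comm_group G" and H: "comm_group H" and f: "pure_embedding G H f"
    and x: "x \<in> carrier G" "f x \<in> kind_bot H t"
  shows "x \<in> kind_bot G t"
proof -
  interpret G: comm_group G by fact
  interpret H: comm_group H by fact
  have hom: "f \<in> hom G H" and inj: "inj_on f (carrier G)" using f by (auto simp: pure_embedding_def)
  have pow: "f (z [^]\<^bsub>G\<^esub> k) = f z [^]\<^bsub>H\<^esub> k" if "z \<in> carrier G" for z and k :: int
    using hom_int_pow[OF hom that G.is_group H.is_group] .
  have one: "z = \<one>\<^bsub>G\<^esub>" if "z \<in> carrier G" "f z = \<one>\<^bsub>H\<^esub>" for z
    using that inj hom_one[OF hom G.is_group H.is_group] by (metis G.one_closed inj_onD)
  note powers = pure_embedding_powers[OF G H f]
  have ulm: "x \<in> ulm G" if "f x \<in> ulm H" using powers x(1) that by (auto simp: ulm_def)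
  have pow1: "x [^]\<^bsub>G\<^esub> k = \<one>\<^bsub>G\<^esub>" if "f x [^]\<^bsub>H\<^esub> k = \<one>\<^bsub>H\<^esub>" for k :: int
    using that one[of "x [^]\<^bsub>G\<^esub> k"] pow[OF x(1)] x(1) by simp
  have tors: "x \<in> torsion_part G" if fx: "f x \<in> torsion_part H"
  proof -
    obtain m :: int where m: "m \<noteq> 0" "f x [^]\<^bsub>H\<^esub> m = \<one>\<^bsub>H\<^esub>" using fx unfolding torsion_part_def by blast
    show ?thesis by (rule torsion_partI[OF x(1) m(1) pow1[OF m(2)]])
  qed
  have mod: "x \<in> powers_mod_torsion G p" if fx: "f x \<in> powers_mod_torsion H p" for p
  proof -
    obtain m :: int and y where y: "m \<noteq> 0" "y \<in> carrier H" "f x [^]\<^bsub>H\<^esub> m = y [^]\<^bsub>H\<^esub> (p * m)"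
      using fx unfolding powers_mod_torsion_def by blast
    \<comment> \<open>Because the factor \<open>m\<close> stands on both sides of the defining
      equation, membership amounts to divisibility of the single element \<open>x [^] m\<close> by
      \<open>p * m\<close>, to which purity applies.\<close>
    then have "f (x [^]\<^bsub>G\<^esub> m) \<in> powers H (p * m)" using pow[OF x(1)] powersI by metis
    then have "x [^]\<^bsub>G\<^esub> m \<in> powers G (p * m)" using powers x(1) by simp
    then obtain z where z: "z \<in> carrier G" "x [^]\<^bsub>G\<^esub> m = z [^]\<^bsub>G\<^esub> (p * m)" by (rule powersE)
    show ?thesis by (rule powers_mod_torsionI[OF x(1) y(1) z])
  qed
  show ?thesis
    using x powers ulm tors mod one pow1 by (cases t) (auto simp: socle_def)
qed

section \<open>Values of the invariants on groups of each kind\<close>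

context comm_group
begin

lemma ulm_divisible:
  assumes "\<And>n. n \<noteq> 0 \<Longrightarrow> powers G n = carrier G"
  shows "ulm G = carrier G"
  using subgroup.subset[OF subgroup_ulm] assms by (auto simp: ulm_def)

lemma torsion_free_socle:
  assumes "torsion_free G" "p \<noteq> 0"
  shows "socle G p = {\<one>}"
  using assms by (auto simp: torsion_free_def socle_def)

lemma divisible_powers_mod_torsion:
  assumes "powers G p = carrier G"
  shows "powers_mod_torsion G p = carrier G"
proof -
  have "x \<in> powers_mod_torsion G p" if x: "x \<in> carrier G" for x
  proof -
    obtain y where "y \<in> carrier G" "x = y [^] p" using x assms by (metis powersE)
    then show ?thesis by (intro powers_mod_torsionI[of _ _ 1 y]) auto
  qed
  then show ?thesis by (auto simp: powers_mod_torsion_def)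
qed

lemma torsion_powers_mod_torsion:
  assumes "x \<in> torsion_part G"
  shows "x \<in> powers_mod_torsion G p"
proof -
  obtain m :: int where "x \<in> carrier G" "m \<noteq> 0" "x [^] m = \<one>" using assms unfolding torsion_part_def by blast
  then show ?thesis by (intro powers_mod_torsionI[of _ _ m \<one>]) auto
qed

lemma primary_socle_trivial:
  fixes p q :: int
  assumes "prime p" "prime q" "p \<noteq> q" "x \<in> carrier G" "x [^] (p ^ n) = \<one>" "x [^] q = \<one>"
  shows "x = \<one>"
proof -
  have "coprime (p ^ n) q" using assms by (simp add: primes_coprime)
  then show ?thesis using subgroup_pow_coprime[OF triv_subgroup assms(4)] assms by blast
qed

lemma pruefer_divisible:
  fixes p q :: int
  assumes p: "prime p" and a: "\<And>n. a n \<in> carrier G" "\<And>n. a (Suc n) [^] p = a n"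
    and tors: "\<And>n. a n [^] (p ^ Suc n) = \<one>" and eq: "carrier G = (\<Union>n. cyclic G (a n))" and q: "q \<noteq> 0"
  shows "powers G q = carrier G"
  using q
proof (rule powers_eq_carrier_if_prime[rotated])
  fix q :: int assume q: "prime q"
  have "x \<in> powers G q" if x: "x \<in> carrier G" for x
  proof -
    obtain n and k :: int where k: "x = a n [^] k" using x unfolding eq by (auto simp: cyclic_def)
    show ?thesis
    proof (cases "q = p")
      case True
      have "(a (Suc n) [^] k) [^] q = x"
        using True k a by (metis int_pow_pow mult.commute)
      then show ?thesis using powersI[of "a (Suc n) [^] k" G q] a(1) by simp
    next
      case False
      then have "coprime q (p ^ Suc n)" using p q by (simp add: primes_coprime)
      moreover have "x [^] (p ^ Suc n) = \<one>"
        using k a(1) tors by (metis int_pow_one int_pow_pow mult.commute)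
      ultimately obtain u :: int where "(x [^] u) [^] q = x"
        using coprime_root_in_cyclic x by metis
      then show ?thesis using powersI[of "x [^] u" G q] x by simp
    qed
  qed
  then show "powers G q = carrier G" using subgroup.subset[OF subgroup_powers] by blast
qed

end

text \<open>
  The invariant of \<open>t\<close> has dimension one on \<open>G\<close> and is spanned by the class of \<open>e\<close>.
\<close>

definition kind_generator :: "('a, 'm) monoid_scheme \<Rightarrow> kind \<Rightarrow> 'a \<Rightarrow> bool" where
  "kind_generator G t e \<longleftrightarrow> e \<in> kind_top G t \<and>
     (\<forall>k. e [^]\<^bsub>G\<^esub> k \<in> kind_bot G t \<longrightarrow> kind_char t dvd k) \<and>
     (\<forall>x\<in>kind_top G t. \<exists>m. \<not> kind_char t dvd m \<and> x [^]\<^bsub>G\<^esub> m \<in> cyclic G e <#>\<^bsub>G\<^esub> kind_bot G t)"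

definition kind_concentrated :: "('a, 'm) monoid_scheme \<Rightarrow> kind \<Rightarrow> bool" where
  "kind_concentrated G t \<longleftrightarrow>
     (\<forall>s. s \<noteq> t \<longrightarrow> valid_kind s \<longrightarrow> kind_top G s \<subseteq> kind_bot G s)"

context comm_group
begin

lemma kind_generatorI:
  assumes "valid_kind t" "e \<in> kind_top G t"
    and "\<And>k. e [^] k \<in> kind_bot G t \<Longrightarrow> kind_char t dvd k"
    and "\<And>x. x \<in> kind_top G t \<Longrightarrow> x \<in> cyclic G e <#> kind_bot G t"
  shows "kind_generator G t e"
  unfolding kind_generator_def
proof (intro conjI ballI allI impI)
  fix x assume x: "x \<in> kind_top G t"
  have "x [^] (1::int) = x" using subgroup.mem_carrier[OF subgroup_kind_top x] by simp
  moreover have "\<not> kind_char t dvd 1" using valid_kind_char[OF assms(1)] not_prime_unit by auto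
  ultimately show "\<exists>m. \<not> kind_char t dvd m \<and> x [^] m \<in> cyclic G e <#> kind_bot G t"
    using assms(4)[OF x] by metis
qed (use assms in auto)

lemma cyclic_le_cyclic_bot:
  "e \<in> kind_top G t \<Longrightarrow> cyclic G e \<subseteq> cyclic G e <#> kind_bot G t"
  by (rule set_mult_upper1[OF subgroup_cyclic[OF subgroup.mem_carrier[OF subgroup_kind_top]] subgroup_kind_bot])

text \<open>The socle of a cyclic group of order \<open>p ^ Suc n\<close> is generated by
  \<open>a [^] (p ^ n)\<close> and lies in \<open>powers G (p ^ n)\<close>, while
  \<open>powers G (p ^ Suc n)\<close> is trivial. So the p-heights in the socle jump at
  \<open>n\<close> only: for \<open>m < n\<close> top and bottom agree, for \<open>m > n\<close> the
  top is trivial.\<close>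

lemma has_kind_cyclic_generator:
  assumes "has_kind G (Cyclic p n)"
  shows "\<exists>e. kind_generator G (Cyclic p n) e" "kind_concentrated G (Cyclic p n)"
proof -
  obtain a where p: "prime p" and a: "a \<in> carrier G" "carrier G = cyclic G a" "a [^] (p ^ n) \<noteq> \<one>" "a [^] (p ^ Suc n) = \<one>"
    using assms unfolding has_kind.simps by blast
  note iff = primepow_order_iff[OF a(1) p a(3,4)]
  have p0: "p \<noteq> 0" using p by auto
  have rep: "\<exists>j::int. x = a [^] j" if "x \<in> carrier G" for x using that a(2) by (auto simp: cyclic_def)
  have bounded: "x [^] (p ^ Suc n) = \<one>" if "x \<in> carrier G" for x
    using rep[OF that] a(1,4) by (metis int_pow_one int_pow_pow mult.commute)
  have pw: "powers G (p ^ Suc n) = {\<one>}"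
    using bounded subgroup.one_closed[OF subgroup_powers] by (auto simp: powers_def)
  have soc: "x \<in> powers G (p ^ n)" if x: "x \<in> socle G p" for x
  proof -
    obtain j :: int where j: "x = a [^] j" using rep x by (auto simp: socle_def)
    then have "a [^] (j * p) = \<one>" using x a(1) by (simp add: socle_def int_pow_pow)
    then have "p ^ n dvd j" using iff p0 by (simp add: mult.commute)
    then show ?thesis using j powersI[OF a(1)] powers_mono by blast
  qed
  let ?e = "a [^] (p ^ n)"
  have top: "?e \<in> kind_top G (Cyclic p n)"
    using a(1,4) powersI[OF a(1)] by (simp add: socle_def int_pow_pow mult.commute)
  have "kind_generator G (Cyclic p n) ?e"
  proof (rule kind_generatorI[OF _ top])
    fix k :: int assume "?e [^] k \<in> kind_bot G (Cyclic p n)"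
    then have "a [^] (p ^ n * k) = \<one>" using pw a(1) by (simp add: int_pow_pow)
    then show "kind_char (Cyclic p n) dvd k" using iff p0 by (simp add: mult.commute)
  next
    fix x assume "x \<in> kind_top G (Cyclic p n)"
    then obtain y where y: "y \<in> carrier G" "x = y [^] (p ^ n)" by (auto elim: powersE)
    obtain j :: int where "y = a [^] j" using rep y by blast
    then have "x = ?e [^] j" using y a(1) by (simp add: int_pow_pow mult.commute)
    then have "x \<in> cyclic G ?e" using cyclicI by metis
    then show "x \<in> cyclic G ?e <#> kind_bot G (Cyclic p n)" using cyclic_le_cyclic_bot[OF top] by blast
  qed (use has_kind_valid[OF assms] in simp)
  then show "\<exists>e. kind_generator G (Cyclic p n) e" by blast
  have ulm: "ulm G \<subseteq> {\<one>}" unfolding pw[symmetric] ulm_def using p0 by (intro INF_lower) simp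
  have tors: "x \<in> torsion_part G" if "x \<in> carrier G" for x
    using bounded[OF that] p0 that by (intro torsion_partI[of _ _ "p ^ Suc n"]) auto
  show "kind_concentrated G (Cyclic p n)"
    unfolding kind_concentrated_def
  proof (intro allI impI subsetI)
    fix s x assume s: "s \<noteq> Cyclic p n" "valid_kind s" and x: "x \<in> kind_top G s"
    have "x = \<one> \<or> x \<in> kind_bot G s"
    proof (cases s)
      case (Cyclic q m)
      then have xs: "x \<in> socle G q" "x \<in> powers G (q ^ m)" "x \<in> carrier G" using x by (auto simp: socle_def)
      show ?thesis
      proof (cases "q = p")
        case True
        then have "m \<noteq> n" using Cyclic s(1) by auto
        then consider "Suc m \<le> n" | "Suc n \<le> m" by linarith
        then show ?thesis
        proof cases
          case 1
          then have "x \<in> powers G (q ^ Suc m)"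
            using soc[of x] xs True powers_mono[OF le_imp_power_dvd[OF 1, of p]] by auto
          then show ?thesis using Cyclic xs by simp
        next
          case 2
          then have "x \<in> powers G (p ^ Suc n)" using xs True powers_mono[OF le_imp_power_dvd[OF 2, of p]] by blast
          then show ?thesis using pw by blast
        qed
      next
        case False
        have "prime q" using s(2) Cyclic by (simp add: valid_kind_def)
        then have "x = \<one>"
          using primary_socle_trivial[OF p _ False[symmetric] xs(3) bounded[OF xs(3)]] xs(1) by (simp add: socle_def)
        then show ?thesis by simp
      qed
    next
      case (Adic q)
      then show ?thesis using x torsion_powers_mod_torsion[OF tors] by simp
    qed (use x ulm in auto)
    then show "x \<in> kind_bot G s" using one_in_kind_bot by auto
  qed
qed

text \<open>The socle is generated by \<open>a 0\<close>. Divisibility kills the cyclic invariants,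
  and being torsion kills the rational and adic ones.\<close>

lemma has_kind_pruefer_generator:
  assumes "has_kind G (Pruefer p)"
  shows "\<exists>e. kind_generator G (Pruefer p) e" "kind_concentrated G (Pruefer p)"
proof -
  obtain a where p: "prime p" and a0: "a 0 \<noteq> \<one>" "a 0 [^] p = \<one>"
    and a: "\<And>n. a n \<in> carrier G" "\<And>n. a (Suc n) [^] p = a n" and eq: "carrier G = (\<Union>n. cyclic G (a n))"
    using assms unfolding has_kind.simps by blast
  note iff = root_sequence_pow_eq_one_iff[OF a p a0]
  have p0: "p \<noteq> 0" using p by auto
  have aN: "a n [^] (p ^ Suc n) = \<one>" for n by (rule iff[THEN iffD2]) simp
  have rep: "\<exists>n. \<exists>k::int. x = a n [^] k" if "x \<in> carrier G" for x
    using that unfolding eq by (auto simp: cyclic_def)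
  have div: "powers G q = carrier G" if "q \<noteq> 0" for q
    using pruefer_divisible[OF p a aN eq that] .
  have ulm: "ulm G = carrier G" by (rule ulm_divisible[OF div])
  have primary: "\<exists>n. x [^] (p ^ Suc n) = \<one>" if x: "x \<in> carrier G" for x
  proof -
    obtain n and k :: int where "x = a n [^] k" using rep[OF x] by blast
    then show ?thesis using a(1) aN by (metis int_pow_one int_pow_pow mult.commute)
  qed
  have top: "a 0 \<in> kind_top G (Pruefer p)" using ulm a(1) a0 by (simp add: socle_def)
  have "kind_generator G (Pruefer p) (a 0)"
  proof (rule kind_generatorI[OF has_kind_valid[OF assms] top])
    fix k :: int assume "a 0 [^] k \<in> kind_bot G (Pruefer p)"
    then show "kind_char (Pruefer p) dvd k" using iff[of 0 k] by simp
  next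
    fix x assume "x \<in> kind_top G (Pruefer p)"
    then have x: "x \<in> carrier G" "x [^] p = \<one>" by (auto simp: socle_def)
    obtain n and k :: int where k: "x = a n [^] k" using rep[OF x(1)] by blast
    then have "a n [^] (k * p) = \<one>" using x a(1) by (simp add: int_pow_pow)
    then have "p ^ Suc n dvd k * p" by (rule iff[THEN iffD1])
    then have "p ^ n dvd k" using p0 by (simp add: mult.commute)
    then obtain j where "k = p ^ n * j" by blast
    moreover have "a n [^] (p ^ n) = a 0" using root_sequence_pow[of a p 0 n] a by simp
    ultimately have "x = a 0 [^] j" using k a(1) by (metis int_pow_pow)
    then have "x \<in> cyclic G (a 0)" using cyclicI by metis
    then show "x \<in> cyclic G (a 0) <#> kind_bot G (Pruefer p)" using cyclic_le_cyclic_bot[OF top] by blast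
  qed
  then show "\<exists>e. kind_generator G (Pruefer p) e" by blast
  have tors: "x \<in> torsion_part G" if x: "x \<in> carrier G" for x
  proof -
    obtain n where "x [^] (p ^ Suc n) = \<one>" using primary[OF x] by blast
    then show ?thesis using torsion_partI[OF x, of "p ^ Suc n"] p0 by simp
  qed
  show "kind_concentrated G (Pruefer p)"
    unfolding kind_concentrated_def
  proof (intro allI impI subsetI)
    fix s x assume s: "s \<noteq> Pruefer p" "valid_kind s" and x: "x \<in> kind_top G s"
    show "x \<in> kind_bot G s"
    proof (cases s)
      case (Cyclic q m)
      then have "q ^ Suc m \<noteq> 0" using s(2) by (auto simp: valid_kind_def)
      then show ?thesis using Cyclic x div subgroup.mem_carrier[OF subgroup_kind_top x] by simp
    next
      case (Pruefer q)
      then have q: "prime q" "p \<noteq> q" using s by (auto simp: valid_kind_def)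
      have xs: "x \<in> carrier G" "x [^] q = \<one>" using x Pruefer by (auto simp: socle_def)
      obtain n where "x [^] (p ^ Suc n) = \<one>" using primary[OF xs(1)] by blast
      then have "x = \<one>" by (rule primary_socle_trivial[OF p q xs(1) _ xs(2)])
      then show ?thesis using Pruefer by simp
    next
      case Rational
      then show ?thesis using x tors ulm by simp
    next
      case (Adic q)
      then show ?thesis using x torsion_powers_mod_torsion[OF tors] by simp
    qed
  qed
qed

lemma has_kind_rational_generator:
  assumes "has_kind G Rational"
  shows "\<exists>e. kind_generator G Rational e" "kind_concentrated G Rational"
proof -
  obtain a where tf: "torsion_free G" and div: "\<And>n. n \<noteq> 0 \<Longrightarrow> powers G n = carrier G"
    and a: "a \<in> carrier G" "a \<noteq> \<one>" "\<forall>x\<in>carrier G. \<exists>(m::int) (k::int). m \<noteq> 0 \<and> x [^] m = a [^] k"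
    using assms unfolding has_kind.simps by blast
  have ulm: "ulm G = carrier G" by (rule ulm_divisible[OF div])
  have top: "a \<in> kind_top G Rational" using ulm a(1) by simp
  \<comment> \<open>\<open>kind_generatorI\<close> does not fit here: an element of a rank-one group
    need only have a nonzero multiple in \<open>cyclic G a\<close>, so the multiplier is really
    used.\<close>
  have "kind_generator G Rational a"
    unfolding kind_generator_def
  proof (intro conjI allI impI ballI)
    fix k :: int assume "a [^] k \<in> kind_bot G Rational"
    then obtain m :: int where m: "m \<noteq> 0" "(a [^] k) [^] m = \<one>" unfolding kind_bot.simps torsion_part_def by blast
    then have "a [^] k = \<one>" using tf a(1) unfolding torsion_free_def by (metis int_pow_closed)
    then have "k = 0" using tf a(1,2) unfolding torsion_free_def by metis
    then show "kind_char Rational dvd k" by simp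
  next
    fix x assume "x \<in> kind_top G Rational"
    then have "x \<in> carrier G" using ulm by simp
    then obtain m k :: int where "m \<noteq> 0" "x [^] m = a [^] k" using a(3) by blast
    moreover have "a [^] k \<in> cyclic G a <#> kind_bot G Rational"
      using cyclicI[of G a k] cyclic_le_cyclic_bot[OF top] by blast
    ultimately have "\<not> kind_char Rational dvd m \<and> x [^] m \<in> cyclic G a <#> kind_bot G Rational" by simp
    then show "\<exists>m. \<not> kind_char Rational dvd m \<and> x [^] m \<in> cyclic G a <#> kind_bot G Rational" by blast
  qed (rule top)
  then show "\<exists>e. kind_generator G Rational e" by blast
  show "kind_concentrated G Rational"
    unfolding kind_concentrated_def
  proof (intro allI impI subsetI)
    fix s x assume s: "s \<noteq> Rational" "valid_kind s" and x: "x \<in> kind_top G s"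
    have c: "kind_char s \<noteq> 0" using s by (auto simp: valid_kind_def)
    have "x = \<one> \<or> x \<in> kind_bot G s"
      using x c s(1) torsion_free_socle[OF tf c] divisible_powers_mod_torsion[OF div[OF c]] by (cases s) auto
    then show "x \<in> kind_bot G s" using one_in_kind_bot by auto
  qed
qed

text \<open>Without torsion, \<open>powers_mod_torsion G p\<close> is just
  \<open>powers G p\<close>, and density at level one says that \<open>a\<close> spans the quotient.
  The p-adic separatedness makes the Ulm subgroup trivial.\<close>

lemma has_kind_adic_generator:
  assumes "has_kind G (Adic p)"
  shows "\<exists>e. kind_generator G (Adic p) e" "kind_concentrated G (Adic p)"
proof -
  obtain a where p: "prime p" and tf: "torsion_free G" and sep: "(\<Inter>n. powers G (p ^ n)) = {\<one>}"
    and div: "\<And>m. \<not> p dvd m \<Longrightarrow> powers G m = carrier G"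
    and a: "a \<in> carrier G" "a \<notin> powers G p" "\<And>n. carrier G \<subseteq> cyclic G a <#> powers G (p ^ n)"
    using assms unfolding has_kind.simps by blast
  have p0: "p \<noteq> 0" using p by auto
  have mod: "powers_mod_torsion G p = powers G p"
  proof
    show "powers_mod_torsion G p \<subseteq> powers G p"
    proof
      fix x assume "x \<in> powers_mod_torsion G p"
      then obtain m :: int and y where c: "x \<in> carrier G" "m \<noteq> 0" "y \<in> carrier G" "x [^] m = y [^] (p * m)"
        unfolding powers_mod_torsion_def by blast
      then have "x [^] m \<in> powers G (m * p)" using powersI[of y G "m * p"] by (simp add: mult.commute)
      then show "x \<in> powers G p" using torsion_free_powers_cancel[OF tf c(2,1)] by blast
    qed
    show "powers G p \<subseteq> powers_mod_torsion G p"
    proof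
      fix x assume "x \<in> powers G p"
      then obtain y where "y \<in> carrier G" "x = y [^] p" by (rule powersE)
      then show "x \<in> powers_mod_torsion G p" by (intro powers_mod_torsionI[of _ _ 1 y]) auto
    qed
  qed
  have "kind_generator G (Adic p) a"
  proof (rule kind_generatorI[OF has_kind_valid[OF assms]])
    fix k :: int assume "a [^] k \<in> kind_bot G (Adic p)"
    then have "a [^] k \<in> powers G (p ^ 1)" using mod by simp
    from torsion_free_pow_in_powers[OF tf p a(1,2) this] show "kind_char (Adic p) dvd k" by simp
  qed (use a(1) a(3)[of 1] mod in auto)
  then show "\<exists>e. kind_generator G (Adic p) e" by blast
  have ulm: "ulm G \<subseteq> {\<one>}"
  proof -
    have "ulm G \<subseteq> powers G (p ^ n)" for n using p0 unfolding ulm_def by (intro INF_lower) simp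
    then show ?thesis using sep by blast
  qed
  show "kind_concentrated G (Adic p)"
    unfolding kind_concentrated_def
  proof (intro allI impI subsetI)
    fix s x assume s: "s \<noteq> Adic p" "valid_kind s" and x: "x \<in> kind_top G s"
    have "x = \<one> \<or> x \<in> kind_bot G s"
    proof (cases s)
      case (Cyclic q m)
      then have "q \<noteq> 0" using s by (auto simp: valid_kind_def)
      then show ?thesis using x Cyclic torsion_free_socle[OF tf] by auto
    next
      case (Adic q)
      then have "\<not> p dvd q" using s p by (auto simp: valid_kind_def dest: primes_dvd_imp_eq)
      then show ?thesis using x Adic divisible_powers_mod_torsion[OF div] by simp
    qed (use x ulm in auto)
    then show "x \<in> kind_bot G s" using one_in_kind_bot by auto
  qed
qed

lemma has_kind_generator: "has_kind G t \<Longrightarrow> \<exists>e. kind_generator G t e"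
  using has_kind_cyclic_generator(1) has_kind_pruefer_generator(1) has_kind_rational_generator(1)
    has_kind_adic_generator(1) by (cases t) simp_all

lemma has_kind_concentrated: "has_kind G t \<Longrightarrow> kind_concentrated G t"
  using has_kind_cyclic_generator(2) has_kind_pruefer_generator(2) has_kind_rational_generator(2)
    has_kind_adic_generator(2) by (cases t) simp_all

text \<open>The invariant of \<open>s\<close> is nonzero on a group of kind \<open>s\<close>, yet
  would vanish if the group also had another kind.\<close>

lemma has_kind_unique:
  assumes "has_kind G s" "has_kind G t"
  shows "s = t"
proof (rule ccontr)
  assume "s \<noteq> t"
  then have sub: "kind_top G s \<subseteq> kind_bot G s"
    using has_kind_concentrated[OF assms(2)] has_kind_valid[OF assms(1)] unfolding kind_concentrated_def by blast
  obtain e where e: "e \<in> kind_top G s" "\<And>k. e [^] k \<in> kind_bot G s \<Longrightarrow> kind_char s dvd k"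
    using has_kind_generator[OF assms(1)] unfolding kind_generator_def by blast
  have "e [^] (1::int) = e" using subgroup.mem_carrier[OF subgroup_kind_top e(1)] by simp
  then have "kind_char s dvd 1" using e(2)[of 1] sub e(1) by auto
  then show False using valid_kind_char[OF has_kind_valid[OF assms(1)]] not_prime_unit by auto
qed

end

section \<open>Direct sums\<close>

lemma comm_group_sum_group:
  assumes "\<And>i. i \<in> I \<Longrightarrow> comm_group (A i)"
  shows "comm_group (sum_group I A)"
proof -
  have g: "\<And>i. i \<in> I \<Longrightarrow> group (A i)" using assms comm_group.axioms(2) by blast
  have "x i \<otimes>\<^bsub>A i\<^esub> y i = y i \<otimes>\<^bsub>A i\<^esub> x i"
    if "x \<in> carrier (sum_group I A)" "y \<in> carrier (sum_group I A)" "i \<in> I" for x y i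
  proof -
    interpret comm_group "A i" using assms that by blast
    have "x i \<in> carrier (A i)" "y i \<in> carrier (A i)" using that by (auto simp: carrier_sum_group[OF g])
    then show ?thesis by (rule m_comm)
  qed
  then show ?thesis by (intro group.group_comm_groupI sum_group g) (auto intro!: restrict_ext)
qed

definition sum_incl :: "'i set \<Rightarrow> ('i \<Rightarrow> ('a, 'm) monoid_scheme) \<Rightarrow> 'i \<Rightarrow> 'a \<Rightarrow> ('i \<Rightarrow> 'a)" where
  "sum_incl I A i x = (\<lambda>j\<in>I. if j = i then x else \<one>\<^bsub>A j\<^esub>)"

lemma sum_incl_hom:
  assumes g: "\<And>i. i \<in> I \<Longrightarrow> group (A i)" and i: "i \<in> I"
  shows "sum_incl I A i \<in> hom (A i) (sum_group I A)"
proof (rule homI)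
  have one: "\<one>\<^bsub>A j\<^esub> \<in> carrier (A j)" if "j \<in> I" for j
    using g[OF that] by (simp add: group.is_monoid)
  fix x assume x: "x \<in> carrier (A i)"
  have "finite {j \<in> I. sum_incl I A i x j \<noteq> \<one>\<^bsub>A j\<^esub>}"
    by (rule finite_subset[of _ "{i}"]) (auto simp: sum_incl_def)
  then show "sum_incl I A i x \<in> carrier (sum_group I A)"
    using x one by (auto simp: carrier_sum_group[OF g] sum_incl_def)
next
  fix x y assume "x \<in> carrier (A i)" "y \<in> carrier (A i)"
  then show "sum_incl I A i (x \<otimes>\<^bsub>A i\<^esub> y) = sum_incl I A i x \<otimes>\<^bsub>sum_group I A\<^esub> sum_incl I A i y"
    using g by (auto simp: sum_incl_def fun_eq_iff group.is_monoid monoid.l_one)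
qed

lemma sum_proj_hom:
  assumes g: "\<And>i. i \<in> I \<Longrightarrow> group (A i)" and i: "i \<in> I"
  shows "(\<lambda>x. x i) \<in> hom (sum_group I A) (A i)"
  using i by (intro homI) (auto simp: carrier_sum_group[OF g])

text \<open>Finite support makes \<open>x\<close> a finite product of its included coordinates; the
  induction erases one coordinate of a finite set containing the support at a time.\<close>

lemma sum_group_mem_subgroup:
  assumes g: "\<And>i. i \<in> I \<Longrightarrow> group (A i)" and N: "subgroup N (sum_group I A)"
    and x: "x \<in> carrier (sum_group I A)" "\<And>i. i \<in> I \<Longrightarrow> sum_incl I A i (x i) \<in> N"
  shows "x \<in> N"
proof -
  have "x \<in> N" if "finite F" "x \<in> carrier (sum_group I A)" "{i \<in> I. x i \<noteq> \<one>\<^bsub>A i\<^esub>} \<subseteq> F"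
    "\<And>i. i \<in> I \<Longrightarrow> sum_incl I A i (x i) \<in> N" for F x
    using that
  proof (induction F arbitrary: x rule: finite_induct)
    case empty
    then have "x = \<one>\<^bsub>sum_group I A\<^esub>" by (auto simp: carrier_sum_group[OF g] fun_eq_iff PiE_iff extensional_def)
    then show ?case using subgroup.one_closed[OF N] by metis
  next
    case (insert k F)
    show ?case
    proof (cases "k \<in> I")
      case False
      then show ?thesis using insert.IH[OF insert.prems(1)] insert.prems by blast
    next
      case k: True
      have xc: "x \<in> extensional I" "\<And>i. i \<in> I \<Longrightarrow> x i \<in> carrier (A i)" "finite {i \<in> I. x i \<noteq> \<one>\<^bsub>A i\<^esub>}"
        using insert.prems(1) by (auto simp: carrier_sum_group[OF g] PiE_iff)
      have mon: "\<And>i. i \<in> I \<Longrightarrow> monoid (A i)" using g group.is_monoid by blast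
      define y where "y = x(k := \<one>\<^bsub>A k\<^esub>)"
      have one_incl: "sum_incl I A k \<one>\<^bsub>A k\<^esub> = \<one>\<^bsub>sum_group I A\<^esub>" by (auto simp: sum_incl_def)
      have y: "y \<in> N"
      proof (rule insert.IH)
        have "finite {i \<in> I. y i \<noteq> \<one>\<^bsub>A i\<^esub>}"
          by (rule finite_subset[OF _ xc(3)]) (auto simp: y_def)
        then show "y \<in> carrier (sum_group I A)"
          using xc k mon by (auto simp: carrier_sum_group[OF g] y_def PiE_iff extensional_def monoid.one_closed)
        show "{i \<in> I. y i \<noteq> \<one>\<^bsub>A i\<^esub>} \<subseteq> F" using insert.prems(2) by (auto simp: y_def)
        show "sum_incl I A i (y i) \<in> N" if "i \<in> I" for i
          using insert.prems(3)[OF that] one_incl subgroup.one_closed[OF N] by (auto simp: y_def)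
      qed
      have "x = sum_incl I A k (x k) \<otimes>\<^bsub>sum_group I A\<^esub> y"
      proof
        fix j show "x j = (sum_incl I A k (x k) \<otimes>\<^bsub>sum_group I A\<^esub> y) j"
          using xc mon k by (cases "j \<in> I") (auto simp: sum_incl_def y_def extensional_def monoid.l_one monoid.r_one)
      qed
      then show ?thesis using subgroup.m_closed[OF N insert.prems(3)[OF k] y] by metis
    qed
  qed
  from this[OF _ x(1) subset_refl x(2)] show ?thesis using x(1) by (auto simp: carrier_sum_group[OF g])
qed

text \<open>Generators of the summands of kind \<open>t\<close> yield \<open>u\<close> in the source
  and \<open>v\<close> in the target. In the subquotient of the target, \<open>v\<close> is spanning
  because the invariant is additive, and the image of \<open>u\<close> is independent because the
  embedding is pure; an independent family injects into a spanning one.\<close>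

lemma pure_embedding_kind_injection:
  fixes A :: "'i \<Rightarrow> ('a, 'm) monoid_scheme" and B :: "'j \<Rightarrow> ('b, 'n) monoid_scheme"
  assumes A: "\<And>i. i \<in> I \<Longrightarrow> comm_group (A i)" and B: "\<And>j. j \<in> J \<Longrightarrow> comm_group (B j)"
    and kB: "\<And>j. j \<in> J \<Longrightarrow> \<exists>s. has_kind (B j) s"
    and f: "pure_embedding (sum_group I A) (sum_group J B) f" and t: "valid_kind t"
  shows "\<exists>h. inj_on h {i \<in> I. has_kind (A i) t} \<and>
           h ` {i \<in> I. has_kind (A i) t} \<subseteq> {j \<in> J. has_kind (B j) t}"
proof -
  have gA: "\<And>i. i \<in> I \<Longrightarrow> group (A i)" and gB: "\<And>j. j \<in> J \<Longrightarrow> group (B j)"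
    using A B comm_group.axioms(2) by blast+
  define It where "It = {i \<in> I. has_kind (A i) t}"
  define Jt where "Jt = {j \<in> J. has_kind (B j) t}"
  let ?H = "sum_group I A" and ?G = "sum_group J B" and ?p = "kind_char t"
  interpret H: comm_group ?H by (rule comm_group_sum_group[OF A])
  interpret G: comm_group ?G by (rule comm_group_sum_group[OF B])
  interpret G: elementary_section ?G ?p "kind_top ?G t" "kind_bot ?G t"
    by (rule G.elementary_section_kind[OF t])
  have hom: "f \<in> hom ?H ?G" using f by (simp add: pure_embedding_def)
  have "\<exists>e. kind_generator (A i) t e" if "i \<in> It" for i
    using comm_group.has_kind_generator[OF A] that unfolding It_def by blast
  then obtain a where a: "\<And>i. i \<in> It \<Longrightarrow> kind_generator (A i) t (a i)" by metis
  have "\<exists>e. kind_generator (B j) t e" if "j \<in> Jt" for j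
    using comm_group.has_kind_generator[OF B] that unfolding Jt_def by blast
  then obtain b where b: "\<And>j. j \<in> Jt \<Longrightarrow> kind_generator (B j) t (b j)" by metis
  define u where "u i = sum_incl I A i (a i)" for i
  define v where "v j = sum_incl J B j (b j)" for j
  have u_top: "u i \<in> kind_top ?H t" if "i \<in> It" for i
    using a[OF that] that hom_kind_top[OF sum_incl_hom[OF gA] gA H.is_group]
    unfolding u_def kind_generator_def It_def by blast
  have v_top: "v j \<in> kind_top ?G t" if "j \<in> Jt" for j
    using b[OF that] that hom_kind_top[OF sum_incl_hom[OF gB] gB G.is_group]
    unfolding v_def kind_generator_def Jt_def by blast
  have uc: "u i \<in> carrier ?H" if "i \<in> It" for i
    using subgroup.mem_carrier[OF H.subgroup_kind_top u_top[OF that]] .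
  have spans: "kind_top ?G t \<subseteq> G.rspan (v ` Jt)"
  proof
    fix x assume x: "x \<in> kind_top ?G t"
    have xc: "x \<in> carrier ?G" using G.P_carrier[OF x] .
    show "x \<in> G.rspan (v ` Jt)"
    \<comment> \<open>As the relative span is a subgroup, it suffices to place the included
      coordinates of \<open>x\<close> in it, which is a question about a single summand.\<close>
    proof (rule sum_group_mem_subgroup[OF gB G.subgroup_span xc])
      fix j assume j: "j \<in> J"
      interpret Bj: comm_group "B j" by (rule B[OF j])
      have hj: "sum_incl J B j \<in> hom (B j) ?G" by (rule sum_incl_hom[OF gB j])
      let ?y = "sum_incl J B j (x j)"
      have xj: "x j \<in> kind_top (B j) t" using hom_kind_top[OF sum_proj_hom[OF gB j] G.is_group gB[OF j] x] .
      then have xjc: "x j \<in> carrier (B j)" using subgroup.mem_carrier[OF Bj.subgroup_kind_top] by metis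
      have y: "?y \<in> kind_top ?G t" using hom_kind_top[OF hj gB[OF j] G.is_group xj] .
      let ?N = "generate ?G (v ` Jt \<inter> kind_top ?G t \<union> kind_bot ?G t)"
      show "?y \<in> G.rspan (v ` Jt)"
      proof (cases "has_kind (B j) t")
        case True
        then have jt: "j \<in> Jt" using j by (simp add: Jt_def)
        then obtain m where m: "\<not> ?p dvd m" "x j [^]\<^bsub>B j\<^esub> m \<in> cyclic (B j) (b j) <#>\<^bsub>B j\<^esub> kind_bot (B j) t"
          using b[OF jt] xj unfolding kind_generator_def by blast
        then obtain k :: int and c where c: "c \<in> kind_bot (B j) t" "x j [^]\<^bsub>B j\<^esub> m = b j [^]\<^bsub>B j\<^esub> k \<otimes>\<^bsub>B j\<^esub> c"
          by (auto elim!: set_multE simp: cyclic_def)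
        have bc: "b j \<in> carrier (B j)"
          using b[OF jt] subgroup.mem_carrier[OF Bj.subgroup_kind_top] unfolding kind_generator_def by blast
        have cc: "c \<in> carrier (B j)" using subgroup.mem_carrier[OF Bj.subgroup_kind_bot c(1)] .
        have "?y [^]\<^bsub>?G\<^esub> m = sum_incl J B j (x j [^]\<^bsub>B j\<^esub> m)"
          using hom_int_pow[OF hj xjc gB[OF j] G.is_group] by simp
        also have "\<dots> = v j [^]\<^bsub>?G\<^esub> k \<otimes>\<^bsub>?G\<^esub> sum_incl J B j c"
          unfolding c(2) v_def
          using hom_mult[OF hj, of "b j [^]\<^bsub>B j\<^esub> k" c] hom_int_pow[OF hj bc gB[OF j] G.is_group, of k] bc cc
          by simp
        also have "\<dots> \<in> ?N"
        proof (rule generate.eng)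
          have "v j \<in> ?N" using jt v_top[OF jt] by (auto intro: generate.incl)
          then show "v j [^]\<^bsub>?G\<^esub> k \<in> ?N" by (rule G.subgroup_int_pow_closed[OF G.generate_subgroup])
          show "sum_incl J B j c \<in> ?N"
            using hom_kind_bot[OF hj gB[OF j] G.is_group c(1)] by (auto intro: generate.incl)
        qed
        finally show ?thesis by (rule G.spanI[OF y m(1)])
      next
        case False
        obtain s where s: "has_kind (B j) s" using kB[OF j] by blast
        then have "t \<noteq> s" using False by blast
        \<comment> \<open>A summand of another kind contributes nothing, its top being contained in
          its bottom.\<close>
        then have "x j \<in> kind_bot (B j) t"
          using Bj.has_kind_concentrated[OF s] t xj unfolding kind_concentrated_def by blast
        then have "?y \<in> kind_bot ?G t" using hom_kind_bot[OF hj gB[OF j] G.is_group] by blast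
        then have "?y \<in> ?N" by (auto intro: generate.incl)
        then have "?y [^]\<^bsub>?G\<^esub> (1::int) \<in> ?N" by (rule G.subgroup_int_pow_closed[OF G.generate_subgroup])
        then show ?thesis by (rule G.spanI[OF y G.not_dvd_one])
      qed
    qed
  qed
  have indep: "f (u i) \<notin> G.rspan ((\<lambda>i. f (u i)) ` (It - {i}))" if i: "i \<in> It" for i
  proof
    assume "f (u i) \<in> G.rspan ((\<lambda>i. f (u i)) ` (It - {i}))"
    then obtain m where m: "\<not> ?p dvd m"
      "f (u i) [^]\<^bsub>?G\<^esub> m \<in> generate ?G ((\<lambda>i. f (u i)) ` (It - {i}) \<inter> kind_top ?G t \<union> kind_bot ?G t)"
      unfolding relative_span_def by blast
    have iI: "i \<in> I" using i by (simp add: It_def)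
    interpret Ai: comm_group "A i" by (rule A[OF iI])
    have proj: "(\<lambda>x. x i) \<in> hom ?H (A i)" by (rule sum_proj_hom[OF gA iI])
    interpret proj: group_hom ?H "A i" "\<lambda>x. x i"
      using proj by (simp add: group_hom_def group_hom_axioms_def)
    interpret f: group_hom ?H ?G f using hom by (simp add: group_hom_def group_hom_axioms_def)
    \<comment> \<open>The kernel of the i-th projection contains all other \<open>u i'\<close>.
      Replacing their span by this subgroup avoids explicit linear combinations.\<close>
    define N where "N = kernel ?H (A i) (\<lambda>x. x i)"
    have N: "subgroup N ?H" unfolding N_def by (rule proj.subgroup_kernel)
    have fN: "subgroup (f ` N) ?G" by (rule f.subgroup_img_is_subgroup[OF N])
    have sub: "subgroup (f ` N <#>\<^bsub>?G\<^esub> kind_bot ?G t) ?G"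
      by (rule G.mult_subgroups[OF fN G.subgroup_kind_bot])
    have "f (u i') \<in> f ` N" if i': "i' \<in> It - {i}" for i'
    proof -
      have "u i' i = \<one>\<^bsub>A i\<^esub>" using i' iI by (auto simp: u_def sum_incl_def)
      then show ?thesis using uc i' unfolding N_def kernel_def by blast
    qed
    then have "(\<lambda>i. f (u i)) ` (It - {i}) \<inter> kind_top ?G t \<union> kind_bot ?G t \<subseteq> f ` N <#>\<^bsub>?G\<^esub> kind_bot ?G t"
      using G.set_mult_upper1[OF fN G.subgroup_kind_bot] G.set_mult_upper2[OF fN G.subgroup_kind_bot] by blast
    then have "f (u i) [^]\<^bsub>?G\<^esub> m \<in> f ` N <#>\<^bsub>?G\<^esub> kind_bot ?G t"
      using G.generate_subgroup_incl[OF _ sub] m(2) by blast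
    then obtain n c where n: "n \<in> N" "c \<in> kind_bot ?G t" "f (u i) [^]\<^bsub>?G\<^esub> m = f n \<otimes>\<^bsub>?G\<^esub> c"
      by (auto elim!: set_multE)
    have nc: "n \<in> carrier ?H" and ni: "n i = \<one>\<^bsub>A i\<^esub>" using n(1) by (auto simp: N_def kernel_def)
    have cc: "c \<in> carrier ?G" using subgroup.mem_carrier[OF G.subgroup_kind_bot n(2)] .
    \<comment> \<open>The relation pulled back to the source: \<open>f w\<close> is
      \<open>c\<close>, which is in the bottom, so purity puts \<open>w\<close> into the bottom of
      the source. Its i-th coordinate is \<open>a i [^] m\<close>, and this forces the
      characteristic to divide \<open>m\<close>.\<close>
    define w where "w = inv\<^bsub>?H\<^esub> n \<otimes>\<^bsub>?H\<^esub> u i [^]\<^bsub>?H\<^esub> m"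
    have wc: "w \<in> carrier ?H" unfolding w_def using nc uc[OF i] by (intro H.m_closed H.inv_closed H.int_pow_closed)
    have "f w = inv\<^bsub>?G\<^esub> f n \<otimes>\<^bsub>?G\<^esub> f (u i) [^]\<^bsub>?G\<^esub> m"
      unfolding w_def using f.hom_mult[OF H.inv_closed[OF nc] H.int_pow_closed[OF uc[OF i]]]
        f.hom_inv[OF nc] f.hom_int_pow[OF uc[OF i]] by metis
    also have "\<dots> = inv\<^bsub>?G\<^esub> f n \<otimes>\<^bsub>?G\<^esub> (f n \<otimes>\<^bsub>?G\<^esub> c)" unfolding n(3) ..
    also have "\<dots> = c"
      using G.m_assoc[OF G.inv_closed[OF f.hom_closed[OF nc]] f.hom_closed[OF nc] cc]
        G.l_inv[OF f.hom_closed[OF nc]] G.l_one[OF cc] by metis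
    finally have "w \<in> kind_bot ?H t"
      using pure_embedding_kind_bot[OF H.comm_group_axioms G.comm_group_axioms f wc] n(2) by metis
    then have "w i \<in> kind_bot (A i) t" using hom_kind_bot[OF proj H.is_group gA[OF iI]] by blast
    moreover have "w i = a i [^]\<^bsub>A i\<^esub> m"
    proof -
      have ui: "u i i = a i" using iI by (simp add: u_def sum_incl_def)
      have "w i = inv\<^bsub>A i\<^esub> (n i) \<otimes>\<^bsub>A i\<^esub> (u i i) [^]\<^bsub>A i\<^esub> m"
        unfolding w_def using proj.hom_mult[OF H.inv_closed[OF nc] H.int_pow_closed[OF uc[OF i]]]
          proj.hom_inv[OF nc] proj.hom_int_pow[OF uc[OF i]] by metis
      then show ?thesis using ni ui proj.hom_closed[OF uc[OF i]] by simp
    qed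
    ultimately have "?p dvd m" using a[OF i] unfolding kind_generator_def by simp
    then show False using m(1) by blast
  qed
  have "\<exists>h. inj_on h It \<and> h ` It \<subseteq> Jt"
  proof (rule independent_family_injects[of "relative_span ?G ?p (kind_top ?G t) (kind_bot ?G t)" It "\<lambda>i. f (u i)" v Jt])
    show "G.rspan S \<subseteq> G.rspan T" if "S \<subseteq> T" for S T by (rule G.span_mono[OF that])
    show "\<exists>F\<subseteq>S. finite F \<and> x \<in> G.rspan F" if "x \<in> G.rspan S" for x S by (rule G.span_finitary[OF that])
    show "y \<in> G.rspan (insert x S)" if "x \<in> G.rspan (insert y S)" "x \<notin> G.rspan S" for x y S
      by (rule G.span_exchange[OF that])
    show "G.rspan (insert y S) \<subseteq> G.rspan S" if "y \<in> G.rspan S" for y S by (rule G.span_absorb[OF that])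
    show "f (u i) \<notin> G.rspan ((\<lambda>i. f (u i)) ` (It - {i}))" if "i \<in> It" for i by (rule indep[OF that])
    show "f (u i) \<in> G.rspan (v ` Jt)" if "i \<in> It" for i
      using spans hom_kind_top[OF hom H.is_group G.is_group u_top[OF that]] by blast
  qed
  then show ?thesis unfolding It_def Jt_def .
qed

section \<open>Reindexing direct sums and transporting pure embeddings\<close>

lemma sum_group_reindex_iso:
  fixes B :: "'j \<Rightarrow> ('b, 'n) monoid_scheme" and h :: "'i \<Rightarrow> 'j"
  assumes g: "\<And>j. j \<in> J \<Longrightarrow> group (B j)" and h: "bij_betw h I J"
  shows "sum_group J B \<cong> sum_group I (\<lambda>i. B (h i))"
proof -
  have hJ: "h i \<in> J" if "i \<in> I" for i using that h bij_betwE by blast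
  have g': "\<And>i. i \<in> I \<Longrightarrow> group (B (h i))" using g hJ by blast
  have inj: "inj_on h I" and im: "h ` I = J" using h by (auto simp: bij_betw_def)
  define F where "F y = (\<lambda>i\<in>I. y (h i))" for y :: "'j \<Rightarrow> 'b"
  have "F \<in> iso (sum_group J B) (sum_group I (\<lambda>i. B (h i)))"
  proof (rule isoI)
    show "F \<in> hom (sum_group J B) (sum_group I (\<lambda>i. B (h i)))"
    proof (rule homI)
      fix y assume y: "y \<in> carrier (sum_group J B)"
      have "h ` {i \<in> I. y (h i) \<noteq> \<one>\<^bsub>B (h i)\<^esub>} \<subseteq> {j \<in> J. y j \<noteq> \<one>\<^bsub>B j\<^esub>}" using hJ by auto
      then have "finite (h ` {i \<in> I. y (h i) \<noteq> \<one>\<^bsub>B (h i)\<^esub>})"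
        using y finite_subset by (auto simp: carrier_sum_group[OF g])
      then have "finite {i \<in> I. y (h i) \<noteq> \<one>\<^bsub>B (h i)\<^esub>}"
        by (rule finite_imageD) (rule inj_on_subset[OF inj], blast)
      moreover have "{i \<in> I. F y i \<noteq> \<one>\<^bsub>B (h i)\<^esub>} = {i \<in> I. y (h i) \<noteq> \<one>\<^bsub>B (h i)\<^esub>}" by (auto simp: F_def)
      ultimately show "F y \<in> carrier (sum_group I (\<lambda>i. B (h i)))"
        using y hJ by (auto simp: carrier_sum_group[OF g] carrier_sum_group[OF g'] F_def)
    qed (use hJ in \<open>auto simp: F_def fun_eq_iff\<close>)
    show "bij_betw F (carrier (sum_group J B)) (carrier (sum_group I (\<lambda>i. B (h i))))"
    proof (rule bij_betw_imageI)
      show "inj_on F (carrier (sum_group J B))"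
      proof (rule inj_onI)
        fix y z assume yz: "y \<in> carrier (sum_group J B)" "z \<in> carrier (sum_group J B)" "F y = F z"
        have "y j = z j" if j: "j \<in> J" for j
        proof -
          obtain i where "i \<in> I" "j = h i" using j im by blast
          then show ?thesis using fun_cong[OF yz(3), of i] by (simp add: F_def)
        qed
        then show "y = z" using yz(1,2) by (auto simp: carrier_sum_group[OF g] intro: PiE_ext)
      qed
      show "F ` carrier (sum_group J B) = carrier (sum_group I (\<lambda>i. B (h i)))"
      proof
        show "F ` carrier (sum_group J B) \<subseteq> carrier (sum_group I (\<lambda>i. B (h i)))"
          using \<open>F \<in> hom _ _\<close> by (auto simp: hom_def)
        show "carrier (sum_group I (\<lambda>i. B (h i))) \<subseteq> F ` carrier (sum_group J B)"
        proof
          fix x assume x: "x \<in> carrier (sum_group I (\<lambda>i. B (h i)))"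
          define y where "y = (\<lambda>j\<in>J. x (inv_into I h j))"
          have yh: "y (h i) = x i" if "i \<in> I" for i using that hJ inj by (simp add: y_def inv_into_f_f)
          have "{j \<in> J. y j \<noteq> \<one>\<^bsub>B j\<^esub>} \<subseteq> h ` {i \<in> I. x i \<noteq> \<one>\<^bsub>B (h i)\<^esub>}"
            using yh im by (auto simp: image_iff)
          moreover have "finite (h ` {i \<in> I. x i \<noteq> \<one>\<^bsub>B (h i)\<^esub>})" using x by (auto simp: carrier_sum_group[OF g'])
          ultimately have "finite {j \<in> J. y j \<noteq> \<one>\<^bsub>B j\<^esub>}" by (rule finite_subset)
          moreover have "y \<in> (\<Pi>\<^sub>E j\<in>J. carrier (B j))"
          proof
            fix j assume "j \<in> J"
            then obtain i where i: "i \<in> I" "j = h i" using im by blast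
            have "x i \<in> carrier (B (h i))" using x i(1) by (auto simp: carrier_sum_group[OF g'])
            then show "y j \<in> carrier (B j)" using yh[OF i(1)] i(2) by simp
          qed (simp add: y_def)
          ultimately have yc: "y \<in> carrier (sum_group J B)" by (simp add: carrier_sum_group[OF g])
          have "F y = x"
          proof
            fix i show "F y i = x i"
              using x yh by (cases "i \<in> I") (auto simp: F_def carrier_sum_group[OF g'] PiE_iff extensional_def)
          qed
          then show "x \<in> F ` carrier (sum_group J B)" using yc by blast
        qed
      qed
    qed
  qed
  then show ?thesis by (auto simp: is_iso_def)
qed

lemma pure_embedding_iso:
  assumes "group G" "group H" "f \<in> iso G H"
  shows "pure_embedding G H f"
proof -
  have "f ` carrier G = carrier H" "inj_on f (carrier G)" "f \<in> hom G H"
    using assms(3) by (auto simp: iso_def bij_betw_def)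
  then show ?thesis
    using group.subgroup_self[OF assms(2)] by (auto simp: pure_embedding_def pure_subgroup_def)
qed

text \<open>A root in \<open>C\<close> of an element coming from \<open>A\<close> moves into the
  image of \<open>B\<close> by purity of \<open>g\<close>, back to \<open>B\<close> by injectivity
  of \<open>g\<close>, and into the image of \<open>A\<close> by purity of \<open>f\<close>.\<close>

lemma pure_embedding_compose:
  assumes gr: "group A" "group B" "group C" and f: "pure_embedding A B f" and g: "pure_embedding B C g"
  shows "pure_embedding A C (g \<circ> f)"
proof -
  have hf: "f \<in> hom A B" "inj_on f (carrier A)" "pure_subgroup (f ` carrier A) B"
    and hg: "g \<in> hom B C" "inj_on g (carrier B)" "pure_subgroup (g ` carrier B) C"
    using f g by (auto simp: pure_embedding_def)
  have fc: "f x \<in> carrier B" if "x \<in> carrier A" for x using hom_in_carrier[OF hf(1) that] .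
  have hom: "g \<circ> f \<in> hom A C" by (rule hom_compose[OF hf(1) hg(1)])
  have inj: "inj_on (g \<circ> f) (carrier A)"
    by (rule comp_inj_on[OF hf(2)]) (rule inj_on_subset[OF hg(2)], use fc in blast)
  interpret gf: group_hom A C "g \<circ> f"
    using hom gr by (simp add: group_hom_def group_hom_axioms_def)
  have "\<exists>y\<in>(g \<circ> f) ` carrier A. y [^]\<^bsub>C\<^esub> n = c"
    if c: "c \<in> (g \<circ> f) ` carrier A" and ex: "\<exists>x\<in>carrier C. x [^]\<^bsub>C\<^esub> n = c" for c and n :: nat
  proof -
    obtain a where a: "a \<in> carrier A" "c = g (f a)" using c by auto
    have "c \<in> g ` carrier B" using a fc by blast
    then have "\<exists>y\<in>g ` carrier B. y [^]\<^bsub>C\<^esub> n = c" using hg(3) ex by (simp only: pure_subgroup_def)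
    then obtain b where b: "b \<in> carrier B" "g b [^]\<^bsub>C\<^esub> n = g (f a)" using a by blast
    have "g (b [^]\<^bsub>B\<^esub> n) = g (f a)" using hom_nat_pow[OF hg(1) b(1) gr(2,3), of n] b(2) by simp
    moreover have "b [^]\<^bsub>B\<^esub> n \<in> carrier B" using b(1) gr(2) by (simp add: group.is_monoid monoid.nat_pow_closed)
    ultimately have "b [^]\<^bsub>B\<^esub> n = f a" using inj_onD[OF hg(2)] fc[OF a(1)] by blast
    then have "\<exists>x\<in>carrier B. x [^]\<^bsub>B\<^esub> n = f a" using b(1) by blast
    then have "\<exists>y\<in>f ` carrier A. y [^]\<^bsub>B\<^esub> n = f a"
      using hf(3) imageI[OF a(1), of f] by (simp only: pure_subgroup_def)
    then obtain a' where a': "a' \<in> carrier A" "f a' [^]\<^bsub>B\<^esub> n = f a" by blast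
    have "(g \<circ> f) a' [^]\<^bsub>C\<^esub> n = c"
      using hom_nat_pow[OF hg(1) fc[OF a'(1)] gr(2,3), of n] a'(2) a(2) by simp
    then show ?thesis using a'(1) by blast
  qed
  then show ?thesis
    using hom inj gf.img_is_subgroup unfolding pure_embedding_def pure_subgroup_def by blast
qed

lemma pure_embedding_transfer_iso:
  assumes G: "group G" "group H" "group G'" "group H'" and iso: "G \<cong> G'" "H \<cong> H'" and f: "pure_embedding G H f"
  shows "\<exists>f'. pure_embedding G' H' f'"
proof -
  obtain i where i: "i \<in> iso G' G" using group.iso_sym[OF G(1) iso(1)] by (auto simp: is_iso_def)
  obtain j where j: "j \<in> iso H H'" using iso(2) by (auto simp: is_iso_def)
  show ?thesis
    using pure_embedding_compose[OF G(3) G(2) G(4)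
        pure_embedding_compose[OF G(3,1,2) pure_embedding_iso[OF G(3,1) i] f] pure_embedding_iso[OF G(2,4) j]]
    by blast
qed

theorem theorem3p3:
  fixes G\<^sub>0 :: "'g monoid" and G\<^sub>1 :: "'h monoid"
    and I\<^sub>0 :: "'i set" and A\<^sub>0 :: "'i \<Rightarrow> 'a monoid"
    and I\<^sub>1 :: "'j set" and A\<^sub>1 :: "'j \<Rightarrow> 'b monoid"
  assumes "comm_group G\<^sub>0" and "comm_group G\<^sub>1"
    and "\<And>i. i \<in> I\<^sub>0 \<Longrightarrow> comm_group (A\<^sub>0 i) \<and> indecomposable (A\<^sub>0 i) \<and> pure_injective (A\<^sub>0 i)"
    and "G\<^sub>0 \<cong> sum_group I\<^sub>0 A\<^sub>0"
    and "\<And>j. j \<in> I\<^sub>1 \<Longrightarrow> comm_group (A\<^sub>1 j) \<and> indecomposable (A\<^sub>1 j) \<and> pure_injective (A\<^sub>1 j)"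
    and "G\<^sub>1 \<cong> sum_group I\<^sub>1 A\<^sub>1"
    and "\<exists>f. pure_embedding G\<^sub>0 G\<^sub>1 f"
    and "\<exists>g. pure_embedding G\<^sub>1 G\<^sub>0 g"
  shows "G\<^sub>0 \<cong> G\<^sub>1"
proof -
  have cA: "\<And>i. i \<in> I\<^sub>0 \<Longrightarrow> comm_group (A\<^sub>0 i)" and cB: "\<And>j. j \<in> I\<^sub>1 \<Longrightarrow> comm_group (A\<^sub>1 j)"
    using assms(3,5) by blast+
  have gA: "\<And>i. i \<in> I\<^sub>0 \<Longrightarrow> group (A\<^sub>0 i)" and gB: "\<And>j. j \<in> I\<^sub>1 \<Longrightarrow> group (A\<^sub>1 j)"
    using cA cB comm_group.axioms(2) by blast+
  have g: "group G\<^sub>0" "group G\<^sub>1" using assms(1,2) comm_group.axioms(2) by blast+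
  note gS = sum_group[OF gA] sum_group[OF gB]
  have kA: "\<exists>t. has_kind (A\<^sub>0 i) t" if "i \<in> I\<^sub>0" for i
    using comm_group.indecomposable_pure_injective_has_kind assms(3)[OF that] by blast
  have kB: "\<exists>t. has_kind (A\<^sub>1 j) t" if "j \<in> I\<^sub>1" for j
    using comm_group.indecomposable_pure_injective_has_kind assms(5)[OF that] by blast
  obtain f where f: "pure_embedding (sum_group I\<^sub>0 A\<^sub>0) (sum_group I\<^sub>1 A\<^sub>1) f"
    using pure_embedding_transfer_iso[OF g gS assms(4,6)] assms(7) by blast
  obtain f' where f': "pure_embedding (sum_group I\<^sub>1 A\<^sub>1) (sum_group I\<^sub>0 A\<^sub>0) f'"
    using pure_embedding_transfer_iso[OF g(2,1) gS(2,1) assms(6,4)] assms(8) by blast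
  define It where "It t = {i \<in> I\<^sub>0. has_kind (A\<^sub>0 i) t}" for t
  define Jt where "Jt t = {j \<in> I\<^sub>1. has_kind (A\<^sub>1 j) t}" for t
  have "\<exists>h. bij_betw h (It t) (Jt t)" for t
  proof (cases "valid_kind t")
    case True
    obtain h where h: "inj_on h (It t)" "h ` It t \<subseteq> Jt t"
      using pure_embedding_kind_injection[OF cA cB kB f True] unfolding It_def Jt_def by blast
    obtain h' where h': "inj_on h' (Jt t)" "h' ` Jt t \<subseteq> It t"
      using pure_embedding_kind_injection[OF cB cA kA f' True] unfolding It_def Jt_def by blast
    show ?thesis by (rule Schroeder_Bernstein[OF h h'])
  next
    case False
    then have "It t = {}" "Jt t = {}" using has_kind_valid unfolding It_def Jt_def by blast+
    then show ?thesis by (simp add: bij_betw_def)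
  qed
  then obtain h where h: "\<And>t. bij_betw (h t) (It t) (Jt t)" by metis
  obtain \<kappa> where \<kappa>: "\<And>i. i \<in> I\<^sub>0 \<Longrightarrow> has_kind (A\<^sub>0 i) (\<kappa> i)" using kA by metis
  \<comment> \<open>The bijections for the separate kinds are glued along the kind of each index.
    Uniqueness of the kind makes the result injective across kinds and makes it hit every index of
    \<phi>'s target.\<close>
  define \<phi> where "\<phi> i = h (\<kappa> i) i" for i
  have \<phi>: "\<phi> i \<in> I\<^sub>1" "has_kind (A\<^sub>1 (\<phi> i)) (\<kappa> i)" if "i \<in> I\<^sub>0" for i
  proof -
    have "i \<in> It (\<kappa> i)" using that \<kappa> by (simp add: It_def)
    then have "\<phi> i \<in> Jt (\<kappa> i)" using bij_betwE[OF h] by (simp add: \<phi>_def)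
    then show "\<phi> i \<in> I\<^sub>1" "has_kind (A\<^sub>1 (\<phi> i)) (\<kappa> i)" by (auto simp: Jt_def)
  qed
  have bij: "bij_betw \<phi> I\<^sub>0 I\<^sub>1"
  proof (rule bij_betwI')
    fix i i' assume i: "i \<in> I\<^sub>0" "i' \<in> I\<^sub>0"
    show "(\<phi> i = \<phi> i') = (i = i')"
    proof
      assume eq: "\<phi> i = \<phi> i'"
      then have k: "\<kappa> i = \<kappa> i'"
        using comm_group.has_kind_unique[OF cB[OF \<phi>(1)[OF i(1)]]] \<phi>(2)[OF i(1)] \<phi>(2)[OF i(2)] by metis
      have "i \<in> It (\<kappa> i)" "i' \<in> It (\<kappa> i)" using i \<kappa>[OF i(1)] \<kappa>[OF i(2)] k by (simp_all add: It_def)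
      then show "i = i'" using h[of "\<kappa> i"] eq k unfolding bij_betw_def \<phi>_def by (metis inj_onD)
    qed simp
  next
    fix j assume j: "j \<in> I\<^sub>1"
    then obtain t where "j \<in> Jt t" using kB unfolding Jt_def by blast
    then obtain i where i: "i \<in> It t" "j = h t i" using h[of t] unfolding bij_betw_def by blast
    then have "i \<in> I\<^sub>0" "\<kappa> i = t" using comm_group.has_kind_unique[OF cA] \<kappa> unfolding It_def by blast+
    then show "\<exists>i\<in>I\<^sub>0. j = \<phi> i" using i(2) by (auto simp: \<phi>_def)
  qed (rule \<phi>(1))
  have "A\<^sub>0 i \<cong> A\<^sub>1 (\<phi> i)" if "i \<in> I\<^sub>0" for i
    by (rule same_kind_iso[OF cA[OF that] \<kappa>[OF that] cB[OF \<phi>(1)[OF that]] \<phi>(2)[OF that]])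
  then have iso1: "sum_group I\<^sub>0 A\<^sub>0 \<cong> sum_group I\<^sub>0 (\<lambda>i. A\<^sub>1 (\<phi> i))"
    by (intro iso_sum_groupI gA gB \<phi>(1)) auto
  have iso2: "sum_group I\<^sub>0 (\<lambda>i. A\<^sub>1 (\<phi> i)) \<cong> sum_group I\<^sub>1 A\<^sub>1"
    using group.iso_sym[OF gS(2) sum_group_reindex_iso[OF gB bij]] .
  have iso3: "sum_group I\<^sub>1 A\<^sub>1 \<cong> G\<^sub>1" using group.iso_sym[OF g(2) assms(6)] .
  show ?thesis by (rule iso_trans[OF assms(4) iso_trans[OF iso1 iso_trans[OF iso2 iso3]]])
qed

end
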